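(* Let $(X,\|\cdot\|)$ be a finite dimensional normed space, $1\le m\le\dim X-1$ an integer, assume that $(X,\|\cdot\|)$ admits density contractors of dimension $m$, and let $\boldsymbol\mu:W\mapsto\boldsymbol\mu_W$ be a choice of density contractors in dimension $m$. If $A\subset X$ is Borel and countably $(\mathcal H^m_{\|\cdot\|},m)$ rectifiable then $\mathcal G^m_{\boldsymbol\mu}(A)=\mathcal H^m_{\|\cdot\|}(A)$.
   Context: $\mathbf G_m(X)$ is the set of $m$-dimensional linear subspaces of $X$. $\mathcal H^m_{\|\cdot\|}$ is the $m$-dimensional Hausdorff measure on $X$ associated with the metric $\|x-y\|$, computed with weights $\alpha(m)2^{-m}(\mathrm{diam}\,E)^m$, where $\alpha(m)$ is the Lebesgue measure of the Euclidean unit ball of $\mathbf R^m$. A set $A$ is countably $(\mathcal H^m_{\|\cdot\|},m)$ rectifiable if $\mathcal H^m_{\|\cdot\|}$-almost all of $A$ is contained in the union of countably many Lipschitz images of bounded subsets of $\mathbf R^m$. $\mathrm{Hom}_m(X,X)$ is the (metric) space of linear maps $\pi:X\to X$ with $\mathrm{rank}\,\pi\le m$, and $\mathrm{Hom}(X,W)$ is the set of linear maps $\pi:X\to X$ with $\mathrm{im}\,\pi\subset W$. A density contractor on $W\in\mathbf G_m(X)$ (with respect to $\mathcal H^m_{\|\cdot\|}$) is a Borel probability measure $\mu$ on $\mathrm{Hom}_m(X,X)$ such that (1) $\mu(\mathrm{Hom}_m(X,X)\setminus\mathrm{Hom}(X,W))=0$; (2) for every $V\in\mathbf G_m(X)$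 and every Borel $A\subset V$, $\int_{\mathrm{Hom}_m(X,X)}\mathcal H^m_{\|\cdot\|}(\pi(A))\,d\mu(\pi)\le\mathcal H^m_{\|\cdot\|}(A)$, with equality when $V=W$. $(X,\|\cdot\|)$ admits density contractors of dimension $m$ if every $W\in\mathbf G_m(X)$ has a density contractor. A choice of density contractors in dimension $m$ is a map $\boldsymbol\mu$ assigning to each $W\in\mathbf G_m(X)$ a density contractor $\boldsymbol\mu_W$ on $W$ (no measurability in $W$ required). Gross measure: for Borel $A\subset X$, $\zeta_{\boldsymbol\mu}(A)=\sup_{W\in\mathbf G_m(X)}\int_{\mathrm{Hom}_m(X,X)}\mathcal H^m_{\|\cdot\|}(\pi(A))\,d\boldsymbol\mu_W(\pi)$. For $A\subset X$ and $0<\delta\le\infty$, $\mathcal G^m_{\boldsymbol\mu,\delta}(A)=\inf\sum_{j\in J}\zeta_{\boldsymbol\mu}(B_j)$, the infimum being over countable families $\{B_j:j\in J\}$ of Borel subsets of $X$ with $A\subset\bigcup_jB_j$ and $\mathrm{diam}\,B_j<\delta$; and $\mathcal G^m_{\boldsymbol\mu}(A)=\sup_{\delta>0}\mathcal G^m_{\boldsymbol\mu,\delta}(A)$. *)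

theory Defs
  imports "HOL-Probability.Probability"
begin

definition finite_dim :: "'a::real_vector itself \<Rightarrow> bool"
  where "finite_dim _ \<longleftrightarrow> (\<exists>B::'a set. finite B \<and> span B = UNIV)"

definition Grassmannian :: "nat \<Rightarrow> 'a::real_vector set set"
  where "Grassmannian m = {W. subspace W \<and> dim W = m}"

text \<open>The library's \<open>diameter\<close> is real-valued and unspecified on unbounded sets.\<close>

definition ediam :: "'a::metric_space set \<Rightarrow> ennreal"
  where "ediam E = (SUP x\<in>E. SUP y\<in>E. ennreal (dist x y))"

text \<open>Countable families, here and for the Gross measure, are sequences: a finite family is
  padded with the empty set, which has weight 0 (the case distinction matters only for
  \<open>m = 0\<close>). By \<open>content_ball\<close>, \<open>unit_ball_vol m\<close> is the Lebesgue measure of the Euclidean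
  unit ball of dimension \<open>m\<close>.\<close>

definition hausdorff_weight :: "nat \<Rightarrow> 'a::metric_space set \<Rightarrow> ennreal"
  where "hausdorff_weight m E =
    (if E = {} then 0 else ennreal (unit_ball_vol (real m) / 2 ^ m) * ediam E ^ m)"

definition hausdorff_delta :: "nat \<Rightarrow> ennreal \<Rightarrow> 'a::metric_space set \<Rightarrow> ennreal"
  where "hausdorff_delta m \<delta> A =
    (INF E\<in>{E::nat \<Rightarrow> 'a set. A \<subseteq> (\<Union>j. E j) \<and> (\<forall>j. ediam (E j) < \<delta>)}.
      \<Sum>j. hausdorff_weight m (E j))"

definition hausdorff_measure :: "nat \<Rightarrow> 'a::metric_space set \<Rightarrow> ennreal"
  where "hausdorff_measure m A = (SUP \<delta>\<in>{0<..}. hausdorff_delta m \<delta> A)"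

text \<open>The index type \<open>'m\<close> stands for the dimension \<open>m = CARD('m)\<close>, so that \<open>real ^ 'm\<close> is
  Euclidean \<open>m\<close>-space.\<close>

definition countably_rectifiable :: "'m::finite itself \<Rightarrow> 'a::metric_space set \<Rightarrow> bool"
  where "countably_rectifiable _ A \<longleftrightarrow>
    (\<exists>(S::nat \<Rightarrow> (real ^ 'm) set) (f::nat \<Rightarrow> real ^ 'm \<Rightarrow> 'a).
      (\<forall>j. bounded (S j) \<and> (\<exists>L. L-lipschitz_on (S j) (f j))) \<and>
      hausdorff_measure CARD('m) (A - (\<Union>j. f j ` S j)) = 0)"

text \<open>On a finite dimensional space every linear map is bounded, so \<open>'a \<Rightarrow>\<^sub>L 'a\<close> consists of all
  linear endomorphisms, metrized by the operator norm.\<close>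

definition Hom_rank :: "nat \<Rightarrow> ('a::real_normed_vector \<Rightarrow>\<^sub>L 'a) set"
  where "Hom_rank m = {\<pi>. dim (range (blinfun_apply \<pi>)) \<le> m}"

definition Hom_into :: "'a::real_normed_vector set \<Rightarrow> ('a \<Rightarrow>\<^sub>L 'a) set"
  where "Hom_into W = {\<pi>. range (blinfun_apply \<pi>) \<subseteq> W}"

text \<open>For Borel \<open>A\<close> the integrand \<open>\<pi> \<mapsto> hausdorff_measure m (\<pi> ` A)\<close> need only be measurable
  with respect to the completion of \<open>\<mu>\<close>; this is harmless by \<open>nn_integral_completion\<close>.\<close>

definition mean_projected_measure ::
    "nat \<Rightarrow> ('a::real_normed_vector \<Rightarrow>\<^sub>L 'a) measure \<Rightarrow> 'a set \<Rightarrow> ennreal"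
  where "mean_projected_measure m \<mu> A =
    (\<integral>\<^sup>+\<pi>. hausdorff_measure m (blinfun_apply \<pi> ` A) \<partial>\<mu>)"

text \<open>In finite dimension \<open>Hom_into W\<close> is closed for every subspace \<open>W\<close>, so the nullity condition
  concerns a measurable set.\<close>

definition density_contractor ::
    "nat \<Rightarrow> 'a::real_normed_vector set \<Rightarrow> ('a \<Rightarrow>\<^sub>L 'a) measure \<Rightarrow> bool"
  where "density_contractor m W \<mu> \<longleftrightarrow> W \<in> Grassmannian m \<and>
    sets \<mu> = sets (restrict_space borel (Hom_rank m)) \<and> prob_space \<mu> \<and>
    emeasure \<mu> (Hom_rank m - Hom_into W) = 0 \<and>
    (\<forall>V\<in>Grassmannian m. \<forall>A\<in>sets borel. A \<subseteq> V \<longrightarrow>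
      mean_projected_measure m \<mu> A \<le> hausdorff_measure m A) \<and>
    (\<forall>A\<in>sets borel. A \<subseteq> W \<longrightarrow> mean_projected_measure m \<mu> A = hausdorff_measure m A)"

definition admits_density_contractors :: "'a::real_normed_vector itself \<Rightarrow> nat \<Rightarrow> bool"
  where "admits_density_contractors _ m \<longleftrightarrow>
    (\<forall>W\<in>Grassmannian m. \<exists>\<mu>. density_contractor m (W::'a set) \<mu>)"

definition choice_of_density_contractors ::
    "nat \<Rightarrow> ('a::real_normed_vector set \<Rightarrow> ('a \<Rightarrow>\<^sub>L 'a) measure) \<Rightarrow> bool"
  where "choice_of_density_contractors m \<mu> \<longleftrightarrow>
    (\<forall>W\<in>Grassmannian m. density_contractor m W (\<mu> W))"

definition gross_zeta ::
    "nat \<Rightarrow> ('a::real_normed_vector set \<Rightarrow> ('a \<Rightarrow>\<^sub>L 'a) measure) \<Rightarrow> 'a set \<Rightarrow> ennreal"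
  where "gross_zeta m \<mu> A = (SUP W\<in>Grassmannian m. mean_projected_measure m (\<mu> W) A)"

definition gross_delta ::
    "nat \<Rightarrow> ('a::real_normed_vector set \<Rightarrow> ('a \<Rightarrow>\<^sub>L 'a) measure) \<Rightarrow> ennreal \<Rightarrow> 'a set \<Rightarrow> ennreal"
  where "gross_delta m \<mu> \<delta> A =
    (INF B\<in>{B::nat \<Rightarrow> 'a set. (\<forall>j. B j \<in> sets borel) \<and> A \<subseteq> (\<Union>j. B j) \<and> (\<forall>j. ediam (B j) < \<delta>)}.
      \<Sum>j. gross_zeta m \<mu> (B j))"

definition gross_measure ::
    "nat \<Rightarrow> ('a::real_normed_vector set \<Rightarrow> ('a \<Rightarrow>\<^sub>L 'a) measure) \<Rightarrow> 'a set \<Rightarrow> ennreal"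
  where "gross_measure m \<mu> A = (SUP \<delta>\<in>{0<..}. gross_delta m \<mu> \<delta> A)"

end

theory Submission
  imports Defs
begin

text \<open>
  Write H for \<open>hausdorff_measure m\<close>, G for the gross measure, \<open>\<zeta>\<close> for its weight and \<open>\<lambda>\<close> for
  Lebesgue measure on m-dimensional Euclidean space. The theorem is an infinitesimal statement:
  on a rectifiable set everything is almost linear at small scales, and for linear pieces both
  inequalities are the two halves of the definition of a density contractor.

  \<^bold>\<open>Linearization.\<close> Say that f is e-close to a linear map T on S if
  \<open>norm (f x - f y - T (x - y)) \<le> e * norm (x - y)\<close> on S (\<open>close_to_linear\<close>). By Rademacher's
  theorem, which is proved here, and by separability of the space of linear maps, a
  rectifiable set is, up to an H-null set, a disjoint union of countably many Borel pieces
  \<open>f ` S\<close> with f \<open>\<epsilon> T\<close>-close to an injective linear T on S (\<open>rectifiable_pieces\<close>). The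
  tolerance \<open>\<epsilon> T\<close> may depend on T in an arbitrary way. This freedom is essential, because the
  contractor on the plane \<open>range T\<close>, and hence every estimate about it, varies with T without any
  regularity. For linear T one has \<open>H (T ` S) = area_factor T * \<lambda> S\<close>, by uniqueness of translation
  invariant measures.

  \<^bold>\<open>G is at most H.\<close> Fix a plane W with contractor \<open>\<mu>\<close>. If f is close to T on S, then \<open>\<pi> \<circ> f\<close> is
  close to \<open>\<pi> \<circ> T\<close>, so that \<open>H (\<pi> ` f ` S)\<close> is about \<open>area_factor (\<pi> \<circ> T) * \<lambda> S\<close>; the mean
  of \<open>area_factor (\<pi> \<circ> T)\<close> over \<open>\<mu>\<close> is the mean projected measure of the parallelotope
  \<open>T ` cbox 0 One\<close>, which is at most \<open>area_factor T\<close>. The error is not uniform in \<open>\<pi>\<close>, because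
  \<open>\<pi> \<circ> T\<close> may degenerate. Therefore \<open>area_bound e T\<close>, the best constant that works for all maps
  that are closer than e to T, is used: it is lower semicontinuous in T, bounded on bounded sets,
  and decreases to \<open>area_factor T\<close> as e tends to 0, so that for \<open>norm \<pi> \<le> n\<close> the mean can be
  controlled by monotone convergence (\<open>mean_area_bound\<close>). Letting n grow gives
  \<open>\<zeta> B \<le> H B\<close> for rectifiable B, and a partition of the set into small Borel parts gives the
  inequality for G.

  \<^bold>\<open>H is at most G.\<close> Take \<open>W = range T\<close>. Now the mean of \<open>area_factor (\<pi> \<circ> T)\<close> equals
  \<open>area_factor T\<close>, and all but a small fraction of it is carried by those \<open>\<pi>\<close> with
  \<open>norm \<pi> \<le> n\<close> and \<open>norm v \<le> n * norm (\<pi> (T v))\<close> for all v. On this set closeness of f to T is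
  uniformly a bilipschitz comparison of \<open>\<pi> \<circ> f\<close> with \<open>\<pi> \<circ> T\<close>. Hence \<open>H Q \<le> (1 + \<eta>) ^ 3 * \<zeta> Q\<close> for
  all Borel subsets Q of a piece (\<open>hausdorff_measure_le_mean_projected\<close>), and the same
  inequality follows for G. The pieces can be summed because G, like H, is countably additive on
  Borel sets: both come from Caratheodory's construction.

  The function \<open>\<pi> \<mapsto> H (\<pi> ` B)\<close> is integrated only through monotonicity, by comparing it with
  measurable functions from above and from below.
\<close>

section \<open>Metric outer measures and Caratheodory's construction\<close>

text \<open>Caratheodory's criterion is needed for three such set functions: the Hausdorff measure, the gross
  measure, and \<open>A \<mapsto> hausdorff_measure m (T ` A)\<close> for an injective linear T.\<close>

definition metric_outer_measure :: "('a::metric_space set \<Rightarrow> ennreal) \<Rightarrow> bool"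
  where "metric_outer_measure \<phi> \<longleftrightarrow> \<phi> {} = 0 \<and> (\<forall>A B. A \<subseteq> B \<longrightarrow> \<phi> A \<le> \<phi> B) \<and>
    (\<forall>A. \<phi> (\<Union>i::nat. A i) \<le> (\<Sum>i. \<phi> (A i))) \<and>
    (\<forall>A B r. 0 < r \<longrightarrow> (\<forall>x\<in>A. \<forall>y\<in>B. r \<le> dist x y) \<longrightarrow> \<phi> A + \<phi> B \<le> \<phi> (A \<union> B))"

lemma
  assumes "metric_outer_measure \<phi>"
  shows mom_empty: "\<phi> {} = 0"
    and mom_mono: "A \<subseteq> B \<Longrightarrow> \<phi> A \<le> \<phi> B"
    and mom_subadd: "\<phi> (\<Union>i::nat. D i) \<le> (\<Sum>i. \<phi> (D i))"
    and mom_separated: "0 < r \<Longrightarrow> (\<And>x y. x \<in> A \<Longrightarrow> y \<in> B \<Longrightarrow> r \<le> dist x y) \<Longrightarrow>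
      \<phi> A + \<phi> B \<le> \<phi> (A \<union> B)"
  using assms unfolding metric_outer_measure_def by auto

lemma mom_subadd2:
  assumes "metric_outer_measure \<phi>"
  shows "\<phi> (A \<union> B) \<le> \<phi> A + \<phi> B"
proof -
  have "\<phi> (\<Union>i. binaryset A B i) \<le> (\<Sum>i. \<phi> (binaryset A B i))"
    by (rule mom_subadd[OF assms])
  also have "\<dots> = \<phi> A + \<phi> B"
    using sums_unique[OF binaryset_sums[of \<phi> A B]] mom_empty[OF assms] by simp
  finally show ?thesis by (simp add: UN_binaryset_eq)
qed

lemma mom_sum_separated:
  fixes R :: "nat \<Rightarrow> 'a::metric_space set"
  assumes m: "metric_outer_measure \<phi>"
    and sep: "\<And>i j x y. i < j \<Longrightarrow> x \<in> R i \<Longrightarrow> y \<in> R j \<Longrightarrow> d j \<le> dist x y"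
    and d: "\<And>j. 0 < j \<Longrightarrow> (0::real) < d j"
  shows "(\<Sum>i<n. \<phi> (R i)) \<le> \<phi> (\<Union>i<n. R i)"
proof (induction n)
  case 0
  then show ?case by simp
next
  case (Suc n)
  have "(\<Sum>i<Suc n. \<phi> (R i)) \<le> \<phi> (\<Union>i<n. R i) + \<phi> (R n)"
    using Suc by (simp add: add_right_mono)
  also have "\<dots> \<le> \<phi> ((\<Union>i<n. R i) \<union> R n)"
  proof (cases "n = 0")
    case True
    then show ?thesis by (simp add: mom_empty[OF m])
  next
    case False
    then show ?thesis
      using mom_separated[OF m d[of n], of "\<Union>i<n. R i" "R n"] sep by auto
  qed
  also have "\<dots> = \<phi> (\<Union>i<Suc n. R i)" by (simp add: lessThan_Suc Un_commute)
  finally show ?case .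
qed

lemma suminf_tail_ennreal_tendsto:
  fixes f :: "nat \<Rightarrow> ennreal"
  assumes "(\<Sum>i. f i) < \<infinity>"
  shows "(\<lambda>n. \<Sum>k. f (n + k)) \<longlonglongrightarrow> 0"
proof -
  define g where "g = (\<lambda>i. enn2real (f i))"
  have fin: "f i < \<infinity>" for i
    using ennreal_suminf_lessD[OF assms] by simp
  have f: "f = (\<lambda>i. ennreal (g i))"
    using fin by (auto simp: g_def less_top)
  have g0: "0 \<le> g i" for i by (simp add: g_def)
  have sg: "summable g"
    using assms unfolding f by (intro summable_suminf_not_top) (auto simp: g0)
  have sgn: "summable (\<lambda>k. g (n + k))" for n
    using summable_ignore_initial_segment[OF sg, of n] by (simp add: add.commute)
  have "(\<Sum>k. f (n + k)) = ennreal (\<Sum>k. g (n + k))" for n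
    unfolding f using sgn g0 by (intro suminf_ennreal2) auto
  moreover have "(\<lambda>n. \<Sum>k. g (n + k)) \<longlonglongrightarrow> 0"
    using suminf_exist_split2[OF sg] by (simp add: add.commute)
  ultimately show ?thesis
    using tendsto_ennrealI by fastforce
qed

text \<open>Caratheodory's criterion. The part of E away from the closed set C is exhausted by the sets D n
  where the distance to C is at least \<open>1 / (n + 1)\<close>, which are separated from C. What is missing from
  D n lies in the layers \<open>R k\<close> with \<open>k \<ge> n\<close>. Layers of the same parity are separated from each other,
  so the sum of their measures is at most \<open>2 * \<phi> E\<close>, and its tail tends to 0.\<close>
lemma mom_closed:
  assumes m: "metric_outer_measure \<phi>" and C: "closed C"
  shows "\<phi> (E \<inter> C) + \<phi> (E - C) = \<phi> E"
proof (rule antisym)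
  have "E = (E \<inter> C) \<union> (E - C)" by auto
  then show "\<phi> E \<le> \<phi> (E \<inter> C) + \<phi> (E - C)"
    using mom_subadd2[OF m] by metis
next
  show "\<phi> (E \<inter> C) + \<phi> (E - C) \<le> \<phi> E"
  proof (cases "C = {} \<or> \<phi> E = \<infinity>")
    case True
    then show ?thesis by (auto simp: mom_empty[OF m])
  next
    case False
    then have Cn: "C \<noteq> {}" and fin: "\<phi> E < \<infinity>" by (auto simp: less_top)
    define u where "u = (\<lambda>x. infdist x C)"
    have u_dist: "u x - u y \<le> dist x y" for x y
      using infdist_triangle[of x C y] by (simp add: u_def)
    have u_pos: "0 < u x" if "x \<notin> C" for x
      using infdist_pos_not_in_closed[OF C Cn that] by (simp add: u_def)
    have u_C: "u x = 0" if "x \<in> C" for x using that by (simp add: u_def)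
    define D where "D = (\<lambda>n::nat. {x\<in>E. 1 / (n + 1) \<le> u x})"
    define R where "R = (\<lambda>n::nat. {x\<in>E. 1 / (n + 2) \<le> u x \<and> u x < 1 / (n + 1)})"
    have half: "(\<Sum>i<n. \<phi> (R (2 * i + p))) \<le> \<phi> E" for n p
    proof -
      have "(\<Sum>i<n. \<phi> (R (2 * i + p))) \<le> \<phi> (\<Union>i<n. R (2 * i + p))"
      proof (rule mom_sum_separated[OF m, where d="\<lambda>j. 1 / (2 * j + p) - 1 / (2 * j + p + 1)"])
        fix i j :: nat and x y assume ij: "i < j" and x: "x \<in> R (2 * i + p)" and y: "y \<in> R (2 * j + p)"
        have "1 / real (2 * j + p) \<le> 1 / real (2 * i + p + 2)"
          using ij by (intro divide_left_mono) auto
        also have "\<dots> \<le> u x" using x by (simp add: R_def add.commute)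
        finally have "1 / real (2 * j + p) \<le> u x" .
        moreover have "u y < 1 / real (2 * j + p + 1)" using y by (simp add: R_def algebra_simps)
        ultimately show "1 / real (2 * j + p) - 1 / real (2 * j + p + 1) \<le> dist x y"
          using u_dist[of x y] by linarith
      next
        fix j :: nat assume "0 < j"
        then show "0 < 1 / real (2 * j + p) - 1 / real (2 * j + p + 1)"
          by (simp add: frac_less2)
      qed
      also have "\<dots> \<le> \<phi> E" by (rule mom_mono[OF m]) (auto simp: R_def)
      finally show ?thesis .
    qed
    have split: "(\<Sum>i<2*n. \<phi> (R i)) = (\<Sum>i<n. \<phi> (R (2 * i + 0))) + (\<Sum>i<n. \<phi> (R (2 * i + 1)))" for n
      by (induction n) (auto simp: algebra_simps)
    have "(\<Sum>i<n. \<phi> (R i)) \<le> 2 * \<phi> E" for n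
    proof -
      have "(\<Sum>i<n. \<phi> (R i)) \<le> (\<Sum>i<2*n. \<phi> (R i))"
        by (rule sum_mono2) auto
      also have "\<dots> \<le> \<phi> E + \<phi> E"
        unfolding split by (intro add_mono half)
      finally show ?thesis by (simp add: mult_2)
    qed
    then have "(\<Sum>i. \<phi> (R i)) \<le> 2 * \<phi> E"
      by (intro suminf_le_const) auto
    also have "\<dots> < \<infinity>" using fin by (simp add: ennreal_mult_less_top)
    finally have tail: "(\<lambda>n. \<Sum>k. \<phi> (R (n + k))) \<longlonglongrightarrow> 0"
      by (rule suminf_tail_ennreal_tendsto)
    have "\<phi> (E \<inter> C) + \<phi> (E - C) \<le> \<phi> E + (\<Sum>k. \<phi> (R (n + k)))" for n
    proof -
      have "E - C \<subseteq> D n \<union> (\<Union>k. R (n + k))"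
      proof
        fix x assume x: "x \<in> E - C"
        show "x \<in> D n \<union> (\<Union>k. R (n + k))"
        proof (cases "1 / (n + 1) \<le> u x")
          case True
          then show ?thesis using x by (auto simp: D_def add.commute)
        next
          case False
          have ux: "0 < u x" using x u_pos by auto
          define P where "P = (\<lambda>k. 1 / real (n + k + 2) \<le> u x)"
          obtain N where "N > 0" "inverse (real N) < u x"
            using ex_inverse_of_nat_less[OF ux] by auto
          moreover have "1 / real (n + N + 2) \<le> inverse (real N)"
            using \<open>N > 0\<close> by (simp add: field_simps)
          ultimately have PN: "P N" by (simp add: P_def)
          define k where "k = (LEAST k. P k)"
          have Pk: "P k" unfolding k_def by (rule LeastI[of P N]) (rule PN)
          have "u x < 1 / real (n + k + 1)"
          proof (cases k)
            case 0
            then show ?thesis using False by simp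
          next
            case (Suc j)
            then have "\<not> P j" using not_less_Least[of j P] by (simp add: k_def)
            then show ?thesis using Suc by (simp add: P_def)
          qed
          then have "x \<in> R (n + k)" using Pk x by (simp add: R_def P_def ac_simps)
          then show ?thesis by auto
        qed
      qed
      then have "\<phi> (E - C) \<le> \<phi> (D n \<union> (\<Union>k. R (n + k)))" by (rule mom_mono[OF m])
      also have "\<dots> \<le> \<phi> (D n) + (\<Sum>k. \<phi> (R (n + k)))"
        by (rule order_trans[OF mom_subadd2[OF m]]) (intro add_left_mono mom_subadd[OF m])
      finally have "\<phi> (E \<inter> C) + \<phi> (E - C) \<le> \<phi> (E \<inter> C) + \<phi> (D n) + (\<Sum>k. \<phi> (R (n + k)))"
        by (simp add: add_left_mono add.assoc)
      also have "\<phi> (E \<inter> C) + \<phi> (D n) \<le> \<phi> (E \<inter> C \<union> D n)"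
      proof (rule mom_separated[OF m, of "1 / (n + 1)"])
        fix x y assume "x \<in> E \<inter> C" "y \<in> D n"
        then show "1 / real (n + 1) \<le> dist x y"
          using u_dist[of y x] u_C[of x] by (simp add: D_def dist_commute add.commute)
      qed simp
      also have "\<phi> (E \<inter> C \<union> D n) \<le> \<phi> E" by (rule mom_mono[OF m]) (auto simp: D_def)
      finally show ?thesis by (simp add: add_right_mono)
    qed
    moreover have "(\<lambda>n. \<phi> E + (\<Sum>k. \<phi> (R (n + k)))) \<longlonglongrightarrow> \<phi> E + 0"
      by (intro tendsto_add tail) auto
    ultimately show ?thesis
      using LIMSEQ_le_const[of "\<lambda>n. \<phi> E + (\<Sum>k. \<phi> (R (n + k)))" "\<phi> E"] by auto
  qed
qed

text \<open>For a metric outer measure this is a measure on the Borel sets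
  (\<open>emeasure_borel_part\<close>), because closed sets satisfy Caratheodory's condition.\<close>
definition borel_part :: "('a::metric_space set \<Rightarrow> ennreal) \<Rightarrow> 'a measure"
  where "borel_part \<phi> = measure_of UNIV (sets borel) \<phi>"

lemma sets_borel_part [simp, measurable_cong]: "sets (borel_part \<phi>) = sets borel"
  using sets.sigma_sets_eq[of borel] by (simp add: borel_part_def)

lemma space_borel_part [simp]: "space (borel_part \<phi>) = UNIV"
  by (simp add: borel_part_def)

lemma emeasure_borel_part:
  assumes m: "metric_outer_measure \<phi>" and A: "A \<in> sets borel"
  shows "emeasure (borel_part \<phi>) A = \<phi> A"
proof -
  interpret P: sigma_algebra UNIV "Pow (UNIV::'a set)" by (rule sigma_algebra_Pow)
  have oms: "outer_measure_space (Pow (UNIV::'a set)) \<phi>"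
    unfolding outer_measure_space_def positive_def increasing_def countably_subadditive_def
    using m by (auto simp: mom_empty intro: mom_mono mom_subadd)
  have compl: "(UNIV - l) \<inter> x = x - l" for l x :: "'a set" by auto
  let ?L = "lambda_system UNIV (Pow (UNIV::'a set)) \<phi>"
  have ms: "measure_space UNIV ?L \<phi>" by (rule P.caratheodory_lemma[OF oms])
  then interpret L: sigma_algebra UNIV ?L by (simp add: measure_space_def)
  have "Collect closed \<subseteq> ?L"
    using mom_closed[OF m] by (simp add: lambda_system_def compl subset_iff) (metis Int_commute)
  then have "sigma_sets UNIV (Collect closed) \<subseteq> ?L" by (rule L.sigma_sets_subset)
  then have sub: "sets borel \<subseteq> ?L" by (simp add: borel_eq_closed)
  have "measure_space UNIV (sets borel) \<phi>"
    unfolding measure_space_def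
  proof (intro conjI)
    show "sigma_algebra UNIV (sets (borel :: 'a measure))"
      using sets.sigma_algebra_axioms[of "borel :: 'a measure"] by simp
    show "positive (sets borel) \<phi>" by (simp add: positive_def mom_empty[OF m])
    show "countably_additive (sets borel) \<phi>"
      using ms sub unfolding measure_space_def countably_additive_def by blast
  qed
  then show ?thesis
    using A unfolding borel_part_def
    by (metis (no_types, lifting) emeasure_measure_of_sigma measure_space_def)
qed

lemma mom_disjoint_suminf:
  fixes D :: "nat \<Rightarrow> 'a::metric_space set"
  assumes m: "metric_outer_measure \<phi>" and "\<And>i. D i \<in> sets borel" and "disjoint_family D"
  shows "(\<Sum>i. \<phi> (D i)) = \<phi> (\<Union>i. D i)"
proof -
  have "(\<Sum>i. emeasure (borel_part \<phi>) (D i)) = emeasure (borel_part \<phi>) (\<Union>i. D i)"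
    using assms by (intro suminf_emeasure) auto
  moreover have "(\<Union>i. D i) \<in> sets borel" using assms(2) by auto
  ultimately show ?thesis using assms by (simp add: emeasure_borel_part)
qed

text \<open>The common pattern of \<open>hausdorff_delta\<close> (F consists of all sets) and \<open>gross_delta\<close> (F consists of
  the Borel sets).\<close>
definition cc_delta :: "'a::metric_space set set \<Rightarrow> ('a set \<Rightarrow> ennreal) \<Rightarrow> ennreal \<Rightarrow> 'a set \<Rightarrow> ennreal"
  where "cc_delta F w \<delta> A =
    (INF E\<in>{E::nat \<Rightarrow> 'a set. (\<forall>j. E j \<in> F) \<and> A \<subseteq> (\<Union>j. E j) \<and> (\<forall>j. ediam (E j) < \<delta>)}. \<Sum>j. w (E j))"

definition cc_measure :: "'a::metric_space set set \<Rightarrow> ('a set \<Rightarrow> ennreal) \<Rightarrow> 'a set \<Rightarrow> ennreal"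
  where "cc_measure F w A = (SUP \<delta>\<in>{0<..}. cc_delta F w \<delta> A)"

lemma dist_le_ediam: "x \<in> A \<Longrightarrow> y \<in> A \<Longrightarrow> ennreal (dist x y) \<le> ediam A"
  unfolding ediam_def by (meson SUP_upper2 SUP_upper)

lemma ediam_le: "(\<And>x y. x \<in> A \<Longrightarrow> y \<in> A \<Longrightarrow> ennreal (dist x y) \<le> c) \<Longrightarrow> ediam A \<le> c"
  unfolding ediam_def by (intro SUP_least) auto

lemma ediam_empty [simp]: "ediam {} = 0"
  by (simp add: ediam_def bot_ennreal)

lemma cc_delta_le:
  "(\<And>j. E j \<in> F) \<Longrightarrow> A \<subseteq> (\<Union>j. E j) \<Longrightarrow> (\<And>j. ediam (E j) < \<delta>) \<Longrightarrow> cc_delta F w \<delta> A \<le> (\<Sum>j. w (E j))"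
  unfolding cc_delta_def by (intro INF_lower) auto

lemma cc_delta_approx:
  assumes "cc_delta F w \<delta> A < c"
  obtains E :: "nat \<Rightarrow> 'a::metric_space set" where "\<And>j. E j \<in> F" "A \<subseteq> (\<Union>j. E j)" "\<And>j. ediam (E j) < \<delta>"
    "(\<Sum>j. w (E j)) < c"
proof -
  from assms obtain E where "E \<in> {E::nat \<Rightarrow> 'a set. (\<forall>j. E j \<in> F) \<and> A \<subseteq> (\<Union>j. E j) \<and> (\<forall>j. ediam (E j) < \<delta>)}"
    "(\<Sum>j. w (E j)) < c"
    unfolding cc_delta_def INF_less_iff by blast
  then show ?thesis using that by blast
qed

lemma cc_delta_antimono: "\<delta> \<le> \<delta>' \<Longrightarrow> cc_delta F w \<delta>' A \<le> cc_delta F w \<delta> A"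
  unfolding cc_delta_def by (intro INF_superset_mono) (auto intro: less_le_trans)

lemma cc_delta_le_measure: "0 < \<delta> \<Longrightarrow> cc_delta F w \<delta> A \<le> cc_measure F w A"
  unfolding cc_measure_def by (intro SUP_upper) auto

lemma cc_delta_mono: "A \<subseteq> B \<Longrightarrow> cc_delta F w \<delta> A \<le> cc_delta F w \<delta> B"
  unfolding cc_delta_def by (intro INF_superset_mono) auto

lemma cc_delta_subadd:
  fixes D :: "nat \<Rightarrow> 'a::metric_space set"
  shows "cc_delta F w \<delta> (\<Union>i. D i) \<le> (\<Sum>i. cc_delta F w \<delta> (D i))"
proof (cases "(\<Sum>i. cc_delta F w \<delta> (D i)) < \<infinity>")
  case True
  show ?thesis
  proof (rule ennreal_le_epsilon)
    fix e :: real assume e: "0 < e"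
    have fin: "cc_delta F w \<delta> (D i) < \<infinity>" for i
      using ennreal_suminf_lessD[OF True] by simp
    have "\<exists>E::nat \<Rightarrow> 'a set. (\<forall>j. E j \<in> F) \<and> D i \<subseteq> (\<Union>j. E j) \<and> (\<forall>j. ediam (E j) < \<delta>) \<and>
      (\<Sum>j. w (E j)) \<le> cc_delta F w \<delta> (D i) + ennreal (e * (1/2)^Suc i)" for i
    proof -
      have "cc_delta F w \<delta> (D i) < cc_delta F w \<delta> (D i) + ennreal (e * (1/2)^Suc i)"
        using fin[of i] e by (simp add: ennreal_add_left_cancel_less[of _ 0, simplified] less_top)
      from cc_delta_approx[OF this] show ?thesis by (metis less_imp_le)
    qed
    then obtain E :: "nat \<Rightarrow> nat \<Rightarrow> 'a set" where E: "\<And>i j. E i j \<in> F" "\<And>i. D i \<subseteq> (\<Union>j. E i j)"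
      "\<And>i j. ediam (E i j) < \<delta>" "\<And>i. (\<Sum>j. w (E i j)) \<le> cc_delta F w \<delta> (D i) + ennreal (e * (1/2)^Suc i)"
      by metis
    define G where "G = (\<lambda>n. E (fst (prod_decode n)) (snd (prod_decode n)))"
    have "(\<Union>i. D i) \<subseteq> (\<Union>n. G n)"
    proof
      fix x assume "x \<in> (\<Union>i. D i)"
      then obtain i j where "x \<in> E i j" using E(2) by blast
      then have "x \<in> G (prod_encode (i, j))" by (simp add: G_def)
      then show "x \<in> (\<Union>n. G n)" by blast
    qed
    then have "cc_delta F w \<delta> (\<Union>i. D i) \<le> (\<Sum>n. w (G n))"
      by (rule cc_delta_le[rotated]) (auto simp: G_def E)
    also have "\<dots> = (\<Sum>n. (\<lambda>p. w (E (fst p) (snd p))) (prod_decode n))" by (simp add: G_def)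
    also have "\<dots> = (\<Sum>i. \<Sum>j. w (E i j))"
      by (rule suminf_ennreal_2dimen) (auto simp: split_beta)
    also have "\<dots> \<le> (\<Sum>i. cc_delta F w \<delta> (D i) + ennreal (e * (1/2)^Suc i))"
      by (intro suminf_le E) auto
    also have "\<dots> = (\<Sum>i. cc_delta F w \<delta> (D i)) + (\<Sum>i. ennreal (e * (1/2)^Suc i))"
      by (intro suminf_add[symmetric]) auto
    also have "(\<Sum>i. ennreal (e * (1/2)^Suc i)) = ennreal e"
    proof (rule suminf_ennreal_eq)
      show "(\<lambda>i. e * (1/2)^Suc i) sums e"
        using sums_mult[OF power_half_series, of e] by simp
    qed (use e in simp)
    finally show "cc_delta F w \<delta> (\<Union>i. D i) \<le> (\<Sum>i. cc_delta F w \<delta> (D i)) + ennreal e" .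
  qed
qed (auto simp: less_top[symmetric])

lemma cc_measure_eq_SUP_nat: "cc_measure F w A = (SUP n. cc_delta F w (ennreal (1 / Suc n)) A)"
proof (rule antisym)
  show "cc_measure F w A \<le> (SUP n. cc_delta F w (ennreal (1 / Suc n)) A)"
    unfolding cc_measure_def
  proof (rule SUP_mono)
    fix \<delta> :: ennreal assume "\<delta> \<in> {0<..}"
    then obtain r :: real where r: "0 < r" "ennreal r \<le> \<delta>"
      by (cases \<delta>) (auto simp: ennreal_less_zero_iff intro: that[of 1])
    then obtain n where "1 / Suc n < r" using nat_approx_posE by metis
    then have "ennreal (1 / Suc n) \<le> \<delta>" using r by (meson ennreal_leI less_imp_le order_trans)
    then show "\<exists>n\<in>UNIV. cc_delta F w \<delta> A \<le> cc_delta F w (ennreal (1 / Suc n)) A"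
      using cc_delta_antimono by blast
  qed
  show "(SUP n. cc_delta F w (ennreal (1 / Suc n)) A) \<le> cc_measure F w A"
    by (intro SUP_least cc_delta_le_measure) simp
qed

text \<open>If A and B are at distance at least r, then a set of diameter less than r meets at most one of
  them, so that a fine cover of the union splits into a cover of A and a cover of B.\<close>
lemma metric_outer_measure_cc:
  fixes F :: "'a::metric_space set set"
  assumes F: "{} \<in> F" and w: "w {} = 0"
  shows "metric_outer_measure (cc_measure F w)"
  unfolding metric_outer_measure_def
proof (intro conjI allI impI)
  have "cc_delta F w \<delta> {} \<le> 0" if "0 < \<delta>" for \<delta>
    using cc_delta_le[of "\<lambda>_. {}" F "{}" \<delta> w] F w that by simp
  then have "cc_measure F w {} \<le> 0" unfolding cc_measure_def by (intro SUP_least) auto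
  then show "cc_measure F w {} = 0" by simp
next
  show "cc_measure F w A \<le> cc_measure F w B" if "A \<subseteq> B" for A B
    using that unfolding cc_measure_def by (intro SUP_mono' cc_delta_mono)
next
  fix A :: "nat \<Rightarrow> 'a set"
  show "cc_measure F w (\<Union>i. A i) \<le> (\<Sum>i. cc_measure F w (A i))"
    unfolding cc_measure_def[of F w "\<Union>i. A i"]
  proof (rule SUP_least)
    fix \<delta> :: ennreal assume "\<delta> \<in> {0<..}"
    then have "(\<Sum>i. cc_delta F w \<delta> (A i)) \<le> (\<Sum>i. cc_measure F w (A i))"
      by (intro suminf_le cc_delta_le_measure) auto
    then show "cc_delta F w \<delta> (\<Union>i. A i) \<le> (\<Sum>i. cc_measure F w (A i))"
      using cc_delta_subadd order_trans by blast
  qed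
next
  fix A B :: "'a set" and r :: real
  assume r: "0 < r" and sep: "\<forall>x\<in>A. \<forall>y\<in>B. r \<le> dist x y"
  have ineq: "cc_delta F w \<delta> A + cc_delta F w \<delta> B \<le> cc_measure F w (A \<union> B)" if "0 < \<delta>" for \<delta>
  proof -
    define d where "d = min \<delta> (ennreal r)"
    have d: "0 < d" "d \<le> \<delta>" "d \<le> ennreal r" using that r by (auto simp: d_def)
    have "cc_delta F w d A + cc_delta F w d B \<le> cc_delta F w d (A \<union> B)"
      unfolding cc_delta_def[of F w d "A \<union> B"]
    proof (rule INF_greatest, clarify)
      fix E :: "nat \<Rightarrow> 'a set"
      assume E: "\<forall>j. E j \<in> F" "A \<union> B \<subseteq> (\<Union>j. E j)" "\<forall>j. ediam (E j) < d"
      define EA where "EA = (\<lambda>j. if E j \<inter> A = {} then {} else E j)"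
      define EB where "EB = (\<lambda>j. if E j \<inter> B = {} then {} else E j)"
      have "E j \<inter> A = {} \<or> E j \<inter> B = {}" for j
      proof (rule ccontr)
        assume "\<not> ?thesis"
        then obtain x y where xy: "x \<in> E j" "x \<in> A" "y \<in> E j" "y \<in> B" by auto
        then have "ennreal r \<le> ennreal (dist x y)" using sep by (simp add: ennreal_leI)
        also have "\<dots> \<le> ediam (E j)" using xy dist_le_ediam by auto
        also have "\<dots> < d" using E by auto
        finally show False using d by auto
      qed
      then have le: "w (EA j) + w (EB j) \<le> w (E j)" for j
        by (auto simp: EA_def EB_def w)
      have "cc_delta F w d A \<le> (\<Sum>j. w (EA j))"
      proof (rule cc_delta_le)
        show "A \<subseteq> (\<Union>j. EA j)"
        proof
          fix x assume "x \<in> A"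
          then obtain j where "x \<in> E j" using E by blast
          then have "x \<in> EA j" using \<open>x \<in> A\<close> by (auto simp: EA_def)
          then show "x \<in> (\<Union>j. EA j)" by blast
        qed
      qed (use E F d in \<open>auto simp: EA_def\<close>)
      moreover have "cc_delta F w d B \<le> (\<Sum>j. w (EB j))"
      proof (rule cc_delta_le)
        show "B \<subseteq> (\<Union>j. EB j)"
        proof
          fix x assume "x \<in> B"
          then obtain j where "x \<in> E j" using E by blast
          then have "x \<in> EB j" using \<open>x \<in> B\<close> by (auto simp: EB_def)
          then show "x \<in> (\<Union>j. EB j)" by blast
        qed
      qed (use E F d in \<open>auto simp: EB_def\<close>)
      ultimately have "cc_delta F w d A + cc_delta F w d B \<le> (\<Sum>j. w (EA j)) + (\<Sum>j. w (EB j))"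
        by (rule add_mono)
      also have "\<dots> = (\<Sum>j. w (EA j) + w (EB j))" by (intro suminf_add) auto
      also have "\<dots> \<le> (\<Sum>j. w (E j))" by (intro suminf_le le) auto
      finally show "cc_delta F w d A + cc_delta F w d B \<le> (\<Sum>j. w (E j))" .
    qed
    moreover have "cc_delta F w \<delta> A + cc_delta F w \<delta> B \<le> cc_delta F w d A + cc_delta F w d B"
      by (intro add_mono cc_delta_antimono d)
    ultimately show ?thesis using cc_delta_le_measure[OF d(1), of F w "A \<union> B"] by simp
  qed
  have "cc_measure F w A + cc_measure F w B =
    (SUP n. cc_delta F w (ennreal (1 / Suc n)) A + cc_delta F w (ennreal (1 / Suc n)) B)"
    unfolding cc_measure_eq_SUP_nat
    by (rule ennreal_SUP_add[symmetric])
      (auto intro!: incseq_SucI cc_delta_antimono ennreal_leI simp: frac_le)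
  also have "\<dots> \<le> cc_measure F w (A \<union> B)"
    by (intro SUP_least ineq) simp
  finally show "cc_measure F w A + cc_measure F w B \<le> cc_measure F w (A \<union> B)" .
qed

lemma hausdorff_delta_eq_cc: "hausdorff_delta m = cc_delta UNIV (hausdorff_weight m)"
  by (simp add: fun_eq_iff hausdorff_delta_def cc_delta_def)

lemma hausdorff_measure_eq_cc: "hausdorff_measure m = cc_measure UNIV (hausdorff_weight m)"
  by (simp add: fun_eq_iff hausdorff_measure_def cc_measure_def hausdorff_delta_eq_cc)

lemma metric_outer_measure_hausdorff: "metric_outer_measure (hausdorff_measure m)"
  unfolding hausdorff_measure_eq_cc by (rule metric_outer_measure_cc) (auto simp: hausdorff_weight_def)

section \<open>Hausdorff measure on Euclidean space and under linear maps\<close>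

lemmas mom_H = metric_outer_measure_hausdorff
lemmas H_empty = mom_empty[OF metric_outer_measure_hausdorff]
lemmas H_mono = mom_mono[OF metric_outer_measure_hausdorff]
lemmas H_subadd = mom_subadd[OF metric_outer_measure_hausdorff]
lemmas H_subadd2 = mom_subadd2[OF metric_outer_measure_hausdorff]

text \<open>Stated for two maps on the same parameter set instead of one Lipschitz map: in this form it also
  compares f with g when g factors through f only on S.\<close>
lemma hausdorff_measure_le_of_dist_le:
  fixes f :: "'i \<Rightarrow> 'a::metric_space" and g :: "'i \<Rightarrow> 'b::metric_space"
  assumes L: "0 < L" and dist: "\<And>x y. x \<in> S \<Longrightarrow> y \<in> S \<Longrightarrow> dist (g x) (g y) \<le> L * dist (f x) (f y)"
  shows "hausdorff_measure m (g ` S) \<le> ennreal (L ^ m) * hausdorff_measure m (f ` S)"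
  unfolding hausdorff_measure_def[of m "g ` S"]
proof (rule SUP_least)
  fix \<delta> :: ennreal assume "\<delta> \<in> {0<..}"
  then have \<delta>: "0 < \<delta>" by simp
  define X where "X = hausdorff_delta m \<delta> (g ` S)"
  define d where "d = ennreal (1 / L) * \<delta>"
  have d: "0 < d" using \<delta> L by (simp add: d_def ennreal_zero_less_mult_iff)
  have Ld: "ennreal L * d = \<delta>"
    using L by (simp add: d_def mult.assoc[symmetric] ennreal_mult''[symmetric])
  have "ennreal (1 / L ^ m) * X \<le> hausdorff_delta m d (f ` S)"
    unfolding hausdorff_delta_def[of m d]
  proof (rule INF_greatest, clarify)
    fix E :: "nat \<Rightarrow> 'a set" assume E: "f ` S \<subseteq> (\<Union>j. E j)" "\<forall>j. ediam (E j) < d"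
    define G where "G = (\<lambda>j. g ` (S \<inter> f -` E j))"
    have diam: "ediam (G j) \<le> ennreal L * ediam (E j)" for j
    proof (rule ediam_le)
      fix u v assume "u \<in> G j" "v \<in> G j"
      then obtain x y where xy: "x \<in> S" "y \<in> S" "f x \<in> E j" "f y \<in> E j" "u = g x" "v = g y"
        by (auto simp: G_def)
      have "ennreal (dist u v) \<le> ennreal (L * dist (f x) (f y))"
        using dist xy by (intro ennreal_leI) auto
      also have "\<dots> = ennreal L * ennreal (dist (f x) (f y))" using L by (simp add: ennreal_mult)
      also have "\<dots> \<le> ennreal L * ediam (E j)"
        by (intro mult_left_mono dist_le_ediam xy) auto
      finally show "ennreal (dist u v) \<le> ennreal L * ediam (E j)" .
    qed
    have w: "hausdorff_weight m (G j) \<le> ennreal (L ^ m) * hausdorff_weight m (E j)" for j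
    proof (cases "G j = {}")
      case False
      then have "E j \<noteq> {}" by (auto simp: G_def)
      have "ediam (G j) ^ m \<le> (ennreal L * ediam (E j)) ^ m" by (intro power_mono diam) simp
      also have "\<dots> = ennreal (L ^ m) * ediam (E j) ^ m"
        using L by (simp add: power_mult_distrib ennreal_power)
      finally have "ennreal (unit_ball_vol (real m) / 2 ^ m) * ediam (G j) ^ m
        \<le> ennreal (unit_ball_vol (real m) / 2 ^ m) * (ennreal (L ^ m) * ediam (E j) ^ m)"
        by (rule mult_left_mono) simp
      then show ?thesis
        using False \<open>E j \<noteq> {}\<close> by (simp add: hausdorff_weight_def mult.left_commute)
    qed (simp add: hausdorff_weight_def)
    have "X \<le> (\<Sum>j. hausdorff_weight m (G j))"
      unfolding X_def hausdorff_delta_eq_cc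
    proof (rule cc_delta_le)
      show "g ` S \<subseteq> (\<Union>j. G j)" using E(1) by (fastforce simp: G_def)
      show "ediam (G j) < \<delta>" for j
        using diam[of j] ennreal_mult_strict_left_mono[of "ediam (E j)" d "ennreal L"] E(2) L Ld
        by (auto intro: le_less_trans)
    qed simp
    also have "\<dots> \<le> (\<Sum>j. ennreal (L ^ m) * hausdorff_weight m (E j))"
      by (intro suminf_le w) auto
    also have "\<dots> = ennreal (L ^ m) * (\<Sum>j. hausdorff_weight m (E j))" by simp
    finally have "ennreal (1 / L ^ m) * X \<le> ennreal (1 / L ^ m) * (ennreal (L ^ m) * (\<Sum>j. hausdorff_weight m (E j)))"
      by (intro mult_left_mono) auto
    also have "\<dots> = (\<Sum>j. hausdorff_weight m (E j))"
      using L by (simp add: mult.assoc[symmetric] ennreal_mult''[symmetric])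
    finally show "ennreal (1 / L ^ m) * X \<le> (\<Sum>j. hausdorff_weight m (E j))" .
  qed
  also have "\<dots> \<le> hausdorff_measure m (f ` S)"
    unfolding hausdorff_delta_eq_cc hausdorff_measure_eq_cc by (rule cc_delta_le_measure[OF d])
  finally have "ennreal (L ^ m) * (ennreal (1 / L ^ m) * X) \<le> ennreal (L ^ m) * hausdorff_measure m (f ` S)"
    by (intro mult_left_mono) auto
  moreover have "ennreal (L ^ m) * (ennreal (1 / L ^ m) * X) = X"
    using L by (simp add: mult.assoc[symmetric] ennreal_mult''[symmetric])
  ultimately show "hausdorff_delta m \<delta> (g ` S) \<le> ennreal (L ^ m) * hausdorff_measure m (f ` S)"
    by (simp add: X_def)
qed

lemma cc_delta_le_finite:
  assumes I: "finite I" and "\<And>i. i \<in> I \<Longrightarrow> E i \<in> F" "A \<subseteq> (\<Union>i\<in>I. E i)"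
    and "\<And>i. i \<in> I \<Longrightarrow> ediam (E i) < \<delta>" and "0 < \<delta>" "{} \<in> F" "w {} = 0"
  shows "cc_delta F w \<delta> A \<le> (\<Sum>i\<in>I. w (E i))"
proof -
  obtain h where h: "bij_betw h {..<card I} I"
    using ex_bij_betw_nat_finite[OF I] by (auto simp: atLeast0LessThan)
  have hI: "h n \<in> I" if "n < card I" for n using h that by (auto simp: bij_betw_def)
  define G where "G = (\<lambda>n. if n < card I then E (h n) else {})"
  have "cc_delta F w \<delta> A \<le> (\<Sum>n. w (G n))"
  proof (rule cc_delta_le)
    show "A \<subseteq> (\<Union>j. G j)"
    proof
      fix x assume "x \<in> A"
      then obtain i where i: "i \<in> I" "x \<in> E i" using assms by blast
      then have "i \<in> h ` {..<card I}" using h by (simp add: bij_betw_def)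
      then obtain n where "n < card I" "h n = i" by auto
      then have "x \<in> G n" using i by (simp add: G_def)
      then show "x \<in> (\<Union>j. G j)" by blast
    qed
  qed (use assms hI in \<open>auto simp: G_def\<close>)
  also have "\<dots> = (\<Sum>n<card I. w (G n))"
    by (rule suminf_finite) (auto simp: G_def assms)
  also have "\<dots> = (\<Sum>n<card I. w (E (h n)))" by (intro sum.cong) (auto simp: G_def)
  also have "\<dots> = (\<Sum>i\<in>I. w (E i))" by (rule sum.reindex_bij_betw[OF h])
  finally show ?thesis .
qed

text \<open>The cube is covered by the \<open>(k + 1) ^ DIM('b)\<close> cells of a grid of width \<open>1 / k\<close>.\<close>
lemma hausdorff_measure_unit_cube_finite:
  "hausdorff_measure DIM('b) (cbox 0 (One::'b::euclidean_space)) < \<infinity>"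
proof -
  let ?D = "DIM('b)"
  define a where "a = unit_ball_vol (real ?D) / 2 ^ ?D"
  have a0: "0 \<le> a" by (simp add: a_def)
  have "hausdorff_delta ?D \<delta> (cbox 0 (One::'b)) \<le> ennreal (a * (2 * real ?D) ^ ?D)" if \<delta>: "0 < \<delta>" for \<delta>
  proof -
    obtain r :: real where r: "0 < r" "ennreal r \<le> \<delta>"
      using \<delta> by (cases \<delta>) (auto simp: ennreal_less_zero_iff intro: that[of 1])
    obtain k0 :: nat where k0: "real ?D / r < real k0" using reals_Archimedean2 by blast
    define k where "k = Suc k0"
    have k: "0 < k" "real ?D / real k < r"
      using k0 r by (auto simp: k_def field_simps)
    define I where "I = (Basis::'b set) \<rightarrow>\<^sub>E {0..int k}"
    define E where "E = (\<lambda>g. {x\<in>cbox 0 (One::'b). \<forall>i\<in>Basis. \<lfloor>real k * (x \<bullet> i)\<rfloor> = g i})"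
    have diam: "ediam (E g) \<le> ennreal (real ?D / real k)" for g
    proof (intro ediam_le ennreal_leI)
      fix x y assume xy: "x \<in> E g" "y \<in> E g"
      have "\<bar>(x - y) \<bullet> i\<bar> \<le> 1 / real k" if "i \<in> Basis" for i
      proof -
        have "\<lfloor>real k * (x \<bullet> i)\<rfloor> = \<lfloor>real k * (y \<bullet> i)\<rfloor>" using xy that by (auto simp: E_def)
        then have "\<bar>real k * (x \<bullet> i) - real k * (y \<bullet> i)\<bar> \<le> 1" by linarith
        then have "real k * \<bar>(x - y) \<bullet> i\<bar> \<le> 1"
          by (simp add: inner_diff_left right_diff_distrib[symmetric] abs_mult)
        then show ?thesis using k by (simp add: field_simps)
      qed
      then have "norm (x - y) \<le> (\<Sum>i\<in>(Basis::'b set). 1 / real k)"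
        by (intro order_trans[OF norm_le_l1] sum_mono) auto
      then show "dist x y \<le> real ?D / real k" by (simp add: dist_norm)
    qed
    have w: "hausdorff_weight ?D (E g) \<le> ennreal (a * (real ?D / real k) ^ ?D)" for g
    proof (cases "E g = {}")
      case False
      have "ediam (E g) ^ ?D \<le> ennreal (real ?D / real k) ^ ?D" by (intro power_mono diam) simp
      then show ?thesis
        using False a0 by (simp add: hausdorff_weight_def a_def[symmetric] ennreal_mult mult_left_mono ennreal_power)
    qed (simp add: hausdorff_weight_def)
    have finI: "finite I" unfolding I_def by (intro finite_PiE) auto
    have "nat (int k + 1) = k + 1" by linarith
    then have cardI: "card I = (k + 1) ^ ?D" by (simp add: I_def card_PiE)
    have "hausdorff_delta ?D \<delta> (cbox 0 (One::'b)) \<le> (\<Sum>g\<in>I. hausdorff_weight ?D (E g))"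
      unfolding hausdorff_delta_eq_cc
    proof (rule cc_delta_le_finite[OF finI])
      show "cbox 0 One \<subseteq> (\<Union>g\<in>I. E g)"
      proof
        fix x :: 'b assume x: "x \<in> cbox 0 One"
        define g where "g = (\<lambda>i\<in>Basis. \<lfloor>real k * (x \<bullet> i)\<rfloor>)"
        have "0 \<le> real k * (x \<bullet> i) \<and> real k * (x \<bullet> i) \<le> real k" if "i \<in> Basis" for i
          using x that k by (simp add: mem_box mult_left_le)
        then have "\<lfloor>real k * (x \<bullet> i)\<rfloor> \<in> {0..int k}" if "i \<in> Basis" for i
          using that by (fastforce simp: floor_le_iff)
        then have "g \<in> I" by (auto simp: I_def g_def)
        moreover have "x \<in> E g" using x by (simp add: E_def g_def)
        ultimately show "x \<in> (\<Union>g\<in>I. E g)" by blast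
      qed
      fix g
      have "ediam (E g) \<le> ennreal (real ?D / real k)" by (rule diam)
      also have "\<dots> < ennreal r" using k r by (simp add: ennreal_less_iff)
      finally show "ediam (E g) < \<delta>" using r by simp
    qed (use \<delta> in \<open>auto simp: hausdorff_weight_def\<close>)
    also have "\<dots> \<le> (\<Sum>g\<in>I. ennreal (a * (real ?D / real k) ^ ?D))" by (intro sum_mono w)
    also have "\<dots> = ennreal (real ((k + 1) ^ ?D) * (a * (real ?D / real k) ^ ?D))"
      using a0 by (simp add: cardI ennreal_of_nat_eq_real_of_nat ennreal_mult)
    also have "\<dots> \<le> ennreal (a * (2 * real ?D) ^ ?D)"
    proof (rule ennreal_leI)
      have "real ((k + 1) ^ ?D) * (real ?D / real k) ^ ?D = ((real k + 1) * (real ?D / real k)) ^ ?D"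
        unfolding power_mult_distrib by (simp add: add.commute)
      also have "\<dots> \<le> (2 * real ?D) ^ ?D"
      proof (rule power_mono)
        have "(real k + 1) * (real ?D / real k) \<le> (2 * real k) * (real ?D / real k)"
          using k by (intro mult_right_mono) auto
        then show "(real k + 1) * (real ?D / real k) \<le> 2 * real ?D" using k by simp
      qed auto
      finally have "a * (real ((k + 1) ^ ?D) * (real ?D / real k) ^ ?D) \<le> a * (2 * real ?D) ^ ?D"
        by (rule mult_left_mono[OF _ a0])
      then show "real ((k + 1) ^ ?D) * (a * (real ?D / real k) ^ ?D) \<le> a * (2 * real ?D) ^ ?D"
        by (simp add: mult.left_commute)
    qed
    finally show ?thesis .
  qed
  then have "hausdorff_measure ?D (cbox 0 (One::'b)) \<le> ennreal (a * (2 * real ?D) ^ ?D)"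
    unfolding hausdorff_measure_def by (intro SUP_least) auto
  then show ?thesis using ennreal_less_top le_less_trans by (metis infinity_ennreal_def)
qed

text \<open>A set of diameter d lies in a ball of radius d, whose volume is \<open>2 ^ DIM('b)\<close> times the weight of
  the set. In particular the unit cube has positive measure.\<close>
lemma lborel_le_hausdorff_measure:
  fixes A :: "'b::euclidean_space set"
  assumes A: "A \<in> sets borel"
  shows "emeasure lborel A \<le> 2 ^ DIM('b) * hausdorff_measure DIM('b) A"
proof -
  let ?D = "DIM('b)"
  define c where "c = ennreal (1 / 2 ^ ?D)"
  have two: "(2::ennreal) ^ ?D = ennreal (2 ^ ?D)" by (simp add: ennreal_power flip: ennreal_numeral)
  have c: "c * (2 ^ ?D * x) = x" "2 ^ ?D * (c * x) = x" for x
    by (simp_all add: c_def two mult.assoc[symmetric] ennreal_mult''[symmetric])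
  have "c * emeasure lborel A \<le> hausdorff_delta ?D \<infinity> A"
    unfolding hausdorff_delta_def
  proof (rule INF_greatest, clarify)
    fix E :: "nat \<Rightarrow> 'b set" assume E: "A \<subseteq> (\<Union>j. E j)" "\<forall>j. ediam (E j) < \<infinity>"
    have "\<exists>B. B \<in> sets borel \<and> E j \<subseteq> B \<and> emeasure lborel B \<le> 2 ^ ?D * hausdorff_weight ?D (E j)" for j
    proof (cases "E j = {}")
      case False
      then obtain x where x: "x \<in> E j" by blast
      obtain d where d: "0 \<le> d" "ediam (E j) = ennreal d"
        using E(2)[rule_format, of j] by (cases "ediam (E j)") auto
      have "E j \<subseteq> cball x d"
      proof
        fix y assume "y \<in> E j"
        then have "ennreal (dist x y) \<le> ennreal d" using dist_le_ediam[OF x] d by metis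
        then show "y \<in> cball x d" using d by simp
      qed
      moreover have "emeasure lborel (cball x d) \<le> 2 ^ ?D * hausdorff_weight ?D (E j)"
      proof -
        have "emeasure lborel (cball x d) = ennreal (unit_ball_vol (real ?D) * d ^ ?D)"
          by (rule emeasure_cball[OF d(1)])
        also have "\<dots> = 2 ^ ?D * (ennreal (unit_ball_vol (real ?D) / 2 ^ ?D) * ennreal d ^ ?D)"
          using d by (simp add: two ennreal_power ennreal_mult[symmetric])
        also have "\<dots> = 2 ^ ?D * hausdorff_weight ?D (E j)"
          using False d by (simp add: hausdorff_weight_def)
        finally show ?thesis by simp
      qed
      ultimately show ?thesis by (intro exI[of _ "cball x d"]) auto
    qed (auto intro: exI[of _ "{}"])
    then obtain B where B: "\<And>j. B j \<in> sets borel" "\<And>j. E j \<subseteq> B j"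
      "\<And>j. emeasure lborel (B j) \<le> 2 ^ ?D * hausdorff_weight ?D (E j)" by metis
    have "emeasure lborel A \<le> emeasure lborel (\<Union>j. B j)"
      using E(1) B by (intro emeasure_mono) (auto, blast)
    also have "\<dots> \<le> (\<Sum>j. emeasure lborel (B j))"
      using B by (intro emeasure_subadditive_countably) auto
    also have "\<dots> \<le> (\<Sum>j. 2 ^ ?D * hausdorff_weight ?D (E j))" by (intro suminf_le B) auto
    also have "\<dots> = 2 ^ ?D * (\<Sum>j. hausdorff_weight ?D (E j))" by simp
    finally have "c * emeasure lborel A \<le> c * (2 ^ ?D * (\<Sum>j. hausdorff_weight ?D (E j)))"
      by (intro mult_left_mono) auto
    then show "c * emeasure lborel A \<le> (\<Sum>j. hausdorff_weight ?D (E j))" by (simp add: c)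
  qed
  also have "\<dots> \<le> hausdorff_measure ?D A"
    unfolding hausdorff_delta_eq_cc hausdorff_measure_eq_cc by (rule cc_delta_le_measure) simp
  finally have "2 ^ ?D * (c * emeasure lborel A) \<le> 2 ^ ?D * hausdorff_measure ?D A"
    by (intro mult_left_mono) auto
  then show ?thesis by (simp add: c)
qed

text \<open>With Q the unit cube, \<open>emeasure M A\<close> is the integral of
  \<open>indicator A x * indicator Q (y - x)\<close> over x and y. Exchanging the integrals and substituting
  \<open>y + x\<close> for x turns it into \<open>emeasure lborel A\<close> times the M-measure of \<open>- Q\<close>, a constant that is
  determined by taking \<open>A = Q\<close>.\<close>
lemma translation_invariant_eq_lborel:
  fixes M :: "'b::euclidean_space measure"
  assumes M[measurable_cong]: "sets M = sets borel"
    and inv: "\<And>a A. A \<in> sets borel \<Longrightarrow> emeasure M ((\<lambda>x. a + x) ` A) = emeasure M A"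
    and fin: "emeasure M (cbox 0 One) < \<infinity>"
    and A[measurable]: "A \<in> sets borel"
  shows "emeasure M A = emeasure M (cbox 0 One) * emeasure lborel A"
proof -
  have spM: "space M = UNIV" using sets_eq_imp_space_eq[OF M] by simp
  obtain D :: "'b set" where D: "countable D" "\<And>X. open X \<Longrightarrow> X \<noteq> {} \<Longrightarrow> \<exists>d\<in>D. d \<in> X"
    using countable_dense_exists by blast
  have sf: "sigma_finite_measure M"
  proof
    show "\<exists>A. countable A \<and> A \<subseteq> sets M \<and> \<Union>A = space M \<and> (\<forall>a\<in>A. emeasure M a \<noteq> \<infinity>)"
    proof (intro exI[of _ "(\<lambda>d. (\<lambda>x. d + x) ` cbox 0 One) ` D"] conjI)
      show "\<Union>((\<lambda>d. (\<lambda>x. d + x) ` cbox 0 One) ` D) = space M"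
      proof -
        have "x \<in> \<Union>((\<lambda>d. (\<lambda>x. d + x) ` cbox 0 One) ` D)" for x :: 'b
        proof -
          have "open ((\<lambda>d. x - d) -` box 0 One)"
            by (intro open_vimage open_box continuous_intros)
          moreover have "x - One /\<^sub>R 2 \<in> (\<lambda>d. x - d) -` box 0 One" by (simp add: mem_box)
          ultimately obtain d where d: "d \<in> D" "x - d \<in> box 0 One" using D(2) by blast
          then have "x - d \<in> cbox 0 One" using box_subset_cbox by blast
          then have "x \<in> (\<lambda>x. d + x) ` cbox 0 One" by (intro image_eqI[of _ _ "x - d"]) auto
          then show ?thesis using d by blast
        qed
        then show ?thesis by (auto simp: spM)
      qed
      show "(\<lambda>d. (\<lambda>x. d + x) ` cbox 0 One) ` D \<subseteq> sets M"
        by (auto simp: M cbox_translation[symmetric])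
      show "\<forall>a\<in>(\<lambda>d. (\<lambda>x. d + x) ` cbox 0 One) ` D. emeasure M a \<noteq> \<infinity>"
        using fin by (auto simp: inv)
    qed (use D in auto)
  qed
  interpret sigma_finite_measure M by (rule sf)
  interpret P: pair_sigma_finite M "lborel :: 'b measure" ..
  have trM: "(\<integral>\<^sup>+x. h x \<partial>M) = (\<integral>\<^sup>+x. h (y + x) \<partial>M)" if [measurable]: "h \<in> borel_measurable borel" for h y
  proof -
    have "distr M M ((+) y) = M"
    proof (rule measure_eqI)
      fix B assume "B \<in> sets (distr M M ((+) y))"
      then have B: "B \<in> sets borel" by (simp add: M)
      have eq: "(+) y -` B = (\<lambda>x. - y + x) ` B" by (force simp: image_iff algebra_simps)
      have "emeasure (distr M M ((+) y)) B = emeasure M ((+) y -` B)"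
        using B by (subst emeasure_distr) (auto simp: M spM)
      then show "emeasure (distr M M ((+) y)) B = emeasure M B" unfolding eq inv[OF B] .
    qed simp
    then have "(\<integral>\<^sup>+x. h x \<partial>M) = (\<integral>\<^sup>+x. h x \<partial>distr M M ((+) y))" by simp
    also have "\<dots> = (\<integral>\<^sup>+x. h (y + x) \<partial>M)" by (rule nn_integral_distr) auto
    finally show ?thesis .
  qed
  have trL: "(\<integral>\<^sup>+x. h x \<partial>lborel) = (\<integral>\<^sup>+x. h (y + x) \<partial>lborel)" if [measurable]: "h \<in> borel_measurable borel"
    for h and y :: 'b
  proof -
    have "(\<integral>\<^sup>+x. h x \<partial>lborel) = (\<integral>\<^sup>+x. h x \<partial>distr lborel borel ((+) y))" by (simp add: lborel_distr_plus)
    also have "\<dots> = (\<integral>\<^sup>+x. h (y + x) \<partial>lborel)" by (rule nn_integral_distr) auto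
    finally show ?thesis .
  qed
  let ?Q = "cbox 0 One :: 'b set"
  have main: "emeasure M A = emeasure lborel A * emeasure M (uminus -` ?Q)" if A[measurable]: "A \<in> sets borel" for A
  proof -
    have "emeasure M A = (\<integral>\<^sup>+x. indicator A x * emeasure lborel ?Q \<partial>M)"
      by (simp add: M)
    also have "\<dots> = (\<integral>\<^sup>+x. (\<integral>\<^sup>+y. indicator A x * indicator ?Q (y - x) \<partial>lborel) \<partial>M)"
    proof (rule nn_integral_cong)
      fix x
      have "(\<integral>\<^sup>+y. indicator ?Q (y - x) \<partial>lborel) = (\<integral>\<^sup>+y. (indicator ?Q y :: ennreal) \<partial>lborel)"
        using trL[of "\<lambda>y. indicator ?Q (y - x)" x] by simp
      then show "indicator A x * emeasure lborel ?Q = (\<integral>\<^sup>+y. indicator A x * indicator ?Q (y - x) \<partial>lborel)"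
        by (simp add: nn_integral_cmult)
    qed
    also have "\<dots> = (\<integral>\<^sup>+y. (\<integral>\<^sup>+x. indicator A x * indicator ?Q (y - x) \<partial>M) \<partial>lborel)"
      by (rule P.Fubini'[symmetric]) measurable
    also have "\<dots> = (\<integral>\<^sup>+y. (\<integral>\<^sup>+x. indicator A (y + x) * indicator ?Q (- x) \<partial>M) \<partial>lborel)"
    proof (rule nn_integral_cong)
      fix y :: 'b
      show "(\<integral>\<^sup>+x. indicator A x * indicator ?Q (y - x) \<partial>M) =
        (\<integral>\<^sup>+x. indicator A (y + x) * indicator ?Q (- x) \<partial>M)"
        using trM[of "\<lambda>x. indicator A x * indicator ?Q (y - x)" y] by simp
    qed
    also have "\<dots> = (\<integral>\<^sup>+x. (\<integral>\<^sup>+y. indicator A (y + x) * indicator ?Q (- x) \<partial>lborel) \<partial>M)"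
      by (rule P.Fubini') measurable
    also have "\<dots> = (\<integral>\<^sup>+x. emeasure lborel A * indicator ?Q (- x) \<partial>M)"
    proof (rule nn_integral_cong)
      fix x :: 'b
      have "(\<integral>\<^sup>+y. indicator A (y + x) \<partial>lborel) = (\<integral>\<^sup>+y. (indicator A y :: ennreal) \<partial>lborel)"
        using trL[of "indicator A" x] by (simp add: add.commute)
      then show "(\<integral>\<^sup>+y. indicator A (y + x) * indicator ?Q (- x) \<partial>lborel) = emeasure lborel A * indicator ?Q (- x)"
        by (simp add: nn_integral_multc)
    qed
    also have "\<dots> = emeasure lborel A * (\<integral>\<^sup>+x. indicator ?Q (- x) \<partial>M)" by (rule nn_integral_cmult) measurable
    also have "(\<integral>\<^sup>+x. indicator ?Q (- x) \<partial>M) = emeasure M (uminus -` ?Q)"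
    proof -
      have "(\<integral>\<^sup>+x. indicator ?Q (- x) \<partial>M) = (\<integral>\<^sup>+x. indicator (uminus -` ?Q) x \<partial>M)"
        by (intro nn_integral_cong) (simp split: split_indicator)
      moreover have "uminus -` ?Q \<in> sets M"
        using measurable_sets[of uminus borel borel ?Q] by (simp add: M)
      ultimately show ?thesis by simp
    qed
    finally show ?thesis .
  qed
  have "emeasure M ?Q = emeasure M (uminus -` ?Q)" using main[of ?Q] by simp
  then show ?thesis using main[OF A] by (simp add: mult.commute)
qed

lemma inj_blinfun_lower_bound:
  fixes T :: "'b::euclidean_space \<Rightarrow>\<^sub>L 'a::real_normed_vector"
  assumes "inj (blinfun_apply T)"
  obtains c where "0 < c" "\<And>v. c * norm v \<le> norm (T v)"
proof -
  have ne: "sphere (0::'b) 1 \<noteq> {}"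
    using vector_choose_size[of 1, where 'a='b] by auto
  have "continuous_on (sphere 0 1) (\<lambda>v. norm (T v))" by (intro continuous_intros)
  then obtain v0 where v0: "v0 \<in> sphere 0 1" "\<And>v. v \<in> sphere 0 1 \<Longrightarrow> norm (T v0) \<le> norm (T v)"
    using continuous_attains_inf[OF compact_sphere ne] by blast
  have "T v0 \<noteq> T 0" using v0(1) injD[OF assms, of v0 0] by auto
  then have c: "0 < norm (T v0)" by (simp add: blinfun.zero_right)
  have "norm (T v0) * norm v \<le> norm (T v)" for v
  proof (cases "v = 0")
    case False
    then have "norm (T v0) \<le> norm (T (v /\<^sub>R norm v))" by (intro v0) simp
    then show ?thesis using False by (simp add: blinfun.scaleR_right field_simps)
  qed simp
  then show ?thesis using that c by blast
qed

text \<open>By the next lemma, this is the factor by which T multiplies m-dimensional measure; for Euclidean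
  spaces it is \<open>sqrt (det (T\<^sup>* T))\<close> times a constant.\<close>
definition area_factor :: "('b::euclidean_space \<Rightarrow>\<^sub>L 'a::real_normed_vector) \<Rightarrow> ennreal"
  where "area_factor T = hausdorff_measure DIM('b) (blinfun_apply T ` cbox 0 One)"

lemma hausdorff_measure_linear_image_inj:
  fixes T :: "'b::euclidean_space \<Rightarrow>\<^sub>L 'a::real_normed_vector"
  assumes T: "inj (blinfun_apply T)" and A: "A \<in> sets borel"
  shows "hausdorff_measure DIM('b) (T ` A) = area_factor T * emeasure lborel A"
    and "area_factor T < \<infinity>"
proof -
  obtain c where c: "0 < c" "\<And>v. c * norm v \<le> norm (T v)" using inj_blinfun_lower_bound[OF T] by blast
  define \<phi> where "\<phi> = (\<lambda>A. hausdorff_measure DIM('b) (T ` A))"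
  have mom: "metric_outer_measure \<phi>"
    unfolding metric_outer_measure_def
  proof (intro conjI allI impI)
    fix A B :: "'b set" and r :: real assume r: "0 < r" "\<forall>x\<in>A. \<forall>y\<in>B. r \<le> dist x y"
    show "\<phi> A + \<phi> B \<le> \<phi> (A \<union> B)"
      unfolding \<phi>_def image_Un
    proof (rule mom_separated[OF mom_H, of "c * r"])
      fix u v assume "u \<in> T ` A" "v \<in> T ` B"
      then obtain x y where xy: "x \<in> A" "y \<in> B" "u = T x" "v = T y" by auto
      have "c * r \<le> c * norm (x - y)" using r xy c by (intro mult_left_mono) (auto simp: dist_norm)
      also have "\<dots> \<le> norm (T (x - y))" by (rule c)
      finally show "c * r \<le> dist u v" by (simp add: xy dist_norm blinfun.diff_right)
    qed (use r c in simp)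
  qed (auto simp: \<phi>_def H_empty image_UN intro!: H_mono H_subadd)
  have fin: "area_factor T < \<infinity>"
  proof -
    have "area_factor T \<le> ennreal ((norm T + 1) ^ DIM('b)) * hausdorff_measure DIM('b) (id ` cbox 0 (One::'b))"
      unfolding area_factor_def
    proof (rule hausdorff_measure_le_of_dist_le)
      fix x y :: 'b
      have "norm (T (x - y)) \<le> norm T * norm (x - y)" by (rule norm_blinfun)
      also have "\<dots> \<le> (norm T + 1) * norm (x - y)" by (intro mult_right_mono) auto
      finally show "dist (T x) (T y) \<le> (norm T + 1) * dist (id x) (id y)"
        by (simp add: dist_norm blinfun.diff_right)
    qed (simp add: add_nonneg_pos)
    also have "\<dots> < \<infinity>" using hausdorff_measure_unit_cube_finite[where 'b='b] by (simp add: ennreal_mult_less_top)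
    finally show ?thesis .
  qed
  then show "area_factor T < \<infinity>" .
  have fin': "\<phi> (cbox 0 One) < \<infinity>" using fin by (simp add: area_factor_def \<phi>_def)
  have tr: "\<phi> ((\<lambda>x. a + x) ` A) = \<phi> A" for a A
  proof -
    have "hausdorff_measure DIM('b) ((\<lambda>x. T (a + x)) ` A) = hausdorff_measure DIM('b) (T ` A)"
      using hausdorff_measure_le_of_dist_le[of 1 A "\<lambda>x. T (a + x)" T "DIM('b)"]
        hausdorff_measure_le_of_dist_le[of 1 A T "\<lambda>x. T (a + x)" "DIM('b)"]
      by (intro antisym) (simp_all add: blinfun.add_right)
    then show ?thesis by (simp add: \<phi>_def image_image)
  qed
  have meas_tr: "(\<lambda>x. a + x) ` A \<in> sets borel" if "A \<in> sets borel" for a :: 'b and A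
  proof -
    have "(\<lambda>x. a + x) ` A = (\<lambda>x. x - a) -` A" by (force simp: image_iff algebra_simps)
    then show ?thesis using measurable_sets[of "\<lambda>x. x - a" borel borel A] that by simp
  qed
  have "emeasure (borel_part \<phi>) A = emeasure (borel_part \<phi>) (cbox 0 One) * emeasure lborel A"
    by (rule translation_invariant_eq_lborel)
      (use A fin' in \<open>auto simp: emeasure_borel_part[OF mom] meas_tr tr\<close>)
  then have "\<phi> A = \<phi> (cbox 0 One) * emeasure lborel A"
    using A by (simp add: emeasure_borel_part[OF mom])
  then show "hausdorff_measure DIM('b) (T ` A) = area_factor T * emeasure lborel A"
    by (simp add: area_factor_def \<phi>_def)
qed

definition hausdorff_const :: "'b::euclidean_space itself \<Rightarrow> ennreal"
  where "hausdorff_const _ = hausdorff_measure DIM('b) (cbox 0 (One::'b))"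

lemma hausdorff_measure_eq_lborel:
  assumes "A \<in> sets borel"
  shows "hausdorff_measure DIM('b) A = hausdorff_const TYPE('b::euclidean_space) * emeasure lborel (A :: 'b set)"
proof -
  have "inj (blinfun_apply (id_blinfun :: 'b \<Rightarrow>\<^sub>L 'b))" by (auto simp: inj_on_def)
  from hausdorff_measure_linear_image_inj(1)[OF this assms] show ?thesis
    by (simp add: area_factor_def hausdorff_const_def)
qed

lemma hausdorff_const_finite: "hausdorff_const TYPE('b::euclidean_space) < \<infinity>"
  unfolding hausdorff_const_def by (rule hausdorff_measure_unit_cube_finite)

lemma hausdorff_const_pos: "0 < hausdorff_const TYPE('b::euclidean_space)"
proof -
  have "1 \<le> 2 ^ DIM('b) * hausdorff_const TYPE('b)"
    using lborel_le_hausdorff_measure[of "cbox 0 (One::'b)"] by (simp add: hausdorff_const_def)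
  then show ?thesis by (cases "hausdorff_const TYPE('b) = 0") (auto simp: zero_less_iff_neq_zero)
qed

lemma hausdorff_measure_image_le_lborel:
  fixes f :: "'b::euclidean_space \<Rightarrow> 'a::metric_space"
  assumes L: "0 < L" and "\<And>x y. x \<in> S \<Longrightarrow> y \<in> S \<Longrightarrow> dist (f x) (f y) \<le> L * dist x y"
    and S: "S \<in> sets borel"
  shows "hausdorff_measure DIM('b) (f ` S) \<le> ennreal (L ^ DIM('b)) * hausdorff_const TYPE('b) * emeasure lborel S"
  using hausdorff_measure_le_of_dist_le[OF L, of S f "\<lambda>x. x" "DIM('b)"] assms
  by (simp add: hausdorff_measure_eq_lborel mult.assoc)

definition close_to_linear :: "real \<Rightarrow> ('b::real_normed_vector \<Rightarrow>\<^sub>L 'a::real_normed_vector) \<Rightarrow> ('b \<Rightarrow> 'a) \<Rightarrow> 'b set \<Rightarrow> bool"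
  where "close_to_linear e T f S \<longleftrightarrow> (\<forall>x\<in>S. \<forall>y\<in>S. norm (f x - f y - T (x - y)) \<le> e * norm (x - y))"

lemma close_to_linearD:
  "close_to_linear e T f S \<Longrightarrow> x \<in> S \<Longrightarrow> y \<in> S \<Longrightarrow> norm (f x - f y - T (x - y)) \<le> e * norm (x - y)"
  unfolding close_to_linear_def by blast

lemma close_to_linear_subset: "close_to_linear e T f S \<Longrightarrow> S' \<subseteq> S \<Longrightarrow> close_to_linear e T f S'"
  unfolding close_to_linear_def by blast

lemma close_to_linear_mono: "close_to_linear e T f S \<Longrightarrow> e \<le> e' \<Longrightarrow> close_to_linear e' T f S"
  unfolding close_to_linear_def by (meson mult_right_mono norm_ge_zero order_trans)

lemma close_to_linear_perturb:
  assumes "close_to_linear e T f S"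
  shows "close_to_linear (e + norm (T' - T)) T' f S"
  unfolding close_to_linear_def
proof (intro ballI)
  fix x y assume xy: "x \<in> S" "y \<in> S"
  have "norm (f x - f y - T' (x - y)) \<le> norm (f x - f y - T (x - y)) + norm ((T' - T) (x - y))"
    by (rule order_trans[OF _ norm_triangle_ineq4]) (simp add: blinfun.diff_left)
  also have "\<dots> \<le> e * norm (x - y) + norm (T' - T) * norm (x - y)"
    by (intro add_mono close_to_linearD[OF assms] xy norm_blinfun)
  finally show "norm (f x - f y - T' (x - y)) \<le> (e + norm (T' - T)) * norm (x - y)"
    by (simp add: algebra_simps)
qed

lemma close_to_linear_dist_le:
  assumes "close_to_linear e T f S" "x \<in> S" "y \<in> S"
  shows "dist (f x) (f y) \<le> norm (T (x - y)) + e * norm (x - y)"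
  using norm_triangle_ineq[of "f x - f y - T (x - y)" "T (x - y)"] close_to_linearD[OF assms]
  by (simp add: dist_norm)

lemma close_to_linear_dist_le_norm:
  assumes "close_to_linear e T f S" "x \<in> S" "y \<in> S"
  shows "dist (f x) (f y) \<le> (norm T + e) * dist x y"
  using close_to_linear_dist_le[OF assms] norm_blinfun[of T "x - y"]
  by (simp add: dist_norm algebra_simps)

text \<open>If T is bounded below by c, then a map close to T on S is a Lipschitz function of T on S, and
  conversely.\<close>
lemma hausdorff_measure_close_upper:
  fixes T :: "'b::euclidean_space \<Rightarrow>\<^sub>L 'a::real_normed_vector"
  assumes c: "0 < c" "\<And>v. c * norm v \<le> norm (T v)" and e: "0 \<le> e"
    and f: "close_to_linear e T f S" and S: "S \<in> sets borel"
  shows "hausdorff_measure DIM('b) (f ` S) \<le> ennreal ((1 + e / c) ^ DIM('b)) * (area_factor T * emeasure lborel S)"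
proof -
  have "hausdorff_measure DIM('b) (f ` S) \<le> ennreal ((1 + e / c) ^ DIM('b)) * hausdorff_measure DIM('b) (T ` S)"
  proof (rule hausdorff_measure_le_of_dist_le)
    fix x y assume xy: "x \<in> S" "y \<in> S"
    have "dist (f x) (f y) \<le> norm (T (x - y)) + e * norm (x - y)"
      by (rule close_to_linear_dist_le[OF f xy])
    also have "\<dots> \<le> norm (T (x - y)) + e * (norm (T (x - y)) / c)"
      using c e by (intro add_left_mono mult_left_mono) (auto simp: field_simps)
    finally show "dist (f x) (f y) \<le> (1 + e / c) * dist (T x) (T y)"
      by (simp add: dist_norm blinfun.diff_right algebra_simps)
  qed (use c e in \<open>auto intro: add_pos_nonneg\<close>)
  also have "inj (blinfun_apply T)"
  proof (rule injI)
    fix x y assume "T x = T y"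
    then show "x = y" using c(2)[of "x - y"] c(1) by (simp add: blinfun.diff_right mult_le_0_iff)
  qed
  note hausdorff_measure_linear_image_inj(1)[OF this S]
  finally show ?thesis .
qed

lemma hausdorff_measure_close_lower:
  fixes T :: "'b::euclidean_space \<Rightarrow>\<^sub>L 'a::real_normed_vector"
  assumes c: "\<And>v. c * norm v \<le> norm (T v)" and e: "0 \<le> e" "e < c"
    and f: "close_to_linear e T f S" and S: "S \<in> sets borel"
  shows "area_factor T * emeasure lborel S \<le> ennreal ((1 / (1 - e / c)) ^ DIM('b)) * hausdorff_measure DIM('b) (f ` S)"
proof -
  have c0: "0 < c" using e by simp
  have ec: "0 < 1 - e / c" using e c0 by simp
  have "inj (blinfun_apply T)"
  proof (rule injI)
    fix x y assume "T x = T y"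
    then show "x = y" using c(1)[of "x - y"] c0 by (simp add: blinfun.diff_right mult_le_0_iff)
  qed
  note hausdorff_measure_linear_image_inj(1)[OF this S, symmetric]
  also have "hausdorff_measure DIM('b) (T ` S) \<le> ennreal ((1 / (1 - e / c)) ^ DIM('b)) * hausdorff_measure DIM('b) (f ` S)"
  proof (rule hausdorff_measure_le_of_dist_le)
    fix x y assume xy: "x \<in> S" "y \<in> S"
    have "norm (T (x - y)) \<le> norm (f x - f y) + norm (f x - f y - T (x - y))"
      using norm_triangle_ineq4[of "f x - f y" "f x - f y - T (x - y)"] by simp
    also have "norm (f x - f y - T (x - y)) \<le> e * norm (x - y)" by (rule close_to_linearD[OF f xy])
    also have "e * norm (x - y) \<le> e * (norm (T (x - y)) / c)"
      using c[of "x - y"] c0 e by (intro mult_left_mono) (auto simp: field_simps)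
    finally have "(1 - e / c) * norm (T (x - y)) \<le> norm (f x - f y)" by (simp add: algebra_simps)
    then show "dist (T x) (T y) \<le> 1 / (1 - e / c) * dist (f x) (f y)"
      using ec by (simp add: dist_norm blinfun.diff_right pos_le_divide_eq mult.commute)
  qed (use ec in simp)
  finally show ?thesis .
qed

text \<open>The map scales the direction \<open>v0\<close> by e and fixes the orthogonal complement. The images of the
  cube lie in slabs that shrink to a hyperplane, so that their volumes tend to 0.\<close>
lemma lborel_compress_small:
  fixes v0 :: "'b::euclidean_space"
  assumes v0: "norm v0 = 1" and \<eta>: "0 < (\<eta>::ennreal)"
  obtains e where "0 < e" "e < 1"
    "emeasure lborel ((\<lambda>v. v - ((1 - e) * (v \<bullet> v0)) *\<^sub>R v0) ` cbox 0 One) < \<eta>"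
proof -
  obtain R where R: "0 < R" "\<And>v. v \<in> cbox 0 (One::'b) \<Longrightarrow> norm v \<le> R"
    using bounded_pos[of "cbox 0 (One::'b)"] by auto
  define K where "K = (\<lambda>n::nat. {v. \<bar>v \<bullet> v0\<bar> \<le> R / (n + 2)} \<inter> cball 0 (2 * R))"
  have Kc: "closed (K n)" for n
    unfolding K_def by (intro closed_Int closed_Collect_le continuous_intros) auto
  have "(\<lambda>n. emeasure lborel (K n)) \<longlonglongrightarrow> emeasure lborel (\<Inter>n. K n)"
  proof (rule Lim_emeasure_decseq)
    show "range K \<subseteq> sets lborel" using Kc by auto
    show "decseq K"
    proof (rule decseq_SucI)
      fix n
      have "R / (real (Suc n) + 2) \<le> R / (real n + 2)" using R by (intro divide_left_mono) auto
      then show "K (Suc n) \<subseteq> K n" by (auto simp: K_def)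
    qed
    show "emeasure lborel (K n) \<noteq> \<infinity>" for n
    proof -
      have "emeasure lborel (K n) \<le> emeasure lborel (cball 0 (2 * R) :: 'b set)"
        by (intro emeasure_mono) (auto simp: K_def)
      then show ?thesis using emeasure_lborel_cball_finite[of "0::'b" "2 * R"] by (auto simp: less_top top_unique)
    qed
  qed
  moreover have "emeasure lborel (\<Inter>n. K n) = 0"
  proof -
    have "(\<Inter>n. K n) \<subseteq> {v. v0 \<bullet> v = 0}"
    proof
      fix v assume v: "v \<in> (\<Inter>n. K n)"
      have "(\<lambda>n. R / (real n + 2)) \<longlonglongrightarrow> 0" by real_asymp
      then have "\<bar>v \<bullet> v0\<bar> \<le> 0"
        by (rule LIMSEQ_le_const) (use v in \<open>auto simp: K_def\<close>)
      then show "v \<in> {v. v0 \<bullet> v = 0}" by (simp add: inner_commute)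
    qed
    then have "negligible (\<Inter>n. K n)"
      by (rule negligible_subset[rotated]) (use v0 in \<open>auto intro!: negligible_hyperplane\<close>)
    moreover have "(\<Inter>n. K n) \<in> sets borel" using Kc by (intro borel_closed closed_INT) auto
    ultimately show ?thesis by (simp add: negligible_iff_emeasure0)
  qed
  ultimately have "\<forall>\<^sub>F n in sequentially. emeasure lborel (K n) < \<eta>"
    using \<eta> by (metis order_tendstoD(2))
  then obtain n where n: "emeasure lborel (K n) < \<eta>" by (auto dest: eventually_happens)
  \<comment> \<open>The denominator is at least 2, so that \<open>e < 1\<close>.\<close>
  define e where "e = 1 / (real n + 2)"
  have e: "0 < e" "e < 1" by (auto simp: e_def)
  have "(\<lambda>v. v - ((1 - e) * (v \<bullet> v0)) *\<^sub>R v0) ` cbox 0 One \<subseteq> K n"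
  proof clarify
    fix v :: 'b assume v: "v \<in> cbox 0 One"
    have v0v0: "v0 \<bullet> v0 = 1" using v0 by (simp add: norm_eq_1)
    have vR: "\<bar>v \<bullet> v0\<bar> \<le> R"
      using Cauchy_Schwarz_ineq2[of v v0] R(2)[OF v] v0 by simp
    have "\<bar>(v - ((1 - e) * (v \<bullet> v0)) *\<^sub>R v0) \<bullet> v0\<bar> = e * \<bar>v \<bullet> v0\<bar>"
      using e by (simp add: inner_diff_left v0v0 algebra_simps abs_mult)
    also have "\<dots> \<le> e * R" using vR e by (intro mult_left_mono) auto
    also have "\<dots> = R / (n + 2)" by (simp add: e_def)
    finally have 1: "\<bar>(v - ((1 - e) * (v \<bullet> v0)) *\<^sub>R v0) \<bullet> v0\<bar> \<le> R / (n + 2)" .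
    have "norm (v - ((1 - e) * (v \<bullet> v0)) *\<^sub>R v0) \<le> norm v + (1 - e) * \<bar>v \<bullet> v0\<bar>"
      using norm_triangle_ineq4[of v "((1 - e) * (v \<bullet> v0)) *\<^sub>R v0"] e v0 by (simp add: abs_mult)
    also have "\<dots> \<le> R + 1 * R"
      using e vR R(2)[OF v] by (intro add_mono mult_mono) auto
    finally show "v - ((1 - e) * (v \<bullet> v0)) *\<^sub>R v0 \<in> K n" using 1 by (simp add: K_def add.commute)
  qed
  then have "emeasure lborel ((\<lambda>v. v - ((1 - e) * (v \<bullet> v0)) *\<^sub>R v0) ` cbox 0 One) \<le> emeasure lborel (K n)"
    by (rule emeasure_mono) (use Kc in auto)
  then show ?thesis using that e n by (meson le_less_trans)
qed

text \<open>Maps close to a degenerate linear map nearly lose measure. Let T annihilate the unit vector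
  \<open>v0\<close> and let U scale \<open>v0\<close> by e. Then \<open>norm (T v) + e * norm v\<close> is bounded by
  \<open>(norm T + 1) * norm (U v)\<close>, so that f is a Lipschitz function of U with a constant independent of
  e, while the volume of \<open>U ` S\<close> is small.\<close>
lemma hausdorff_measure_close_noninj:
  fixes T :: "'b::euclidean_space \<Rightarrow>\<^sub>L 'a::real_normed_vector"
  assumes T: "\<not> inj (blinfun_apply T)" and \<eta>: "0 < (\<eta>::ennreal)"
  obtains e where "0 < e" "\<And>f S. close_to_linear e T f S \<Longrightarrow> S \<in> sets borel \<Longrightarrow>
    hausdorff_measure DIM('b) (f ` S) \<le> \<eta> * emeasure lborel S"
proof -
  obtain w1 w2 where "w1 \<noteq> w2" "T w1 = T w2" using T by (auto simp: inj_def)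
  define v0 where "v0 = (w1 - w2) /\<^sub>R norm (w1 - w2)"
  have v0: "norm v0 = 1" "T v0 = 0"
    using \<open>w1 \<noteq> w2\<close> \<open>T w1 = T w2\<close> by (auto simp: v0_def blinfun.scaleR_right blinfun.diff_right)
  have v0v0: "v0 \<bullet> v0 = 1" using v0 by (simp add: norm_eq_1)
  define L where "L = norm T + 1"
  have L: "0 < L" by (simp add: L_def add_nonneg_pos)
  \<comment> \<open>C is the total distortion from \<open>U ` S\<close> to \<open>f ` S\<close> in terms of
    Lebesgue measure, so the volume of the compressed cube must be below \<open>\<eta> / C\<close>.\<close>
  define C where "C = ennreal (L ^ DIM('b)) * hausdorff_const TYPE('b)"
  have C: "C < \<infinity>" "0 < C"
    using L hausdorff_const_finite[where 'b='b] hausdorff_const_pos[where 'b='b]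
    by (auto simp: C_def ennreal_mult_less_top ennreal_zero_less_mult_iff)
  have "0 < \<eta> / C" using \<eta> C by (simp add: ennreal_zero_less_divide less_top)
  then obtain e where e: "0 < e" "e < 1"
    and small: "emeasure lborel ((\<lambda>v. v - ((1 - e) * (v \<bullet> v0)) *\<^sub>R v0) ` cbox 0 One) < \<eta> / C"
    using lborel_compress_small[OF v0(1)] by blast
  \<comment> \<open>The compression of \<open>lborel_compress_small\<close> as a bounded linear map.\<close>
  define U where "U = id_blinfun - (1 - e) *\<^sub>R (blinfun_scaleR_left v0 o\<^sub>L blinfun_inner_left v0)"
  have U: "U v = v - ((1 - e) * (v \<bullet> v0)) *\<^sub>R v0" for v
    by (simp add: U_def blinfun.diff_left blinfun.scaleR_left)
  have nU: "(norm (U v))\<^sup>2 = (norm (v - (v \<bullet> v0) *\<^sub>R v0))\<^sup>2 + (e * (v \<bullet> v0))\<^sup>2" for v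
    unfolding U power2_norm_eq_inner
    by (simp add: inner_diff_left inner_diff_right v0v0 inner_commute algebra_simps power2_eq_square)
  have 1: "norm (v - (v \<bullet> v0) *\<^sub>R v0) \<le> norm (U v)" for v
    by (rule power2_le_imp_le) (auto simp: nU)
  have 2: "e * norm v \<le> norm (U v)" for v
  proof (rule power2_le_imp_le)
    have "(norm v)\<^sup>2 = (norm (v - (v \<bullet> v0) *\<^sub>R v0))\<^sup>2 + (v \<bullet> v0)\<^sup>2"
      unfolding power2_norm_eq_inner
      by (simp add: inner_diff_left inner_diff_right v0v0 inner_commute algebra_simps power2_eq_square)
    then have "(e * norm v)\<^sup>2 = e\<^sup>2 * (norm (v - (v \<bullet> v0) *\<^sub>R v0))\<^sup>2 + (e * (v \<bullet> v0))\<^sup>2"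
      by (simp add: power_mult_distrib algebra_simps)
    also have "\<dots> \<le> 1 * (norm (v - (v \<bullet> v0) *\<^sub>R v0))\<^sup>2 + (e * (v \<bullet> v0))\<^sup>2"
      using e by (intro add_mono mult_right_mono) (auto simp: power_le_one)
    finally show "(e * norm v)\<^sup>2 \<le> (norm (U v))\<^sup>2" by (simp add: nU)
  qed simp
  have injU: "inj (blinfun_apply U)"
  proof (rule injI)
    fix x y assume "U x = U y"
    then show "x = y" using 2[of "x - y"] e by (simp add: blinfun.diff_right mult_le_0_iff)
  qed
  have JU: "area_factor U = hausdorff_const TYPE('b) * emeasure lborel (U ` cbox 0 One)"
    unfolding area_factor_def
    by (rule hausdorff_measure_eq_lborel) (auto intro!: borel_compact compact_continuous_image continuous_intros)
  show ?thesis
  proof (rule that[OF e(1)])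
    fix f and S :: "'b set" assume f: "close_to_linear e T f S" and S: "S \<in> sets borel"
    have "hausdorff_measure DIM('b) (f ` S) \<le> ennreal (L ^ DIM('b)) * hausdorff_measure DIM('b) (U ` S)"
    proof (rule hausdorff_measure_le_of_dist_le[OF L])
      fix x y assume xy: "x \<in> S" "y \<in> S"
      define v where "v = x - y"
      have "T v = T (v - (v \<bullet> v0) *\<^sub>R v0)" by (simp add: blinfun.diff_right blinfun.scaleR_right v0)
      then have "norm (T v) \<le> norm T * norm (v - (v \<bullet> v0) *\<^sub>R v0)" using norm_blinfun by metis
      also have "\<dots> \<le> norm T * norm (U v)" by (intro mult_left_mono 1) simp
      finally have "norm (T v) + e * norm v \<le> norm T * norm (U v) + norm (U v)"
        using 2[of v] by simp
      then show "dist (f x) (f y) \<le> L * dist (U x) (U y)"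
        using close_to_linear_dist_le[OF f xy]
        by (simp add: v_def L_def dist_norm blinfun.diff_right algebra_simps)
    qed
    also have "\<dots> = C * emeasure lborel (U ` cbox 0 One) * emeasure lborel S"
      unfolding hausdorff_measure_linear_image_inj(1)[OF injU S] JU C_def by (simp add: mult_ac)
    also have "\<dots> \<le> C * (\<eta> / C) * emeasure lborel S"
      using small by (intro mult_right_mono mult_left_mono) (auto simp: U)
    also have "C * (\<eta> / C) = \<eta> * C / C" by (simp add: ennreal_times_divide mult.commute)
    also have "\<dots> = \<eta>" using C by (intro ennreal_mult_divide_eq) auto
    finally show "hausdorff_measure DIM('b) (f ` S) \<le> \<eta> * emeasure lborel S" .
  qed
qed

lemma area_factor_noninj:
  fixes T :: "'b::euclidean_space \<Rightarrow>\<^sub>L 'a::real_normed_vector"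
  assumes T: "\<not> inj (blinfun_apply T)"
  shows "area_factor T = 0"
proof -
  have "area_factor T \<le> 0 + ennreal e" if e: "0 < e" for e
  proof -
    obtain e' where e': "0 < e'" "\<And>f S. close_to_linear e' T f S \<Longrightarrow> S \<in> sets borel \<Longrightarrow>
      hausdorff_measure DIM('b) (f ` S) \<le> ennreal e * emeasure lborel S"
      using hausdorff_measure_close_noninj[OF T, of "ennreal e"] e by auto
    have "close_to_linear e' T (blinfun_apply T) (cbox 0 One)"
      using e'(1) by (simp add: close_to_linear_def blinfun.diff_right)
    from e'(2)[OF this] show ?thesis by (simp add: area_factor_def)
  qed
  then have "area_factor T \<le> 0" by (rule ennreal_le_epsilon)
  then show ?thesis by simp
qed

lemma area_factor_pos:
  fixes T :: "'b::euclidean_space \<Rightarrow>\<^sub>L 'a::real_normed_vector"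
  assumes T: "inj (blinfun_apply T)"
  shows "0 < area_factor T"
proof -
  obtain c where c: "0 < c" "\<And>v. c * norm v \<le> norm (T v)" using inj_blinfun_lower_bound[OF T] by blast
  have "hausdorff_measure DIM('b) ((\<lambda>x::'b. x) ` cbox 0 One) \<le> ennreal ((1/c) ^ DIM('b)) * hausdorff_measure DIM('b) (T ` cbox 0 One)"
  proof (rule hausdorff_measure_le_of_dist_le)
    fix x y :: 'b
    show "dist x y \<le> 1 / c * dist (T x) (T y)"
      using c(2)[of "x - y"] c(1) by (simp add: dist_norm blinfun.diff_right field_simps)
  qed (use c in simp)
  then have "hausdorff_const TYPE('b) \<le> ennreal ((1/c) ^ DIM('b)) * area_factor T"
    by (simp add: area_factor_def hausdorff_const_def)
  then show ?thesis using hausdorff_const_pos[where 'b='b]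
    by (cases "area_factor T = 0") (auto simp: zero_less_iff_neq_zero)
qed

section \<open>The area factor as a limit of semicontinuous bounds\<close>

text \<open>The smallest C with \<open>H (f ` S) \<le> C * emeasure lborel S\<close> for all f that are closer than e to T on S.
  The strict inequality \<open>e' < e\<close> makes it lower semicontinuous in T (\<open>open_area_bound\<close>).\<close>
definition area_bound :: "real \<Rightarrow> ('b::euclidean_space \<Rightarrow>\<^sub>L 'a::real_normed_vector) \<Rightarrow> ennreal"
  where "area_bound e T = (SUP p\<in>{(f, S). S \<in> sets borel \<and> 0 < emeasure lborel S \<and> emeasure lborel S < \<infinity> \<and>
    (\<exists>e'<e. close_to_linear e' T f S)}.
      hausdorff_measure DIM('b) (fst p ` snd p) / emeasure lborel (snd p))"

lemma area_bound_upper: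
  fixes T :: "'b::euclidean_space \<Rightarrow>\<^sub>L 'a::real_normed_vector"
  assumes f: "close_to_linear e' T f S" "0 \<le> e'" "e' < e" and S: "S \<in> sets borel" "emeasure lborel S < \<infinity>"
  shows "hausdorff_measure DIM('b) (f ` S) \<le> area_bound e T * emeasure lborel S"
proof (cases "emeasure lborel S = 0")
  case True
  have "hausdorff_measure DIM('b) (f ` S) \<le>
    ennreal ((norm T + e) ^ DIM('b)) * hausdorff_const TYPE('b) * emeasure lborel S"
  proof (rule hausdorff_measure_image_le_lborel)
    show "0 < norm T + e" using f by (simp add: add_nonneg_pos)
    show "dist (f x) (f y) \<le> (norm T + e) * dist x y" if "x \<in> S" "y \<in> S" for x y
      using close_to_linear_dist_le_norm[OF close_to_linear_mono[OF f(1), of e] that] f by simp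
  qed fact
  then show ?thesis using True by simp
next
  case False
  have "hausdorff_measure DIM('b) (f ` S) / emeasure lborel S \<le> area_bound e T"
    unfolding area_bound_def
    by (rule SUP_upper2[of "(f, S)"]) (use False f S in \<open>auto simp: zero_less_iff_neq_zero\<close>)
  then have "hausdorff_measure DIM('b) (f ` S) / emeasure lborel S * emeasure lborel S \<le> area_bound e T * emeasure lborel S"
    by (intro mult_right_mono) auto
  then show ?thesis using False S by (simp add: ennreal_divide_times ennreal_divide_self less_top)
qed

lemma area_bound_least:
  fixes T :: "'b::euclidean_space \<Rightarrow>\<^sub>L 'a::real_normed_vector"
  assumes "\<And>f S e'. close_to_linear e' T f S \<Longrightarrow> e' < e \<Longrightarrow> S \<in> sets borel \<Longrightarrow>
    hausdorff_measure DIM('b) (f ` S) \<le> C * emeasure lborel S"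
  shows "area_bound e T \<le> C"
  unfolding area_bound_def
proof (rule SUP_least, clarsimp)
  fix f and S :: "'b set" and e' assume S: "S \<in> sets borel" "0 < emeasure lborel S" "emeasure lborel S < \<top>"
    and f: "e' < e" "close_to_linear e' T f S"
  have "hausdorff_measure DIM('b) (f ` S) \<le> C * emeasure lborel S" using assms f S by blast
  then have "hausdorff_measure DIM('b) (f ` S) / emeasure lborel S \<le> C * emeasure lborel S / emeasure lborel S"
    by (rule divide_right_mono_ennreal)
  also have "\<dots> = C" using S by (intro ennreal_mult_divide_eq) auto
  finally show "hausdorff_measure DIM('b) (f ` S) / emeasure lborel S \<le> C" .
qed

lemma area_bound_mono: "e \<le> e' \<Longrightarrow> area_bound e T \<le> area_bound e' T"
  unfolding area_bound_def by (rule SUP_subset_mono) (auto intro: less_le_trans)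

lemma area_bound_le_norm:
  fixes T :: "'b::euclidean_space \<Rightarrow>\<^sub>L 'a::real_normed_vector"
  assumes "0 < e"
  shows "area_bound e T \<le> ennreal ((norm T + e) ^ DIM('b)) * hausdorff_const TYPE('b)"
proof (rule area_bound_least)
  fix f S e' assume f: "close_to_linear e' T f S" "e' < e" and S: "S \<in> sets (borel :: 'b measure)"
  show "hausdorff_measure DIM('b) (f ` S) \<le>
    ennreal ((norm T + e) ^ DIM('b)) * hausdorff_const TYPE('b) * emeasure lborel S"
  proof (rule hausdorff_measure_image_le_lborel)
    show "0 < norm T + e" using assms by (simp add: add_nonneg_pos)
    show "dist (f x) (f y) \<le> (norm T + e) * dist x y" if "x \<in> S" "y \<in> S" for x y
      using close_to_linear_dist_le_norm[OF close_to_linear_mono[OF f(1), of e] that] f by simp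
  qed fact
qed

lemma area_factor_le_area_bound:
  fixes T :: "'b::euclidean_space \<Rightarrow>\<^sub>L 'a::real_normed_vector"
  assumes e: "0 < e"
  shows "area_factor T \<le> area_bound e T"
proof -
  have "close_to_linear 0 T (blinfun_apply T) (cbox 0 One)"
    by (simp add: close_to_linear_def blinfun.diff_right)
  from area_bound_upper[OF this _ e] show ?thesis by (simp add: area_factor_def)
qed

text \<open>For injective T the bounds are at most \<open>(1 + e / c) ^ m * area_factor T\<close>; for degenerate T they
  tend to 0.\<close>
lemma area_factor_eq_INF:
  fixes T :: "'b::euclidean_space \<Rightarrow>\<^sub>L 'a::real_normed_vector"
  shows "area_factor T = (INF n. area_bound (1 / Suc n) T)"
proof (rule antisym)
  show "area_factor T \<le> (INF n. area_bound (1 / Suc n) T)"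
    by (intro INF_greatest area_factor_le_area_bound) simp
  show "(INF n. area_bound (1 / Suc n) T) \<le> area_factor T"
  proof (cases "inj (blinfun_apply T)")
    case True
    obtain c where c: "0 < c" "\<And>v. c * norm v \<le> norm (T v)" using inj_blinfun_lower_bound[OF True] by blast
    have bd: "area_bound e T \<le> ennreal ((1 + e / c) ^ DIM('b)) * area_factor T" if e: "0 < e" for e
    proof (rule area_bound_least)
      fix f S e' assume f: "close_to_linear e' T f S" "e' < e" and S: "S \<in> sets (borel :: 'b measure)"
      show "hausdorff_measure DIM('b) (f ` S) \<le> ennreal ((1 + e / c) ^ DIM('b)) * area_factor T * emeasure lborel S"
        using hausdorff_measure_close_upper[OF c _ close_to_linear_mono[OF f(1), of e] S] e f
        by (simp add: mult.assoc)
    qed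
    have "(\<lambda>n. 1 / real (Suc n)) \<longlonglongrightarrow> 0"
      using LIMSEQ_inverse_real_of_nat by (simp add: inverse_eq_divide)
    then have "(\<lambda>n. (1 + (1 / Suc n) / c) ^ DIM('b)) \<longlonglongrightarrow> (1 + 0 / c) ^ DIM('b)"
      using c by (intro tendsto_intros) auto
    then have "(\<lambda>n. area_factor T * ennreal ((1 + (1 / Suc n) / c) ^ DIM('b))) \<longlonglongrightarrow> area_factor T * ennreal ((1 + 0 / c) ^ DIM('b))"
      using hausdorff_measure_linear_image_inj(2)[OF True borel_open[OF open_empty]]
      by (intro ennreal_tendsto_cmult tendsto_ennrealI) auto
    then have "(\<lambda>n. ennreal ((1 + (1 / Suc n) / c) ^ DIM('b)) * area_factor T) \<longlonglongrightarrow> area_factor T"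
      by (simp add: mult.commute)
    moreover have "(INF n. area_bound (1 / Suc n) T) \<le> ennreal ((1 + (1 / Suc n) / c) ^ DIM('b)) * area_factor T" for n
      using bd[of "1 / Suc n"] by (intro INF_lower2[of n]) auto
    ultimately show ?thesis by (intro LIMSEQ_le_const) blast+
  next
    case False
    have "(INF n. area_bound (1 / Suc n) T) \<le> 0 + ennreal \<eta>" if \<eta>: "0 < \<eta>" for \<eta>
    proof -
      obtain e where e: "0 < e" "\<And>f S. close_to_linear e T f S \<Longrightarrow> S \<in> sets borel \<Longrightarrow>
        hausdorff_measure DIM('b) (f ` S) \<le> ennreal \<eta> * emeasure lborel S"
        using hausdorff_measure_close_noninj[OF False, of "ennreal \<eta>"] \<eta> by auto
      obtain n where n: "1 / real (Suc n) < e" using nat_approx_posE[OF e(1)] by metis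
      have "area_bound (1 / Suc n) T \<le> ennreal \<eta>"
        by (rule area_bound_least, rule e(2)) (use n in \<open>auto intro: close_to_linear_mono\<close>)
      then show ?thesis by (auto intro: INF_lower2)
    qed
    then have "(INF n. area_bound (1 / Suc n) T) \<le> 0" by (rule ennreal_le_epsilon)
    then show ?thesis by (rule order_trans) simp
  qed
qed

lemma open_area_bound:
  "open {T :: 'b::euclidean_space \<Rightarrow>\<^sub>L 'a::real_normed_vector. a < area_bound e T}"
  unfolding open_dist
proof clarify
  fix T :: "'b \<Rightarrow>\<^sub>L 'a" assume "a < area_bound e T"
  then obtain f S e' where S: "S \<in> sets borel" "0 < emeasure lborel S" "emeasure lborel S < \<infinity>"
    and f: "e' < e" "close_to_linear e' T f S" and a: "a < hausdorff_measure DIM('b) (f ` S) / emeasure lborel S"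
    unfolding area_bound_def less_SUP_iff by auto
  show "\<exists>r>0. \<forall>T'. dist T' T < r \<longrightarrow> T' \<in> {T. a < area_bound e T}"
  proof (intro exI[of _ "e - e'"] conjI allI impI)
    fix T' assume T': "dist T' T < e - e'"
    have "close_to_linear (e' + norm (T' - T)) T' f S" by (rule close_to_linear_perturb[OF f(2)])
    moreover have "e' + norm (T' - T) < e" using T' by (simp add: dist_norm)
    ultimately have "hausdorff_measure DIM('b) (f ` S) / emeasure lborel S \<le> area_bound e T'"
      unfolding area_bound_def by (intro SUP_upper2[of "(f, S)"]) (use S in auto)
    then show "T' \<in> {T. a < area_bound e T}" using a by (auto intro: less_le_trans)
  qed (use f in simp)
qed

lemma borel_measurable_area_bound [measurable]: "area_bound e \<in> borel_measurable borel"
  by (rule borel_measurableI_greater) (simp add: open_area_bound)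

lemma borel_measurable_area_factor [measurable]: "area_factor \<in> borel_measurable borel"
proof -
  have "(\<lambda>T. INF n. area_bound (1 / Suc n) T) \<in> borel_measurable borel" by measurable
  then show ?thesis unfolding area_factor_eq_INF[symmetric] .
qed

section \<open>Finite-dimensional normed spaces\<close>

text \<open>Equivalence of norms, by induction on the basis. In the step, the new vector a has positive
  distance d from the span of the others: otherwise a sequence in the span would converge to \<open>- a\<close>,
  its coordinates would be Cauchy by the induction hypothesis, and \<open>- a\<close> would lie in the span.\<close>
lemma coordinates_bounded:
  fixes B :: "'a::real_normed_vector set"
  assumes "finite B" "independent B"
  shows "\<exists>C>0. \<forall>u. \<forall>b\<in>B. \<bar>u b\<bar> \<le> C * norm (\<Sum>b\<in>B. u b *\<^sub>R b)"
  using assms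
proof (induction B rule: finite_induct)
  case empty
  then show ?case by (auto intro: exI[of _ 1])
next
  case (insert a B)
  have indB: "independent B" and aB: "a \<notin> span B"
    using insert by (auto simp: independent_insert)
  obtain C where C: "C > 0" "\<And>u b. b \<in> B \<Longrightarrow> \<bar>u b\<bar> \<le> C * norm (\<Sum>b\<in>B. u b *\<^sub>R b)"
    using insert.IH[OF indB] by blast
  have "\<exists>d>0. \<forall>s\<in>span B. d \<le> norm (a + s)"
  proof (rule ccontr)
    assume "\<not> ?thesis"
    then have "\<exists>s\<in>span B. norm (a + s) < 1 / Suc n" for n
      by (metis not_less zero_less_divide_1_iff of_nat_0_less_iff zero_less_Suc)
    then obtain s where s: "\<And>n. s n \<in> span B" "\<And>n. norm (a + s n) < 1 / Suc n" by metis
    have "\<exists>u. s n = (\<Sum>b\<in>B. u b *\<^sub>R b)" for n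
      using s(1)[of n] by (auto simp: span_finite[OF insert.hyps(1)])
    then obtain u where u: "\<And>n. s n = (\<Sum>b\<in>B. u n b *\<^sub>R b)" by metis
    have "(\<lambda>n. a + s n) \<longlonglongrightarrow> 0"
    proof (rule Lim_null_comparison)
      show "\<forall>\<^sub>F n in sequentially. norm (a + s n) \<le> inverse (real (Suc n))"
        using s(2) by (intro always_eventually allI) (auto simp: inverse_eq_divide intro: less_imp_le)
    qed (rule LIMSEQ_inverse_real_of_nat)
    then have s_lim: "s \<longlonglongrightarrow> - a"
      using tendsto_diff[of "\<lambda>n. a + s n" 0 sequentially "\<lambda>_. a" a] by simp
    have "Cauchy (\<lambda>n. u n b)" if b: "b \<in> B" for b
    proof (rule metric_CauchyI)
      fix e :: real assume e: "0 < e"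
      have "Cauchy s" using s_lim LIMSEQ_imp_Cauchy by blast
      then obtain M where M: "\<And>m n. m \<ge> M \<Longrightarrow> n \<ge> M \<Longrightarrow> dist (s m) (s n) < e / C"
        using e C metric_CauchyD[of s "e / C"] by (metis divide_pos_pos)
      have "dist (u m b) (u n b) < e" if "m \<ge> M" "n \<ge> M" for m n
      proof -
        have "\<bar>u m b - u n b\<bar> \<le> C * norm (\<Sum>b\<in>B. (u m b - u n b) *\<^sub>R b)"
          by (rule C(2)[OF b, of "\<lambda>b. u m b - u n b"])
        also have "(\<Sum>b\<in>B. (u m b - u n b) *\<^sub>R b) = s m - s n"
          by (simp add: u scaleR_diff_left sum_subtractf)
        also have "C * norm (s m - s n) < e"
          using M[OF that] C by (simp add: dist_norm field_simps)
        finally show ?thesis by (simp add: dist_real_def)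
      qed
      then show "\<exists>M. \<forall>m\<ge>M. \<forall>n\<ge>M. dist (u m b) (u n b) < e" by blast
    qed
    then have "\<exists>w. (\<lambda>n. u n b) \<longlonglongrightarrow> w" if "b \<in> B" for b
      using that real_Cauchy_convergent by (auto simp: convergent_def)
    then obtain w where w: "\<And>b. b \<in> B \<Longrightarrow> (\<lambda>n. u n b) \<longlonglongrightarrow> w b" by metis
    have "s \<longlonglongrightarrow> (\<Sum>b\<in>B. w b *\<^sub>R b)"
      unfolding u[abs_def] by (intro tendsto_sum tendsto_scaleR w) auto
    then have "- a = (\<Sum>b\<in>B. w b *\<^sub>R b)" using s_lim LIMSEQ_unique by blast
    moreover have "(\<Sum>b\<in>B. w b *\<^sub>R b) \<in> span B" by (intro span_sum span_scale span_base)
    ultimately have "- a \<in> span B" by simp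
    then have "- (- a) \<in> span B" by (rule span_neg)
    then show False using aB by (simp only: minus_minus)
  qed
  then obtain d where d: "d > 0" "\<And>s. s \<in> span B \<Longrightarrow> d \<le> norm (a + s)" by blast
  define C' where "C' = 1 / d + C * (1 + norm a / d)"
  have C': "1 / d \<le> C'" "C * (1 + norm a / d) \<le> C'" "C' > 0"
    using C d by (auto simp: C'_def intro!: add_pos_nonneg mult_nonneg_nonneg)
  show ?case
  proof (intro exI[of _ C'] conjI allI ballI)
    fix u b assume b: "b \<in> insert a B"
    define N where "N = norm (\<Sum>b\<in>insert a B. u b *\<^sub>R b)"
    define s where "s = (\<Sum>b\<in>B. u b *\<^sub>R b)"
    have sB: "s \<in> span B" by (auto simp: s_def intro: span_sum span_scale span_base)
    have N: "N = norm (u a *\<^sub>R a + s)" using insert.hyps by (simp add: N_def s_def)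
    have ua: "\<bar>u a\<bar> \<le> 1 / d * N"
    proof (cases "u a = 0")
      case False
      have "d \<le> norm (a + s /\<^sub>R u a)" by (intro d span_scale sB)
      then have "\<bar>u a\<bar> * d \<le> \<bar>u a\<bar> * norm (a + s /\<^sub>R u a)" by (intro mult_left_mono) auto
      also have "\<dots> = N" using False by (simp add: N scaleR_add_right flip: norm_scaleR)
      finally show ?thesis using d by (simp add: field_simps)
    qed (use d in \<open>simp add: N\<close>)
    show "\<bar>u b\<bar> \<le> C' * norm (\<Sum>b\<in>insert a B. u b *\<^sub>R b)"
    proof (cases "b = a")
      case True
      have "1 / d * N \<le> C' * N" by (intro mult_right_mono C') (simp add: N)
      then show ?thesis using ua True by (simp add: N_def)
    next
      case False
      then have "\<bar>u b\<bar> \<le> C * norm s" using C(2)[of b u] b by (simp add: s_def)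
      also have "norm s \<le> N + \<bar>u a\<bar> * norm a"
        using norm_triangle_ineq4[of "u a *\<^sub>R a + s" "u a *\<^sub>R a"] by (simp add: N)
      also have "\<dots> \<le> N + 1 / d * N * norm a" using ua by (intro add_left_mono mult_right_mono) auto
      finally have "\<bar>u b\<bar> \<le> C * (1 + norm a / d) * N" using C by (simp add: algebra_simps)
      also have "\<dots> \<le> C' * N" by (intro mult_right_mono C') (simp add: N)
      finally show ?thesis by (simp add: N_def)
    qed
  qed (rule C'(3))
qed

lemma finite_dim_coordinates:
  assumes "finite_dim TYPE('a::real_normed_vector)"
  obtains B :: "'a::real_normed_vector set" and \<phi> where "finite B" "\<And>b. b \<in> B \<Longrightarrow> bounded_linear (\<phi> b)"
    "\<And>x. x = (\<Sum>b\<in>B. \<phi> b x *\<^sub>R b)"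
proof -
  obtain S :: "'a set" where S: "finite S" "span S = UNIV" using assms unfolding finite_dim_def by blast
  obtain B where B: "B \<subseteq> S" "independent B" "S \<subseteq> span B" using maximal_independent_subset by blast
  have fB: "finite B" using B S finite_subset by blast
  have sB: "span B = UNIV" using S B by (metis span_mono span_span top.extremum_uniqueI)
  obtain C where C: "C > 0" "\<And>u b. b \<in> B \<Longrightarrow> \<bar>u b\<bar> \<le> C * norm (\<Sum>b\<in>B. u b *\<^sub>R b)"
    using coordinates_bounded[OF fB B(2)] by blast
  have rep: "(\<Sum>b\<in>B. representation B x b *\<^sub>R b) = x" for x
    using real_vector.sum_representation_eq[OF B(2) _ fB order_refl] sB by simp
  have "bounded_linear (\<lambda>x. representation B x b)" if "b \<in> B" for b
  proof (rule bounded_linear_intro[of _ C])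
    show "norm (representation B x b) \<le> norm x * C" for x
      using C(2)[OF that, of "representation B x"] by (simp add: rep mult.commute)
  qed (use B sB in \<open>auto simp: real_vector.representation_add real_vector.representation_scale\<close>)
  then show ?thesis using that[OF fB, of "\<lambda>b x. representation B x b"] rep by simp
qed

lemma finite_dim_separable:
  assumes "finite_dim TYPE('a::real_normed_vector)"
  obtains D :: "'a::real_normed_vector set" where "countable D" "\<And>x e. 0 < e \<Longrightarrow> \<exists>d\<in>D. norm (x - d) < e"
proof -
  obtain S :: "'a set" where S: "finite S" "span S = UNIV" using assms unfolding finite_dim_def by blast
  define D where "D = (\<lambda>q. \<Sum>b\<in>S. real_of_rat (q b) *\<^sub>R b) ` (S \<rightarrow>\<^sub>E UNIV)"
  define K where "K = (\<Sum>b\<in>S. norm b) + 1"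
  have K: "0 < K" by (auto simp: K_def sum_nonneg intro: add_nonneg_pos)
  have "\<exists>d\<in>D. norm (x - d) < e" if e: "0 < e" for x :: 'a and e
  proof -
    have "x \<in> span S" using S by simp
    then obtain u where u: "x = (\<Sum>b\<in>S. u b *\<^sub>R b)" by (auto simp: span_finite[OF S(1)])
    have "\<exists>q. \<bar>u b - real_of_rat q\<bar> < e / K" for b
    proof -
      obtain r where r: "r \<in> \<rat>" "u b < r" "r < u b + e / K"
        using Rats_dense_in_real[of "u b" "u b + e / K"] e K by auto
      then obtain q where "r = real_of_rat q" by (auto elim: Rats_cases)
      then show ?thesis using r by (intro exI[of _ q]) auto
    qed
    then obtain q where q: "\<And>b. \<bar>u b - real_of_rat (q b)\<bar> < e / K" by metis
    define d where "d = (\<Sum>b\<in>S. real_of_rat (restrict q S b) *\<^sub>R b)"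
    have "d \<in> D" unfolding D_def d_def by (intro imageI) auto
    moreover have "norm (x - d) < e"
    proof -
      have "x - d = (\<Sum>b\<in>S. (u b - real_of_rat (q b)) *\<^sub>R b)"
        by (simp add: u d_def scaleR_diff_left sum_subtractf)
      also have "norm \<dots> \<le> (\<Sum>b\<in>S. e / K * norm b)"
      proof (intro order_trans[OF norm_sum] sum_mono)
        fix b
        show "norm ((u b - real_of_rat (q b)) *\<^sub>R b) \<le> e / K * norm b"
          unfolding norm_scaleR real_norm_def by (intro mult_right_mono less_imp_le[OF q]) simp
      qed
      also have "\<dots> = e / K * (K - 1)" by (simp add: K_def sum_distrib_left)
      also have "\<dots> < e" using e K by (simp add: field_simps)
      finally show ?thesis .
    qed
    ultimately show ?thesis by blast
  qed
  moreover have "countable D" unfolding D_def by (intro countable_image countable_PiE) (auto simp: S)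
  ultimately show ?thesis using that by blast
qed

lemma finite_dim_blinfun:
  assumes "finite_dim TYPE('a::real_normed_vector)"
  shows "finite_dim TYPE('b::euclidean_space \<Rightarrow>\<^sub>L 'a)"
proof -
  obtain S :: "'a set" where S: "finite S" "span S = UNIV" using assms unfolding finite_dim_def by blast
  define g where "g = (\<lambda>(i::'b, b::'a). blinfun_scaleR_left b o\<^sub>L blinfun_inner_left i)"
  have "T \<in> span (g ` (Basis \<times> S))" for T :: "'b \<Rightarrow>\<^sub>L 'a"
  proof -
    have "\<exists>u. T i = (\<Sum>b\<in>S. u b *\<^sub>R b)" for i
    proof -
      have "T i \<in> span S" using S by simp
      then show ?thesis by (auto simp: span_finite[OF S(1)])
    qed
    then obtain u where u: "\<And>i. T i = (\<Sum>b\<in>S. u i b *\<^sub>R b)" by metis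
    have "T = (\<Sum>i\<in>Basis. \<Sum>b\<in>S. u i b *\<^sub>R g (i, b))"
    proof (rule blinfun_eqI)
      fix x
      have "T x = T (\<Sum>i\<in>Basis. (x \<bullet> i) *\<^sub>R i)" by (simp add: euclidean_representation)
      also have "\<dots> = (\<Sum>i\<in>Basis. (x \<bullet> i) *\<^sub>R (\<Sum>b\<in>S. u i b *\<^sub>R b))"
        by (simp add: blinfun.sum_right blinfun.scaleR_right u)
      also have "\<dots> = (\<Sum>i\<in>Basis. \<Sum>b\<in>S. u i b *\<^sub>R g (i, b)) x"
        by (simp add: blinfun.sum_left blinfun.scaleR_left g_def scaleR_sum_right mult.commute)
      finally show "T x = (\<Sum>i\<in>Basis. \<Sum>b\<in>S. u i b *\<^sub>R g (i, b)) x" .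
    qed
    also have "\<dots> \<in> span (g ` (Basis \<times> S))"
      by (intro span_sum span_scale span_base imageI) auto
    finally show ?thesis .
  qed
  then show ?thesis unfolding finite_dim_def using S by (intro exI[of _ "g ` (Basis \<times> S)"]) auto
qed

text \<open>Countably many of the balls with centre T and radius \<open>\<epsilon> T\<close> cover \<open>\<T>\<close>, for an arbitrary positive
  function \<open>\<epsilon>\<close>. For each point d of a countable dense set and each n, one centre T is selected (if
  there is any) within \<open>1 / Suc n\<close> of d and with \<open>2 / Suc n \<le> \<epsilon> T\<close>.\<close>
lemma finite_dim_Lindelof:
  fixes \<T> :: "'a::real_normed_vector set" and \<epsilon> :: "'a \<Rightarrow> real"
  assumes fd: "finite_dim TYPE('a)" and \<epsilon>: "\<And>T. T \<in> \<T> \<Longrightarrow> 0 < \<epsilon> T"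
  obtains \<D> where "countable \<D>" "\<D> \<subseteq> \<T>" "\<And>T. T \<in> \<T> \<Longrightarrow> \<exists>T'\<in>\<D>. norm (T - T') < \<epsilon> T'"
proof -
  obtain D :: "'a set" where D: "countable D" "\<And>x e. 0 < e \<Longrightarrow> \<exists>d\<in>D. norm (x - d) < e"
    using finite_dim_separable[OF fd] by blast
  define P where "P = (\<lambda>(d, n::nat) T. T \<in> \<T> \<and> norm (T - d) < 1 / Suc n \<and> 2 / Suc n \<le> \<epsilon> T)"
  define sel where "sel = (\<lambda>p. SOME T. P p T)"
  define \<D> where "\<D> = sel ` {p \<in> D \<times> UNIV. \<exists>T. P p T}"
  have selP: "P p (sel p)" if "P p T" for p T
    unfolding sel_def using that by (rule someI)
  have "countable \<D>" unfolding \<D>_def using D by (auto intro!: countable_image countable_subset[of _ "D \<times> UNIV"])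
  moreover have "\<D> \<subseteq> \<T>" using selP by (fastforce simp: \<D>_def P_def)
  moreover have "\<exists>T'\<in>\<D>. norm (T - T') < \<epsilon> T'" if T: "T \<in> \<T>" for T
  proof -
    obtain n where n: "1 / real (Suc n) < \<epsilon> T / 2" using nat_approx_posE[of "\<epsilon> T / 2"] \<epsilon>[OF T] by auto
    obtain d where d: "d \<in> D" "norm (T - d) < 1 / Suc n" using D(2)[of "1 / Suc n"] by auto
    have PT: "P (d, n) T" using T d n by (simp add: P_def)
    define T' where "T' = sel (d, n)"
    have "T' \<in> \<D>" using d PT by (auto simp: \<D>_def T'_def)
    moreover have "norm (T - T') < \<epsilon> T'"
    proof -
      have "norm (T' - d) < 1 / Suc n" "2 / Suc n \<le> \<epsilon> T'" using selP[OF PT] by (auto simp: P_def T'_def)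
      moreover have "norm (T - T') \<le> norm (T - d) + norm (T' - d)"
        using norm_triangle_ineq4[of "T - d" "T' - d"] by simp
      ultimately show ?thesis using d(2) by linarith
    qed
    ultimately show ?thesis by blast
  qed
  ultimately show ?thesis using that by blast
qed

section \<open>Rademacher's theorem\<close>

lemma emeasure_interval_measure_Ioo_continuous:
  fixes F :: "real \<Rightarrow> real"
  assumes mono: "\<And>x y. x \<le> y \<Longrightarrow> F x \<le> F y" and cont: "continuous_on UNIV F" and ab: "a \<le> b"
  shows "emeasure (interval_measure F) {a<..<b} = ennreal (F b - F a)"
proof (cases "a = b")
  case False
  have rc: "continuous (at_right x) F" for x
    using cont by (simp add: continuous_on_eq_continuous_within continuous_at_imp_continuous_at_within)
  have pt: "emeasure (interval_measure F) {b} = 0"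
    using emeasure_interval_measure_Icc[of b b F] mono cont by simp
  have "{a<..b} = {a<..<b} \<union> {b}" using ab False by auto
  then have "emeasure (interval_measure F) {a<..b} = emeasure (interval_measure F) {a<..<b} + emeasure (interval_measure F) {b}"
    by (simp add: plus_emeasure)
  moreover have "emeasure (interval_measure F) {a<..b} = ennreal (F b - F a)"
    by (rule emeasure_interval_measure_Ioc) (use ab mono rc in auto)
  ultimately show ?thesis using pt by simp
qed (use ab in simp)

text \<open>The increasing functions \<open>F1 = (L x + g x) / 2 L\<close> and \<open>F2 = (L x - g x) / 2 L\<close> add up to x.
  Hence their Stieltjes measures add up to Lebesgue measure, and that of \<open>F1\<close> has a density by the
  Radon-Nikodym theorem.\<close>
lemma lipschitz_real_density:
  fixes g :: "real \<Rightarrow> real"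
  assumes L: "0 < L" and g: "\<And>x y. \<bar>g x - g y\<bar> \<le> L * \<bar>x - y\<bar>"
  obtains h :: "real \<Rightarrow> real" where "\<And>a b. a \<le> b \<Longrightarrow> (h has_integral (g b - g a)) {a..b}"
proof -
  define F1 where "F1 = (\<lambda>x. (L * x + g x) / (2 * L))"
  define F2 where "F2 = (\<lambda>x. (L * x - g x) / (2 * L))"
  have contg: "continuous_on UNIV g"
  proof (rule lipschitz_on_continuous_on)
    show "L-lipschitz_on UNIV g" using L g by (auto intro!: lipschitz_onI simp: dist_real_def)
  qed
  have mono1: "F1 x \<le> F1 y" if "x \<le> y" for x y
    using g[of x y] that L by (auto simp: F1_def abs_le_iff algebra_simps intro!: divide_right_mono)
  have mono2: "F2 x \<le> F2 y" if "x \<le> y" for x y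
    using g[of y x] that L by (auto simp: F2_def abs_le_iff algebra_simps intro!: divide_right_mono)
  have cont: "continuous_on UNIV F1" "continuous_on UNIV F2"
    unfolding F1_def F2_def using contg L by (auto intro!: continuous_intros)
  let ?M1 = "interval_measure F1" and ?M2 = "interval_measure F2"
  define N where "N = measure_of UNIV (sets borel) (\<lambda>A. emeasure ?M1 A + emeasure ?M2 A)"
  have setsN: "sets N = sets borel"
    using sets.sigma_sets_eq[of "borel :: real measure"] by (simp add: N_def)
  have emN: "emeasure N A = emeasure ?M1 A + emeasure ?M2 A" if "A \<in> sets borel" for A
    unfolding N_def
  proof (rule emeasure_measure_of_sigma)
    show "sigma_algebra UNIV (sets (borel :: real measure))"
      using sets.sigma_algebra_axioms[of "borel :: real measure"] by simp
    show "countably_additive (sets borel) (\<lambda>A. emeasure ?M1 A + emeasure ?M2 A)"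
      unfolding countably_additive_def
      by (auto simp: suminf_add[symmetric] suminf_emeasure)
  qed (use that in \<open>auto simp: positive_def\<close>)
  have "lborel = N"
  proof (rule lborel_eqI[OF _ setsN])
    fix l u :: real assume "\<And>b. b \<in> Basis \<Longrightarrow> l \<bullet> b \<le> u \<bullet> b"
    then have lu: "l \<le> u" by simp
    have "emeasure N (box l u) = ennreal (F1 u - F1 l) + ennreal (F2 u - F2 l)"
      using emeasure_interval_measure_Ioo_continuous[of F1 l u] emeasure_interval_measure_Ioo_continuous[of F2 l u]
        mono1 mono2 cont lu by (simp add: emN box_real)
    also have "\<dots> = ennreal ((F1 u - F1 l) + (F2 u - F2 l))"
      using mono1[OF lu] mono2[OF lu] by (simp add: ennreal_plus)
    also have "(F1 u - F1 l) + (F2 u - F2 l) = u - l"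
      using L by (simp add: F1_def F2_def field_simps)
    finally show "emeasure N (box l u) = (\<Prod>b\<in>Basis. (u - l) \<bullet> b)" by simp
  qed
  then have le: "emeasure ?M1 A \<le> emeasure lborel A" if "A \<in> sets borel" for A
    using emN[OF that] by simp
  have "absolutely_continuous lborel ?M1"
    unfolding absolutely_continuous_def null_sets_def
    using le by (auto intro: order_antisym) (metis le_zero_eq)
  then obtain k where k: "k \<in> borel_measurable lborel" "density lborel k = ?M1"
    using sigma_finite_measure.Radon_Nikodym[OF sigma_finite_lborel, of ?M1] by auto
  have [measurable]: "k \<in> borel_measurable borel" using k by simp
  have int_k: "(\<integral>\<^sup>+x. k x * indicator {a..b} x \<partial>lborel) = ennreal (F1 b - F1 a)" if "a \<le> b" for a b
  proof -
    have "(\<integral>\<^sup>+x. k x * indicator {a..b} x \<partial>lborel) = emeasure ?M1 {a..b}"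
      unfolding k(2)[symmetric] by (simp add: emeasure_density)
    also have "\<dots> = ennreal (F1 b - F1 a)"
      using that mono1 cont by (intro emeasure_interval_measure_Icc) auto
    finally show ?thesis .
  qed
  have "AE x in lborel. \<forall>n::nat. k x * indicator {-real n..real n} x \<noteq> \<infinity>"
    unfolding AE_all_countable
  proof
    fix n :: nat
    show "AE x in lborel. k x * indicator {-real n..real n} x \<noteq> \<infinity>"
      by (rule nn_integral_PInf_AE) (use int_k[of "-real n" "real n"] in auto)
  qed
  then have fin: "AE x in lborel. k x \<noteq> \<infinity>"
  proof eventually_elim
    case (elim x)
    obtain n :: nat where "\<bar>x\<bar> \<le> real n" using real_arch_simple by blast
    then show ?case using elim[rule_format, of n] by (auto simp: abs_le_iff)
  qed
  define h1 where "h1 = (\<lambda>x. enn2real (k x))"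
  have h1: "(h1 has_integral (F1 b - F1 a)) {a..b}" if ab: "a \<le> b" for a b
  proof -
    have "(\<integral>\<^sup>+x. ennreal (h1 x * indicator {a..b} x) \<partial>lborel) = (\<integral>\<^sup>+x. k x * indicator {a..b} x \<partial>lborel)"
      by (rule nn_integral_cong_AE) (use fin in eventually_elim, auto simp: h1_def less_top split: split_indicator)
    also have "\<dots> = ennreal (F1 b - F1 a)" by (rule int_k[OF ab])
    finally have "((\<lambda>x. h1 x * indicator {a..b} x) has_integral (F1 b - F1 a)) UNIV"
      by (rule nn_integral_has_integral[rotated 2]) (use mono1[OF ab] in \<open>auto simp: h1_def\<close>)
    moreover have "(\<lambda>x. h1 x * indicator {a..b} x) = (\<lambda>x. if x \<in> {a..b} then h1 x else 0)"
      by (auto simp: indicator_def)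
    ultimately show ?thesis using has_integral_restrict_UNIV by metis
  qed
  show ?thesis
  proof (rule that)
    fix a b :: real assume ab: "a \<le> b"
    have "((\<lambda>x. (2 * L) * h1 x - L) has_integral ((2 * L) * (F1 b - F1 a) - (b - a) * L)) {a..b}"
      using has_integral_mult_right[OF h1[OF ab], of "2 * L"] has_integral_const_real[of L a b] ab
      by (intro has_integral_diff) auto
    also have "(2 * L) * (F1 b - F1 a) - (b - a) * L = g b - g a"
      using L by (simp add: F1_def field_simps)
    finally show "((\<lambda>x. (2 * L) * h1 x - L) has_integral (g b - g a)) {a..b}" .
  qed
qed

text \<open>Lebesgue's differentiation theorem for the density, with intervals to the right of x. For
  Rademacher's theorem one-sided limits are enough, because v and \<open>- v\<close> are treated as separate
  directions and their derivatives are related by additivity.\<close>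
lemma lipschitz_real_right_derivative_AE:
  fixes g :: "real \<Rightarrow> real"
  assumes L: "0 < L" and g: "\<And>x y. \<bar>g x - g y\<bar> \<le> L * \<bar>x - y\<bar>"
  obtains N where "negligible N" "\<And>x. x \<notin> N \<Longrightarrow> \<exists>d. ((\<lambda>t. (g (x + t) - g x) / t) \<longlongrightarrow> d) (at_right 0)"
proof -
  obtain h where h: "\<And>a b. a \<le> b \<Longrightarrow> (h has_integral (g b - g a)) {a..b}"
    using lipschitz_real_density[OF L g] by blast
  have "h integrable_on cbox a b" for a b
    using h[of a b] by (cases "a \<le> b") (auto simp: integrable_on_def)
  then obtain N where N: "negligible N"
    "\<And>x e. \<lbrakk>x \<notin> N; 0 < e\<rbrakk> \<Longrightarrow> \<exists>d>0. \<forall>t. 0 < t \<and> t < d \<longrightarrow>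
      norm (integral (cbox x (x + t *\<^sub>R One)) h /\<^sub>R t ^ DIM(real) - h x) < e"
    using integrable_ccontinuous_explicit[of h] by metis
  show ?thesis
  proof (rule that[OF N(1)])
    fix x assume x: "x \<notin> N"
    have "((\<lambda>t. (g (x + t) - g x) / t) \<longlongrightarrow> h x) (at_right 0)"
    proof (rule tendstoI)
      fix e :: real assume "0 < e"
      then obtain d where d: "d > 0" "\<And>t. 0 < t \<Longrightarrow> t < d \<Longrightarrow>
        norm (integral (cbox x (x + t *\<^sub>R One)) h /\<^sub>R t ^ DIM(real) - h x) < e"
        using N(2)[OF x] by blast
      have "dist ((g (x + t) - g x) / t) (h x) < e" if t: "0 < t" "t < d" for t
        using d(2)[OF t] h[of x "x + t"] t by (simp add: dist_real_def integral_unique divide_inverse mult.commute)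
      then show "\<forall>\<^sub>F t in at_right 0. dist ((g (x + t) - g x) / t) (h x) < e"
        using d(1) by (auto simp: eventually_at_right_field)
    qed
    then show "\<exists>d. ((\<lambda>t. (g (x + t) - g x) / t) \<longlongrightarrow> d) (at_right 0)" by blast
  qed
qed

lemma null_sets_lborel_iff_negligible:
  "A \<in> sets borel \<Longrightarrow> A \<in> null_sets lborel \<longleftrightarrow> negligible A"
  by (simp add: negligible_iff_null_sets null_sets_completion_iff)

locale lipschitz_function =
  fixes f :: "'b::euclidean_space \<Rightarrow> real" and L :: real
  assumes L: "0 < L" and f: "\<And>x y. \<bar>f x - f y\<bar> \<le> L * norm (x - y)"
begin

definition quot where "quot v t x = (f (x + t *\<^sub>R v) - f x) / t"
text \<open>The one-sided directional derivative, wherever it exists; the limit along \<open>1 / Suc n\<close> makes it a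
  measurable function.\<close>
definition dd where "dd v x = lim (\<lambda>n. quot v (1 / real (Suc n)) x)"

lemma continuous_f: "continuous_on UNIV f"
proof (rule lipschitz_on_continuous_on)
  show "L-lipschitz_on UNIV f" using L f by (auto intro!: lipschitz_onI simp: dist_real_def dist_norm)
qed

lemma continuous_f' [continuous_intros]: "continuous_on A k \<Longrightarrow> continuous_on A (\<lambda>x. f (k x))"
  by (rule continuous_on_compose2[OF continuous_f]) auto

lemma measurable_f [measurable]: "f \<in> borel_measurable borel"
  using continuous_f by (rule borel_measurable_continuous_onI)

lemma quot_bound: "0 < t \<Longrightarrow> \<bar>quot v t x\<bar> \<le> L * norm v"
  using f[of "x + t *\<^sub>R v" x] by (simp add: quot_def abs_divide field_simps)

lemma measurable_quot [measurable]: "quot v t \<in> borel_measurable borel"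
  unfolding quot_def by measurable

lemma measurable_dd [measurable]: "dd v \<in> borel_measurable borel"
  unfolding dd_def by measurable

text \<open>The points where the directional derivative exists (\<open>good_if_limit\<close>, \<open>limit_if_good\<close>), written
  as a Cauchy condition: for fixed k and n it defines a closed set, whence the set is Borel.\<close>
definition good :: "'b \<Rightarrow> 'b set" where
  "good v = (\<Inter>k. \<Union>n. {x. \<forall>s\<in>{0<..<1 / real (Suc n)}. \<forall>t\<in>{0<..<1 / real (Suc n)}.
     \<bar>quot v s x - quot v t x\<bar> \<le> 1 / real (Suc k)})"

lemma good_borel [measurable]: "good v \<in> sets borel"
proof -
  have "closed {x. \<forall>s\<in>{0<..<1 / real (Suc n)}. \<forall>t\<in>{0<..<1 / real (Suc n)}.
     \<bar>quot v s x - quot v t x\<bar> \<le> 1 / real (Suc k)}" (is "closed ?S") for n k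
  proof -
    have "?S = (\<Inter>s\<in>{0<..<1 / real (Suc n)}. \<Inter>t\<in>{0<..<1 / real (Suc n)}.
      {x. \<bar>quot v s x - quot v t x\<bar> \<le> 1 / real (Suc k)})" by auto
    also have "closed \<dots>"
      unfolding quot_def by (intro closed_INT ballI closed_Collect_le continuous_intros) auto
    finally show ?thesis .
  qed
  then show ?thesis unfolding good_def by (intro sets.countable_INT' sets.countable_UN) auto
qed

lemma good_if_limit:
  assumes "((\<lambda>t. quot v t x) \<longlongrightarrow> d) (at_right 0)"
  shows "x \<in> good v"
  unfolding good_def
proof
  fix k
  have "\<forall>\<^sub>F t in at_right 0. dist (quot v t x) d < 1 / (2 * real (Suc k))"
    by (rule tendstoD[OF assms]) simp
  then obtain b where b: "0 < b" "\<And>t. 0 < t \<Longrightarrow> t < b \<Longrightarrow> dist (quot v t x) d < 1 / (2 * real (Suc k))"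
    by (auto simp: eventually_at_right_field)
  obtain n where n: "1 / real (Suc n) < b" using nat_approx_posE[OF b(1)] by metis
  have "\<bar>quot v s x - quot v t x\<bar> \<le> 1 / real (Suc k)"
    if "s \<in> {0<..<1 / real (Suc n)}" "t \<in> {0<..<1 / real (Suc n)}" for s t
  proof -
    have "0 < s" "s < b" "0 < t" "t < b" using that n by auto
    then have "dist (quot v s x) d < 1 / (2 * real (Suc k))" "dist (quot v t x) d < 1 / (2 * real (Suc k))"
      by (blast intro: b(2))+
    then have "\<bar>quot v s x - quot v t x\<bar> \<le> 1 / (2 * real (Suc k)) + 1 / (2 * real (Suc k))"
      unfolding dist_real_def by arith
    also have "\<dots> = 1 / real (Suc k)" by (simp add: field_simps)
    finally show ?thesis .
  qed
  then show "x \<in> (\<Union>n. {x. \<forall>s\<in>{0<..<1 / real (Suc n)}. \<forall>t\<in>{0<..<1 / real (Suc n)}.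
     \<bar>quot v s x - quot v t x\<bar> \<le> 1 / real (Suc k)})" by blast
qed

lemma limit_if_good:
  assumes x: "x \<in> good v"
  shows "((\<lambda>t. quot v t x) \<longlongrightarrow> dd v x) (at_right 0)"
proof -
  have small: "\<exists>n. \<forall>s t. 0 < s \<longrightarrow> s < 1 / real (Suc n) \<longrightarrow> 0 < t \<longrightarrow> t < 1 / real (Suc n) \<longrightarrow>
    \<bar>quot v s x - quot v t x\<bar> < e" if e: "0 < e" for e
  proof -
    obtain k where k: "1 / real (Suc k) < e" using nat_approx_posE[OF e] by metis
    have "x \<in> (\<Union>n. {x. \<forall>s\<in>{0<..<1 / real (Suc n)}. \<forall>t\<in>{0<..<1 / real (Suc n)}.
     \<bar>quot v s x - quot v t x\<bar> \<le> 1 / real (Suc k)})" using x unfolding good_def by blast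
    then obtain n where "\<forall>s\<in>{0<..<1 / real (Suc n)}. \<forall>t\<in>{0<..<1 / real (Suc n)}.
     \<bar>quot v s x - quot v t x\<bar> \<le> 1 / real (Suc k)" by blast
    then have "\<bar>quot v s x - quot v t x\<bar> < e"
      if "0 < s" "s < 1 / real (Suc n)" "0 < t" "t < 1 / real (Suc n)" for s t
      using that k le_less_trans by (meson greaterThanLessThan_iff)
    then show ?thesis by blast
  qed
  have "Cauchy (\<lambda>n. quot v (1 / real (Suc n)) x)"
  proof (rule metric_CauchyI)
    fix e :: real assume "0 < e"
    then obtain n where n: "\<And>s t. 0 < s \<Longrightarrow> s < 1 / real (Suc n) \<Longrightarrow> 0 < t \<Longrightarrow> t < 1 / real (Suc n) \<Longrightarrow>
      \<bar>quot v s x - quot v t x\<bar> < e" using small by blast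
    have "dist (quot v (1 / real (Suc i)) x) (quot v (1 / real (Suc j)) x) < e" if "i \<ge> Suc n" "j \<ge> Suc n" for i j
      unfolding dist_real_def using that by (intro n) (auto simp: frac_less2)
    then show "\<exists>M. \<forall>m\<ge>M. \<forall>n\<ge>M. dist (quot v (1 / real (Suc m)) x) (quot v (1 / real (Suc n)) x) < e" by blast
  qed
  then have lim: "(\<lambda>n. quot v (1 / real (Suc n)) x) \<longlonglongrightarrow> dd v x"
    unfolding dd_def using real_Cauchy_convergent convergent_LIMSEQ_iff by blast
  show ?thesis
  proof (rule tendstoI)
    fix e :: real assume e: "0 < e"
    then obtain n where n: "\<And>s t. 0 < s \<Longrightarrow> s < 1 / real (Suc n) \<Longrightarrow> 0 < t \<Longrightarrow> t < 1 / real (Suc n) \<Longrightarrow>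
      \<bar>quot v s x - quot v t x\<bar> < e / 2" using small[of "e / 2"] by auto
    have "dist (quot v t x) (dd v x) < e" if t: "0 < t" "t < 1 / real (Suc n)" for t
    proof -
      have "\<bar>quot v t x - dd v x\<bar> \<le> e / 2"
      proof (rule LIMSEQ_le_const2)
        show "(\<lambda>i. \<bar>quot v t x - quot v (1 / real (Suc i)) x\<bar>) \<longlonglongrightarrow> \<bar>quot v t x - dd v x\<bar>"
          by (intro tendsto_intros lim)
        have "\<bar>quot v t x - quot v (1 / real (Suc i)) x\<bar> \<le> e / 2" if "i \<ge> Suc n" for i
          using that t by (intro less_imp_le n) (auto simp: frac_less2)
        then show "\<exists>N. \<forall>i\<ge>N. \<bar>quot v t x - quot v (1 / real (Suc i)) x\<bar> \<le> e / 2" by blast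
      qed
      then show ?thesis using e by (simp add: dist_real_def)
    qed
    then show "\<forall>\<^sub>F t in at_right 0. dist (quot v t x) (dd v x) < e"
      by (auto simp: eventually_at_right_field intro!: exI[of _ "1 / real (Suc n)"])
  qed
qed

text \<open>Every line in direction v meets the complement B in a null set, by the one-dimensional theorem.
  By translation invariance \<open>emeasure lborel B\<close> is the average over \<open>t \<in> {0..1}\<close> of the measures of
  B translated by \<open>t *\<^sub>R v\<close>; exchanging the integrals gives 0.\<close>
lemma good_AE: "AE x in lborel. x \<in> good v"
proof -
  define B where "B = UNIV - good v"
  have [measurable]: "B \<in> sets borel" unfolding B_def by measurable
  have slice: "(\<integral>\<^sup>+t. indicator B (x + t *\<^sub>R v) \<partial>lborel) = 0" for x
  proof -
    define g where "g = (\<lambda>t. f (x + t *\<^sub>R v))"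
    have g: "\<bar>g s - g t\<bar> \<le> (L * norm v + 1) * \<bar>s - t\<bar>" for s t
    proof -
      have "\<bar>g s - g t\<bar> \<le> L * norm ((s - t) *\<^sub>R v)"
        using f[of "x + s *\<^sub>R v" "x + t *\<^sub>R v"] by (simp add: g_def scaleR_diff_left)
      also have "\<dots> = (L * norm v) * \<bar>s - t\<bar>" by simp
      also have "\<dots> \<le> (L * norm v + 1) * \<bar>s - t\<bar>" by (intro mult_right_mono) auto
      finally show ?thesis .
    qed
    have "0 < L * norm v + 1" using L by (intro add_nonneg_pos) auto
    then obtain N where N: "negligible N"
      "\<And>s. s \<notin> N \<Longrightarrow> \<exists>d. ((\<lambda>t. (g (s + t) - g s) / t) \<longlongrightarrow> d) (at_right 0)"
      using lipschitz_real_right_derivative_AE[OF _ g] by blast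
    have sub: "{t. x + t *\<^sub>R v \<in> B} \<subseteq> N"
    proof (rule ccontr)
      assume "\<not> ?thesis"
      then obtain s where s: "x + s *\<^sub>R v \<in> B" "s \<notin> N" by blast
      obtain d where "((\<lambda>t. (g (s + t) - g s) / t) \<longlongrightarrow> d) (at_right 0)" using N(2)[OF s(2)] by blast
      then have "((\<lambda>t. quot v t (x + s *\<^sub>R v)) \<longlongrightarrow> d) (at_right 0)"
        by (simp add: quot_def g_def algebra_simps)
      then show False using s(1) good_if_limit by (auto simp: B_def)
    qed
    have meas: "{t. x + t *\<^sub>R v \<in> B} \<in> sets borel"
      using measurable_sets[of "\<lambda>t. x + t *\<^sub>R v" borel borel B] by (simp add: vimage_def)
    have "negligible {t. x + t *\<^sub>R v \<in> B}" using N(1) sub negligible_subset by blast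
    then have "emeasure lborel {t. x + t *\<^sub>R v \<in> B} = 0"
      using meas by (simp add: null_setsD1 flip: null_sets_lborel_iff_negligible)
    moreover have "(\<integral>\<^sup>+t. indicator B (x + t *\<^sub>R v) \<partial>lborel) = (\<integral>\<^sup>+t. indicator {t. x + t *\<^sub>R v \<in> B} t \<partial>lborel)"
      by (intro nn_integral_cong) (simp split: split_indicator)
    ultimately show ?thesis using meas by simp
  qed
  have "emeasure lborel B = (\<integral>\<^sup>+t. indicator {0..1::real} t * emeasure lborel B \<partial>lborel)"
    by (simp add: nn_integral_multc)
  also have "\<dots> = (\<integral>\<^sup>+t. (\<integral>\<^sup>+x. indicator {0..1} t * indicator B (x + t *\<^sub>R v) \<partial>lborel) \<partial>lborel)"
  proof (rule nn_integral_cong)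
    fix t :: real
    have "emeasure lborel B = (\<integral>\<^sup>+x. indicator B x \<partial>distr lborel borel ((+) (t *\<^sub>R v)))"
      by (simp add: lborel_distr_plus)
    also have "\<dots> = (\<integral>\<^sup>+x. indicator B (t *\<^sub>R v + x) \<partial>lborel)" by (rule nn_integral_distr) auto
    finally show "indicator {0..1} t * emeasure lborel B = (\<integral>\<^sup>+x. indicator {0..1} t * indicator B (x + t *\<^sub>R v) \<partial>lborel)"
      by (simp add: nn_integral_cmult add.commute)
  qed
  also have "\<dots> = (\<integral>\<^sup>+x. (\<integral>\<^sup>+t. indicator {0..1} t * indicator B (x + t *\<^sub>R v) \<partial>lborel) \<partial>lborel)"
    by (rule lborel_pair.Fubini'[symmetric]) measurable
  also have "\<dots> \<le> (\<integral>\<^sup>+x. (\<integral>\<^sup>+t. indicator B (x + t *\<^sub>R v) \<partial>lborel) \<partial>(lborel :: 'b measure))"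
    by (intro nn_integral_mono) (auto split: split_indicator)
  also have "\<dots> = 0" by (simp add: slice)
  finally have "emeasure lborel B = 0" by simp
  then have "B \<in> null_sets lborel" by (simp add: null_sets_def)
  from AE_not_in[OF this] show ?thesis by (simp add: B_def)
qed

lemma dd_seq: "x \<in> good v \<Longrightarrow> (\<lambda>n. quot v (1 / real (Suc n)) x) \<longlonglongrightarrow> dd v x"
proof -
  assume x: "x \<in> good v"
  have "filterlim (\<lambda>n. 1 / real (Suc n)) (at_right 0) sequentially"
    unfolding filterlim_at using LIMSEQ_inverse_real_of_nat by (auto simp: inverse_eq_divide)
  then show ?thesis using filterlim_compose[OF limit_if_good[OF x]] by blast
qed

text \<open>The integral of the difference h over every box vanishes. Namely,
  \<open>f (x + t (u + v)) - f x\<close> is the sum of the increment \<open>f (x + t u) - f x\<close> and the v-increment at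
  \<open>x + t u\<close>. Moving the translation by \<open>t u\<close> from the integrand to the box, the integral of
  \<open>G n\<close> is 0 for \<open>t = 1 / Suc n\<close>, and \<open>G n\<close> tends to \<open>I * h\<close> off the boundary of the box with a
  bounded majorant.\<close>
lemma dd_add_AE: "AE x in lborel. dd (u + v) x = dd u x + dd v x"
proof -
  define h where "h = (\<lambda>x. if x \<in> good u \<inter> good v \<inter> good (u + v) then dd (u + v) x - dd u x - dd v x else 0)"
  have [measurable]: "h \<in> borel_measurable borel" unfolding h_def by measurable
  have AEg: "AE x in lborel. x \<in> good u \<inter> good v \<inter> good (u + v)"
    using good_AE[of u] good_AE[of v] good_AE[of "u + v"] by eventually_elim auto
  have int0: "(h has_integral 0) (cbox a b)" for a b
  proof -
    obtain R where R: "0 < R" "cbox a b \<subseteq> cball 0 R" using bounded_subset_ballD[OF bounded_cbox, of a b 0]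
      using ball_subset_cball by (metis (no_types) order_trans)
    define C where "C = L * (norm u + norm v + norm (u + v)) + 1"
    have C0: "0 \<le> L * norm u" "0 \<le> L * norm v" "0 \<le> L * norm (u + v)" using L by auto
    define t where "t = (\<lambda>n. 1 / real (Suc n))"
    have t: "0 < t n" "t n \<le> 1" for n by (auto simp: t_def)
    have t0: "t \<longlonglongrightarrow> 0" using LIMSEQ_inverse_real_of_nat by (simp add: t_def inverse_eq_divide)
    define I where "I = (\<lambda>x. indicator (cbox a b) x :: real)"
    have [measurable]: "I \<in> borel_measurable borel" unfolding I_def by measurable
    \<comment> \<open>In the last term the indicator, not the quotient, is translated.\<close>
    define G where "G = (\<lambda>n x. I x * quot (u + v) (t n) x - I x * quot u (t n) x - I (x - t n *\<^sub>R u) * quot v (t n) x)"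
    have intW: "integrable lborel (\<lambda>x::'b. indicator (cball 0 (R + norm u)) x * C :: real)"
      using emeasure_lborel_cball_finite[of "0::'b" "R + norm u"] by (intro integrable_mult_left integrable_real_indicator) auto
    have I_le: "\<bar>I x * c\<bar> \<le> indicator (cball 0 (R + norm u)) x * \<bar>c\<bar>" for x c
    proof (cases "x \<in> cbox a b")
      case True
      then have "norm x \<le> R" using R(2) by auto
      then have "x \<in> cball 0 (R + norm u)" by (simp add: add_increasing2)
      with True show ?thesis by (simp add: I_def)
    qed (simp add: I_def)
    have I_le2: "\<bar>I (x - t n *\<^sub>R u) * c\<bar> \<le> indicator (cball 0 (R + norm u)) x * \<bar>c\<bar>" for x c n
    proof (cases "x - t n *\<^sub>R u \<in> cbox a b")
      case True
      then have "norm (x - t n *\<^sub>R u) \<le> R" using R(2) by auto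
      moreover have "norm x \<le> norm (x - t n *\<^sub>R u) + norm (t n *\<^sub>R u)"
        using norm_triangle_ineq[of "x - t n *\<^sub>R u" "t n *\<^sub>R u"] by simp
      moreover have "norm (t n *\<^sub>R u) \<le> norm u" using t[of n] by (simp add: mult_left_le_one_le)
      ultimately have "x \<in> cball 0 (R + norm u)" by simp
      with True show ?thesis by (simp add: I_def)
    qed (simp add: I_def)
    have dom: "norm (G n x) \<le> indicator (cball 0 (R + norm u)) x * C" for n x
    proof -
      have "norm (G n x) \<le> \<bar>I x * quot (u + v) (t n) x\<bar> + \<bar>I x * quot u (t n) x\<bar> + \<bar>I (x - t n *\<^sub>R u) * quot v (t n) x\<bar>"
        unfolding G_def real_norm_def by linarith
      also have "\<dots> \<le> indicator (cball 0 (R + norm u)) x * (\<bar>quot (u + v) (t n) x\<bar> + \<bar>quot u (t n) x\<bar> + \<bar>quot v (t n) x\<bar>)"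
        using I_le[of x] I_le2[of x n] by (simp add: distrib_left add_mono)
      also have "\<dots> \<le> indicator (cball 0 (R + norm u)) x * C"
        using quot_bound[OF t(1), of u n x] quot_bound[OF t(1), of v n x] quot_bound[OF t(1), of "u + v" n x]
        by (intro mult_left_mono) (auto simp: C_def distrib_left)
      finally show ?thesis .
    qed
    have intpiece: "integrable lborel (\<lambda>x. k x * quot w (t n) x)"
      if [measurable]: "k \<in> borel_measurable borel" and k: "\<And>x c. \<bar>k x * c\<bar> \<le> indicator (cball 0 (R + norm u)) x * \<bar>c\<bar>"
        and w: "L * norm w \<le> C" for k w n
    proof (rule Bochner_Integration.integrable_bound[OF intW])
      show "AE x in lborel. norm (k x * quot w (t n) x) \<le> norm (indicator (cball 0 (R + norm u)) x * C)"
      proof (rule AE_I2)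
        fix x
        have "\<bar>quot w (t n) x\<bar> \<le> \<bar>C\<bar>" using quot_bound[OF t(1), of w n x] w by linarith
        then have "indicator (cball 0 (R + norm u)) x * \<bar>quot w (t n) x\<bar> \<le> indicator (cball 0 (R + norm u)) x * \<bar>C\<bar>"
          by (intro mult_left_mono) auto
        then show "norm (k x * quot w (t n) x) \<le> norm (indicator (cball 0 (R + norm u)) x * C)"
          using k[of x "quot w (t n) x"] by (simp add: abs_mult)
      qed
    qed measurable
    have w: "L * norm u \<le> C" "L * norm v \<le> C" "L * norm (u + v) \<le> C"
      using C0 by (auto simp: C_def distrib_left)
    have intG: "integral\<^sup>L lborel (G n) = 0" for n
    proof -
      have i1: "integrable lborel (\<lambda>x. I x * quot (u + v) (t n) x)" by (rule intpiece) (use I_le w in auto)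
      have i2: "integrable lborel (\<lambda>x. I x * quot u (t n) x)" by (rule intpiece) (use I_le w in auto)
      have i3: "integrable lborel (\<lambda>x. I (x - t n *\<^sub>R u) * quot v (t n) x)" by (rule intpiece) (use I_le2 w in auto)
      have "(\<integral>x. I (x - t n *\<^sub>R u) * quot v (t n) x \<partial>lborel) =
        (\<integral>x. I (x - t n *\<^sub>R u) * quot v (t n) x \<partial>distr lborel borel ((+) (t n *\<^sub>R u)))"
        by (simp add: lborel_distr_plus)
      also have "\<dots> = (\<integral>x. I x * quot v (t n) (t n *\<^sub>R u + x) \<partial>lborel)"
        by (subst integral_distr) auto
      also have "(\<lambda>x. I x * quot v (t n) (t n *\<^sub>R u + x)) = (\<lambda>x. I x * quot (u + v) (t n) x - I x * quot u (t n) x)"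
        by (auto simp: fun_eq_iff quot_def scaleR_add_right add_ac diff_divide_distrib algebra_simps)
      also have "integral\<^sup>L lborel \<dots> = (\<integral>x. I x * quot (u + v) (t n) x \<partial>lborel) - (\<integral>x. I x * quot u (t n) x \<partial>lborel)"
        using i1 i2 by (rule Bochner_Integration.integral_diff)
      finally show ?thesis unfolding G_def using i1 i2 i3 by simp
    qed
    have fr: "AE x in lborel. x \<notin> frontier (cbox a b)"
    proof -
      have "negligible (frontier (cbox a b))" by (simp add: negligible_convex_frontier)
      then have "frontier (cbox a b) \<in> null_sets lborel"
        by (simp add: null_sets_lborel_iff_negligible borel_closed)
      then show ?thesis by (rule AE_not_in)
    qed
    have conv: "AE x in lborel. (\<lambda>n. G n x) \<longlonglongrightarrow> I x * h x"
      using fr AEg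
    proof eventually_elim
      case (elim x)
      have "(\<lambda>n. I (x - t n *\<^sub>R u)) \<longlonglongrightarrow> I x"
      proof -
        have "isCont I x"
          unfolding I_def using elim(1) by (simp add: isCont_indicator)
        moreover have "(\<lambda>n. x - t n *\<^sub>R u) \<longlonglongrightarrow> x - 0 *\<^sub>R u" by (intro tendsto_intros t0)
        ultimately show ?thesis using isCont_tendsto_compose by fastforce
      qed
      moreover have "(\<lambda>n. quot w (t n) x) \<longlonglongrightarrow> dd w x" if "x \<in> good w" for w
        unfolding t_def by (rule dd_seq[OF that])
      ultimately have "(\<lambda>n. G n x) \<longlonglongrightarrow> I x * dd (u + v) x - I x * dd u x - I x * dd v x"
        unfolding G_def using elim by (intro tendsto_intros) auto
      then show ?case using elim by (simp add: h_def algebra_simps)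
    qed
    have "(\<lambda>n. integral\<^sup>L lborel (G n)) \<longlonglongrightarrow> (\<integral>x. I x * h x \<partial>lborel)" "integrable lborel (\<lambda>x. I x * h x)"
      using conv dom by (auto intro!: integral_dominated_convergence[OF _ _ intW] integrable_dominated_convergence[OF _ _ intW] simp: G_def)
    then have "(\<integral>x. I x * h x \<partial>lborel) = 0" "integrable lborel (\<lambda>x. I x * h x)"
      using LIMSEQ_unique[of "\<lambda>n. 0"] by (auto simp: intG)
    then have "((\<lambda>x. I x * h x) has_integral 0) UNIV"
      using has_integral_integral_lborel by metis
    moreover have "(\<lambda>x. I x * h x) = (\<lambda>x. if x \<in> cbox a b then h x else 0)"
      by (auto simp: I_def)
    ultimately show ?thesis using has_integral_restrict_UNIV by metis
  qed
  obtain N where N: "negligible N" "\<And>x e. \<lbrakk>x \<notin> N; 0 < e\<rbrakk> \<Longrightarrow> \<exists>d>0. \<forall>t. 0 < t \<and> t < d \<longrightarrow>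
      norm (integral (cbox x (x + t *\<^sub>R One)) h /\<^sub>R t ^ DIM('b) - h x) < e"
    using integrable_ccontinuous_explicit[of h] int0 by (metis integrable_on_def)
  have "h x = 0" if x: "x \<notin> N" for x
  proof (rule ccontr)
    assume "h x \<noteq> 0"
    then obtain d where d: "d > 0" "\<And>t. 0 < t \<Longrightarrow> t < d \<Longrightarrow>
      norm (integral (cbox x (x + t *\<^sub>R One)) h /\<^sub>R t ^ DIM('b) - h x) < \<bar>h x\<bar>"
      using N(2)[OF x, of "\<bar>h x\<bar>"] by auto
    from d(2)[of "d / 2"] d(1) show False by (simp add: integral_unique[OF int0])
  qed
  then have sub: "{x. h x \<noteq> 0} \<subseteq> N" by blast
  have "{x. h x \<noteq> 0} \<in> sets borel" by measurable
  moreover have "negligible {x. h x \<noteq> 0}" using N(1) sub negligible_subset by blast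
  ultimately have "{x. h x \<noteq> 0} \<in> null_sets lborel" by (simp add: null_sets_lborel_iff_negligible)
  from AE_not_in[OF this] AEg show ?thesis
    by eventually_elim (auto simp: h_def)
qed

end

context lipschitz_function begin

lemma dd_scale_pos:
  assumes "x \<in> good v" and r: "0 \<le> r"
  shows "dd (r *\<^sub>R v) x = r * dd v x" "x \<in> good (r *\<^sub>R v)"
proof -
  have "((\<lambda>t. quot (r *\<^sub>R v) t x) \<longlongrightarrow> r * dd v x) (at_right 0)"
  proof (cases "r = 0")
    case False
    then have r: "0 < r" using r by simp
    have "filterlim (\<lambda>t. r * t) (at_right 0) (at_right 0)"
    proof (subst filterlim_at, intro conjI)
      have "((\<lambda>t. r * t) \<longlongrightarrow> r * 0) (at_right 0)" by (intro tendsto_intros)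
      then show "filterlim (\<lambda>t. r * t) (nhds 0) (at_right 0)" by simp
      show "\<forall>\<^sub>F t in at_right 0. r * t \<in> {0<..} \<and> r * t \<noteq> 0"
        using r by (auto simp: eventually_at_right_field intro: exI[of _ 1])
    qed
    from tendsto_mult_left[OF filterlim_compose[OF limit_if_good[OF assms(1)] this], of r]
    have "((\<lambda>t. r * quot v (r * t) x) \<longlongrightarrow> r * dd v x) (at_right 0)" .
    moreover have "(\<lambda>t. r * quot v (r * t) x) = (\<lambda>t. quot (r *\<^sub>R v) t x)"
      using r by (auto simp: quot_def fun_eq_iff mult.commute)
    ultimately show ?thesis by simp
  qed (simp add: quot_def)
  then show g: "x \<in> good (r *\<^sub>R v)" by (rule good_if_limit)
  show "dd (r *\<^sub>R v) x = r * dd v x"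
    using tendsto_unique[OF _ limit_if_good[OF g]] \<open>((\<lambda>t. quot (r *\<^sub>R v) t x) \<longlongrightarrow> r * dd v x) (at_right 0)\<close>
    by (metis trivial_limit_at_right_real)
qed

lemma dd_scale_AE: "AE x in lborel. dd (r *\<^sub>R v) x = r * dd v x"
proof (cases "0 \<le> r")
  case True
  show ?thesis using good_AE[of v] by eventually_elim (simp add: dd_scale_pos True)
next
  case False
  show ?thesis using good_AE[of v] good_AE[of "-v"] dd_add_AE[of "r *\<^sub>R v" "(-r) *\<^sub>R v"]
  proof eventually_elim
    case (elim x)
    have "dd 0 x = 0" using dd_scale_pos(1)[OF elim(1), of 0] by simp
    moreover have "dd ((-r) *\<^sub>R v) x = - r * dd v x" using False by (intro dd_scale_pos(1) elim) auto
    ultimately show ?case using elim(3) by (simp add: algebra_simps)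
  qed
qed

lemma dd_linear_AE: "AE x in lborel. dd v x = (\<Sum>i\<in>Basis. (v \<bullet> i) * dd i x)"
proof -
  have "AE x in lborel. dd (\<Sum>i\<in>I. (v \<bullet> i) *\<^sub>R i) x = (\<Sum>i\<in>I. (v \<bullet> i) * dd i x)" if "finite I" for I :: "'b set"
    using that
  proof (induction I rule: finite_induct)
    case empty
    show ?case using good_AE[of 0] by eventually_elim (use dd_scale_pos(1)[of _ 0 0] in simp)
  next
    case (insert i I)
    show ?case
      using insert.IH dd_scale_AE[of "v \<bullet> i" i] dd_add_AE[of "(v \<bullet> i) *\<^sub>R i" "\<Sum>i\<in>I. (v \<bullet> i) *\<^sub>R i"]
      by eventually_elim (simp add: insert.hyps)
  qed
  from this[of Basis] show ?thesis by (simp add: euclidean_representation)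
qed

text \<open>Almost everywhere, the directional derivatives exist and are linear along a countable dense set
  of directions. By compactness of the sphere, finitely many of these directions approximate all
  others up to r, and the Lipschitz condition transfers the estimate.\<close>
theorem differentiable_AE: "AE x in lborel. \<exists>f'. (f has_derivative f') (at x)"
proof -
  obtain D :: "'b set" where D: "countable D" "\<And>X. open X \<Longrightarrow> X \<noteq> {} \<Longrightarrow> \<exists>d\<in>D. d \<in> X"
    using countable_dense_exists by blast
  have "AE x in lborel. \<forall>v\<in>D. x \<in> good v \<and> dd v x = (\<Sum>i\<in>Basis. (v \<bullet> i) * dd i x)"
    unfolding AE_ball_countable[OF D(1)] using good_AE dd_linear_AE by (auto intro: AE_conjI)
  then show ?thesis
  proof eventually_elim
    case (elim x)
    define T where "T = (\<lambda>h. \<Sum>i\<in>Basis. (h \<bullet> i) * dd i x)"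
    have blT: "bounded_linear T" unfolding T_def
      by (intro bounded_linear_sum bounded_linear_mult_const bounded_linear_inner_left)
    then obtain K where K: "0 < K" "\<And>h. \<bar>T h\<bar> \<le> norm h * K"
      using bounded_linear.pos_bounded[OF blT] by auto
    interpret T: bounded_linear T by (rule blT)
    have "(f has_derivative T) (at x)"
      unfolding has_derivative_at_alt
    proof (intro conjI allI impI blT)
      fix e :: real assume e: "0 < e"
      \<comment> \<open>The three error terms below are \<open>L * r\<close>, r and \<open>r * K\<close>
        times the distance.\<close>
      define r where "r = e / (L + 1 + K)"
      have r: "0 < r" "r * (L + 1 + K) = e" using e L K by (auto simp: r_def)
      have "sphere 0 1 \<subseteq> (\<Union>v\<in>D. ball v r)"
      proof
        fix w :: 'b
        obtain v where "v \<in> D" "v \<in> ball w r" using D(2)[of "ball w r"] r by auto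
        then show "w \<in> (\<Union>v\<in>D. ball v r)" by (auto simp: dist_commute)
      qed
      then obtain F where F: "F \<subseteq> D" "finite F" "sphere 0 1 \<subseteq> (\<Union>v\<in>F. ball v r)"
        using compactE_image[OF compact_sphere, of D "\<lambda>v. ball v r" 0 1] by auto
      have "\<forall>v\<in>F. \<forall>\<^sub>F t in at_right 0. dist (quot v t x) (T v) < r"
      proof
        fix v assume "v \<in> F"
        then have "v \<in> D" using F by auto
        then have "((\<lambda>t. quot v t x) \<longlongrightarrow> T v) (at_right 0)"
          using elim limit_if_good[of x v] by (simp add: T_def)
        then show "\<forall>\<^sub>F t in at_right 0. dist (quot v t x) (T v) < r" using r by (intro tendstoD)
      qed
      then have "\<forall>\<^sub>F t in at_right 0. \<forall>v\<in>F. dist (quot v t x) (T v) < r"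
        using F(2) by (simp add: eventually_ball_finite)
      then obtain d where d: "0 < d" "\<And>t v. 0 < t \<Longrightarrow> t < d \<Longrightarrow> v \<in> F \<Longrightarrow> dist (quot v t x) (T v) < r"
        by (auto simp: eventually_at_right_field)
      show "\<exists>d>0. \<forall>y. norm (y - x) < d \<longrightarrow> norm (f y - f x - T (y - x)) \<le> e * norm (y - x)"
      proof (intro exI[of _ d] conjI allI impI d(1))
        fix y assume y: "norm (y - x) < d"
        show "norm (f y - f x - T (y - x)) \<le> e * norm (y - x)"
        proof (cases "y = x")
          case False
          define s where "s = norm (y - x)"
          define w where "w = (y - x) /\<^sub>R s"
          have s: "0 < s" "s < d" using False y by (auto simp: s_def)
          have w: "norm w = 1" "y = x + s *\<^sub>R w" using s False by (auto simp: w_def s_def)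
          then obtain v where v: "v \<in> F" "norm (w - v) < r"
            using F(3) by (force simp: dist_norm norm_minus_commute)
          have 1: "\<bar>f (x + s *\<^sub>R w) - f (x + s *\<^sub>R v)\<bar> \<le> L * (s * r)"
          proof -
            have "\<bar>f (x + s *\<^sub>R w) - f (x + s *\<^sub>R v)\<bar> \<le> L * norm (s *\<^sub>R (w - v))"
              using f[of "x + s *\<^sub>R w" "x + s *\<^sub>R v"] by (simp add: scaleR_diff_right)
            also have "\<dots> \<le> L * (s * r)" using L s v by (intro mult_left_mono) auto
            finally show ?thesis .
          qed
          have 2: "\<bar>f (x + s *\<^sub>R v) - f x - s * T v\<bar> \<le> s * r"
          proof -
            have "f (x + s *\<^sub>R v) - f x - s * T v = s * (quot v s x - T v)"
              using s by (simp add: quot_def field_simps)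
            then show ?thesis using d(2)[OF s v(1)] s by (simp add: dist_real_def abs_mult)
          qed
          have 3: "\<bar>s * T v - s * T w\<bar> \<le> s * (r * K)"
          proof -
            have "\<bar>T v - T w\<bar> \<le> norm (w - v) * K"
              using K(2)[of "w - v"] by (simp add: T.diff abs_minus_commute)
            also have "\<dots> \<le> r * K" using v K by (intro mult_right_mono) auto
            finally have "s * \<bar>T v - T w\<bar> \<le> s * (r * K)" using s by (intro mult_left_mono) auto
            then show ?thesis using s by (simp add: right_diff_distrib[symmetric] abs_mult)
          qed
          have "T (y - x) = s * T w" by (simp add: w(2) T.scaleR)
          then have "norm (f y - f x - T (y - x)) \<le> L * (s * r) + s * r + s * (r * K)"
            using 1 2 3 unfolding w(2) real_norm_def by linarith
          also have "\<dots> = (r * (L + 1 + K)) * s" by (simp add: algebra_simps)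
          also have "\<dots> = e * norm (y - x)" by (simp add: r(2) s_def)
          finally show ?thesis .
        qed (simp add: T.zero)
      qed
    qed
    then show ?case by blast
  qed
qed

end

text \<open>McShane's extension \<open>x \<mapsto> INF y\<in>S. f y + L * dist x y\<close>.\<close>
lemma lipschitz_extension_real:
  fixes f :: "'b::metric_space \<Rightarrow> real"
  assumes f: "L-lipschitz_on S f"
  obtains g where "\<And>x. x \<in> S \<Longrightarrow> g x = f x" "L-lipschitz_on UNIV g"
proof (cases "S = {}")
  case True
  then show ?thesis
    by (intro that[of "\<lambda>_. 0"]) (auto intro!: lipschitz_onI simp: lipschitz_on_nonneg[OF f])
next
  case False
  have L: "0 \<le> L" by (rule lipschitz_on_nonneg[OF f])
  obtain y0 where y0: "y0 \<in> S" using False by blast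
  have low: "f y0 - L * dist x y0 \<le> f y + L * dist x y" if "y \<in> S" for x y
  proof -
    have "f y0 - f y \<le> L * dist y0 y"
      using lipschitz_onD[OF f y0 that] by (simp add: dist_real_def)
    also have "\<dots> \<le> L * (dist x y0 + dist x y)"
      using L by (intro mult_left_mono) (metis dist_commute dist_triangle2 add.commute)
    finally show ?thesis by (simp add: algebra_simps)
  qed
  define g where "g = (\<lambda>x. INF y\<in>S. f y + L * dist x y)"
  have bdd: "bdd_below ((\<lambda>y. f y + L * dist x y) ` S)" for x
    using low[of _ x] by (intro bdd_belowI2[where m="f y0 - L * dist x y0"])
  have le: "g x \<le> g x' + L * dist x x'" for x x'
  proof -
    have "g x - L * dist x x' \<le> (INF y\<in>S. f y + L * dist x' y)"
    proof (rule cINF_greatest[OF False])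
      fix y assume y: "y \<in> S"
      have "g x \<le> f y + L * dist x y" unfolding g_def by (rule cINF_lower[OF bdd y])
      also have "\<dots> \<le> f y + L * (dist x x' + dist x' y)"
        using L by (intro add_left_mono mult_left_mono dist_triangle)
      finally show "g x - L * dist x x' \<le> f y + L * dist x' y" by (simp add: algebra_simps)
    qed
    then show ?thesis by (simp add: g_def)
  qed
  show ?thesis
  proof (rule that)
    fix x assume x: "x \<in> S"
    show "g x = f x"
    proof (rule antisym)
      show "g x \<le> f x" unfolding g_def using cINF_lower[OF bdd x, of x] by simp
      show "f x \<le> g x" unfolding g_def
      proof (rule cINF_greatest[OF False])
        fix y assume "y \<in> S"
        then show "f x \<le> f y + L * dist x y"
          using lipschitz_onD[OF f x] by (fastforce simp: dist_real_def)
      qed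
    qed
  next
    show "L-lipschitz_on UNIV g"
    proof (rule lipschitz_onI[OF _ L])
      fix x y
      show "dist (g x) (g y) \<le> L * dist x y"
        using le[of x y] le[of y x] by (auto simp: dist_real_def abs_le_iff dist_commute)
    qed
  qed
qed

section \<open>Decomposition of rectifiable sets into almost linear pieces\<close>

lemma lipschitz_extension:
  fixes f :: "'b::metric_space \<Rightarrow> 'a::real_normed_vector"
  assumes fd: "finite_dim TYPE('a)" and f: "L-lipschitz_on S f"
  obtains g L' where "\<And>x. x \<in> S \<Longrightarrow> g x = f x" "L'-lipschitz_on UNIV g"
proof -
  obtain B :: "'a set" and \<phi> where B: "finite B" "\<And>b. b \<in> B \<Longrightarrow> bounded_linear (\<phi> b)"
    "\<And>x. x = (\<Sum>b\<in>B. \<phi> b x *\<^sub>R b)" using finite_dim_coordinates[OF fd] by metis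
  have "\<exists>h M. (\<forall>x\<in>S. h x = \<phi> b (f x)) \<and> M-lipschitz_on UNIV h" if b: "b \<in> B" for b
  proof -
    interpret bounded_linear "\<phi> b" by (rule B(2)[OF b])
    obtain K where K: "K > 0" "\<And>x. norm (\<phi> b x) \<le> norm x * K" using pos_bounded by blast
    have "(K * L)-lipschitz_on S (\<lambda>x. \<phi> b (f x))"
    proof (rule lipschitz_onI)
      fix x y assume xy: "x \<in> S" "y \<in> S"
      have "dist (\<phi> b (f x)) (\<phi> b (f y)) \<le> K * dist (f x) (f y)"
        using K(2)[of "f x - f y"] by (simp add: dist_norm diff mult.commute)
      also have "\<dots> \<le> K * (L * dist x y)"
        using K by (intro mult_left_mono lipschitz_onD[OF f] xy) auto
      finally show "dist (\<phi> b (f x)) (\<phi> b (f y)) \<le> K * L * dist x y" by (simp add: mult.assoc)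
    qed (use K lipschitz_on_nonneg[OF f] in simp)
    then show ?thesis using lipschitz_extension_real by metis
  qed
  then obtain h M where h: "\<And>b x. b \<in> B \<Longrightarrow> x \<in> S \<Longrightarrow> h b x = \<phi> b (f x)"
    "\<And>b. b \<in> B \<Longrightarrow> (M b)-lipschitz_on UNIV (h b)" by metis
  define g where "g = (\<lambda>x. \<Sum>b\<in>B. h b x *\<^sub>R b)"
  show ?thesis
  proof (rule that)
    show "g x = f x" if "x \<in> S" for x
      using B(3)[of "f x"] h(1) that by (simp add: g_def)
    show "(\<Sum>b\<in>B. M b * norm b)-lipschitz_on UNIV g"
    proof (rule lipschitz_onI)
      fix x y
      have "dist (g x) (g y) = norm (\<Sum>b\<in>B. (h b x - h b y) *\<^sub>R b)"
        by (simp add: g_def dist_norm scaleR_diff_left sum_subtractf)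
      also have "\<dots> \<le> (\<Sum>b\<in>B. (M b * dist x y) * norm b)"
        by (intro order_trans[OF norm_sum] sum_mono)
          (use lipschitz_onD[OF h(2)] in \<open>auto simp: dist_real_def intro!: mult_right_mono\<close>)
      finally show "dist (g x) (g y) \<le> (\<Sum>b\<in>B. M b * norm b) * dist x y"
        unfolding sum_distrib_right by (simp add: mult_ac)
    qed (intro sum_nonneg mult_nonneg_nonneg norm_ge_zero lipschitz_on_nonneg[OF h(2)])
  qed
qed

lemma rademacher:
  fixes f :: "'b::euclidean_space \<Rightarrow> 'a::real_normed_vector"
  assumes fd: "finite_dim TYPE('a)" and f: "L-lipschitz_on UNIV f"
  shows "AE x in lborel. \<exists>T :: 'b \<Rightarrow>\<^sub>L 'a. (f has_derivative blinfun_apply T) (at x)"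
proof -
  obtain B :: "'a set" and \<phi> where B: "finite B" "\<And>b. b \<in> B \<Longrightarrow> bounded_linear (\<phi> b)"
    "\<And>x. x = (\<Sum>b\<in>B. \<phi> b x *\<^sub>R b)" using finite_dim_coordinates[OF fd] by metis
  have "AE x in lborel. \<exists>f'. ((\<lambda>x. \<phi> b (f x)) has_derivative f') (at x)" if b: "b \<in> B" for b
  proof -
    interpret bounded_linear "\<phi> b" by (rule B(2)[OF b])
    obtain K where K: "K > 0" "\<And>x. norm (\<phi> b x) \<le> norm x * K" using pos_bounded by blast
    have L: "0 \<le> L" by (rule lipschitz_on_nonneg[OF f])
    interpret lipschitz_function "\<lambda>x. \<phi> b (f x)" "K * L + 1"
    proof
      show "0 < K * L + 1" using K L by (intro add_nonneg_pos) auto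
      fix x y
      have "\<bar>\<phi> b (f x) - \<phi> b (f y)\<bar> \<le> K * dist (f x) (f y)"
        using K(2)[of "f x - f y"] by (simp add: dist_norm diff mult.commute)
      also have "\<dots> \<le> K * (L * dist x y)"
        using K by (intro mult_left_mono lipschitz_onD[OF f]) auto
      finally show "\<bar>\<phi> b (f x) - \<phi> b (f y)\<bar> \<le> (K * L + 1) * norm (x - y)"
        by (simp add: dist_norm distrib_right mult.assoc add_increasing2)
    qed
    show ?thesis by (rule differentiable_AE)
  qed
  then have "AE x in lborel. \<forall>b\<in>B. \<exists>f'. ((\<lambda>x. \<phi> b (f x)) has_derivative f') (at x)"
    by (simp add: AE_ball_countable[OF countable_finite[OF B(1)]])
  then show ?thesis
  proof eventually_elim
    case (elim x)
    then obtain f' where f': "\<And>b. b \<in> B \<Longrightarrow> ((\<lambda>x. \<phi> b (f x)) has_derivative f' b) (at x)" by metis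
    define T where "T = (\<lambda>h. \<Sum>b\<in>B. f' b h *\<^sub>R b)"
    have "((\<lambda>x. \<Sum>b\<in>B. \<phi> b (f x) *\<^sub>R b) has_derivative T) (at x)"
      unfolding T_def by (intro has_derivative_sum has_derivative_scaleR_left f')
    then have d: "(f has_derivative T) (at x)" using B(3) by simp
    then have "bounded_linear T" by (rule has_derivative_bounded_linear)
    then have "blinfun_apply (Blinfun T) = T" by (rule bounded_linear_Blinfun_apply)
    then show ?case using d by metis
  qed
qed

text \<open>Where the derivative T of f at x is within \<open>\<epsilon> T' / 2\<close> of \<open>T'\<close>, the map f is \<open>\<epsilon> T'\<close>-close to \<open>T'\<close>
  as seen from x up to some distance \<open>1 / Suc k\<close>. For fixed \<open>T'\<close> and k such points form a closed set,
  and on its intersection with a ball of radius a quarter of this distance f is close to \<open>T'\<close>.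
  Countably many \<open>T'\<close> and centres of balls suffice.\<close>
lemma derivative_pieces:
  fixes f :: "'b::euclidean_space \<Rightarrow> 'a::real_normed_vector"
  assumes fd: "finite_dim TYPE('a)" and f: "continuous_on UNIV f"
    and \<epsilon>: "\<And>T. T \<in> \<T> \<Longrightarrow> 0 < \<epsilon> T"
  obtains C :: "('b set \<times> ('b \<Rightarrow>\<^sub>L 'a)) set" where "countable C"
    "\<And>K T. (K, T) \<in> C \<Longrightarrow> compact K \<and> T \<in> \<T> \<and> close_to_linear (\<epsilon> T) T f K"
    "{x. \<exists>T\<in>\<T>. (f has_derivative blinfun_apply T) (at x)} \<subseteq> (\<Union>p\<in>C. fst p)"
proof -
  obtain \<D> where \<D>: "countable \<D>" "\<D> \<subseteq> \<T>" "\<And>T. T \<in> \<T> \<Longrightarrow> \<exists>T'\<in>\<D>. norm (T - T') < \<epsilon> T' / 2"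
    using finite_dim_Lindelof[OF finite_dim_blinfun[OF fd], of \<T> "\<lambda>T. \<epsilon> T / 2"] \<epsilon> by auto
  obtain D :: "'b set" where D: "countable D" "\<And>X. open X \<Longrightarrow> X \<noteq> {} \<Longrightarrow> \<exists>d\<in>D. d \<in> X"
    using countable_dense_exists by blast
  define r where "r = (\<lambda>k::nat. 1 / real (Suc k))"
  have r: "0 < r k" for k by (simp add: r_def)
  define E where "E = (\<lambda>T k. {x. \<forall>y. dist x y < r k \<longrightarrow> norm (f y - f x - blinfun_apply T (y - x)) \<le> \<epsilon> T * norm (y - x)})"
  define K where "K = (\<lambda>(T, k, q). cball q (r k / 4) \<inter> E T k)"
  have "closed (E T k)" for T k
  proof -
    have "E T k = (\<Inter>y. {x. r k \<le> dist x y} \<union> {x. norm (f y - f x - blinfun_apply T (y - x)) \<le> \<epsilon> T * norm (y - x)})"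
      unfolding E_def by (simp add: set_eq_iff) (metis not_le)
    also have "closed \<dots>"
      by (intro closed_INT ballI closed_Un closed_Collect_le continuous_intros f)
    finally show ?thesis .
  qed
  then have cK: "compact (K p)" for p by (auto simp: K_def split: prod.split intro: compact_Int_closed)
  have close: "close_to_linear (\<epsilon> T) T f (K (T, k, q))" for T k q
    unfolding close_to_linear_def
  proof (intro ballI)
    fix x y assume "x \<in> K (T, k, q)" and y: "y \<in> K (T, k, q)"
    then have "dist q x \<le> r k / 4" "dist q y \<le> r k / 4" by (auto simp: K_def)
    then have "dist y x < r k" using dist_triangle3[of y x q] r[of k] by simp
    then show "norm (f x - f y - blinfun_apply T (x - y)) \<le> \<epsilon> T * norm (x - y)"
      using y by (auto simp: K_def E_def)
  qed
  show ?thesis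
  proof (rule that[of "(\<lambda>(T, k, q). (K (T, k, q), T)) ` (\<D> \<times> UNIV \<times> D)"])
    show "countable ((\<lambda>(T, k, q). (K (T, k, q), T)) ` (\<D> \<times> UNIV \<times> D))"
      using \<D>(1) D(1) by (intro countable_image countable_SIGMA) auto
    show "compact L \<and> T \<in> \<T> \<and> close_to_linear (\<epsilon> T) T f L"
      if "(L, T) \<in> (\<lambda>(T, k, q). (K (T, k, q), T)) ` (\<D> \<times> UNIV \<times> D)" for L T
      using that cK close \<D>(2) by auto
    show "{x. \<exists>T\<in>\<T>. (f has_derivative blinfun_apply T) (at x)} \<subseteq> (\<Union>p\<in>(\<lambda>(T, k, q). (K (T, k, q), T)) ` (\<D> \<times> UNIV \<times> D). fst p)"
    proof clarify
      fix x T assume T: "T \<in> \<T>" and d: "(f has_derivative blinfun_apply T) (at x)"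
      obtain T' where T': "T' \<in> \<D>" "norm (T - T') < \<epsilon> T' / 2" using \<D>(3)[OF T] by blast
      have e: "0 < \<epsilon> T' / 2" using \<epsilon> T' \<D> by auto
      obtain \<delta> where \<delta>: "0 < \<delta>" "\<And>y. norm (y - x) < \<delta> \<Longrightarrow> norm (f y - f x - T (y - x)) \<le> \<epsilon> T' / 2 * norm (y - x)"
        using d e unfolding has_derivative_at_alt by blast
      obtain k where k: "r k < \<delta>" using nat_approx_posE[OF \<delta>(1)] unfolding r_def by metis
      have "x \<in> E T' k"
        unfolding E_def
      proof clarify
        fix y assume "dist x y < r k"
        then have "norm (y - x) < \<delta>" using k by (simp add: dist_norm norm_minus_commute)
        have "norm (f y - f x - T' (y - x)) \<le> norm (f y - f x - T (y - x)) + norm ((T - T') (y - x))"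
          by (rule order_trans[OF _ norm_triangle_ineq]) (simp add: blinfun.diff_left)
        also have "\<dots> \<le> \<epsilon> T' / 2 * norm (y - x) + \<epsilon> T' / 2 * norm (y - x)"
        proof (intro add_mono \<delta>)
          have "norm ((T - T') (y - x)) \<le> norm (T - T') * norm (y - x)" by (rule norm_blinfun)
          also have "\<dots> \<le> \<epsilon> T' / 2 * norm (y - x)" using T' by (intro mult_right_mono) auto
          finally show "norm ((T - T') (y - x)) \<le> \<epsilon> T' / 2 * norm (y - x)" .
        qed fact
        finally show "norm (f y - f x - T' (y - x)) \<le> \<epsilon> T' * norm (y - x)" by simp
      qed
      moreover obtain q where q: "q \<in> D" "q \<in> ball x (r k / 4)"
        using D(2)[of "ball x (r k / 4)"] r[of k] by auto
      ultimately have "x \<in> K (T', k, q)" by (simp add: K_def dist_commute less_imp_le)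
      then show "x \<in> (\<Union>p\<in>(\<lambda>(T, k, q). (K (T, k, q), T)) ` (\<D> \<times> UNIV \<times> D). fst p)"
        using T' q by force
    qed
  qed
qed

lemma hausdorff_null_lipschitz_image:
  fixes f :: "'b::metric_space \<Rightarrow> 'a::metric_space"
  assumes f: "L-lipschitz_on S f" and "hausdorff_measure m S = 0"
  shows "hausdorff_measure m (f ` S) = 0"
proof -
  have "hausdorff_measure m (f ` S) \<le> ennreal ((L + 1) ^ m) * hausdorff_measure m ((\<lambda>x. x) ` S)"
  proof (rule hausdorff_measure_le_of_dist_le)
    fix x y assume "x \<in> S" "y \<in> S"
    then have "dist (f x) (f y) \<le> L * dist x y" by (rule lipschitz_onD[OF f])
    also have "\<dots> \<le> (L + 1) * dist x y" by (intro mult_right_mono) auto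
    finally show "dist (f x) (f y) \<le> (L + 1) * dist x y" .
  qed (use lipschitz_on_nonneg[OF f] in simp)
  then show ?thesis using assms(2) by simp
qed

text \<open>Sard's lemma for the points with degenerate derivative: in a ball they are covered by disjoint
  pieces on which f multiplies measure by at most \<open>\<eta>\<close>.\<close>
lemma hausdorff_measure_critical_values:
  fixes f :: "'b::euclidean_space \<Rightarrow> 'a::real_normed_vector"
  assumes fd: "finite_dim TYPE('a)" and f: "continuous_on UNIV f"
  shows "hausdorff_measure DIM('b)
    (f ` {x. \<exists>T :: 'b \<Rightarrow>\<^sub>L 'a. \<not> inj (blinfun_apply T) \<and> (f has_derivative blinfun_apply T) (at x)}) = 0"
proof -
  let ?Z = "{x. \<exists>T :: 'b \<Rightarrow>\<^sub>L 'a. \<not> inj (blinfun_apply T) \<and> (f has_derivative blinfun_apply T) (at x)}"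
  have bounded: "hausdorff_measure DIM('b) (f ` (?Z \<inter> cball 0 (real R))) = 0" for R :: nat
  proof -
    let ?B = "cball (0::'b) (real R)"
    obtain v where v: "emeasure lborel ?B = ennreal v" "0 \<le> v"
      using emeasure_lborel_cball_finite[of "0::'b" "real R"] by (cases "emeasure lborel ?B") auto
    have "hausdorff_measure DIM('b) (f ` (?Z \<inter> ?B)) \<le> 0 + ennreal e" if e: "0 < e" for e
    proof -
      \<comment> \<open>Chosen such that \<open>\<eta> * v \<le> e\<close> also when v is 0.\<close>
      define \<eta> where "\<eta> = e / (v + 1)"
      have \<eta>: "0 < \<eta>" "\<eta> * v \<le> e" using e v by (auto simp: \<eta>_def field_simps)
      define admissible where "admissible = (\<lambda>(T :: 'b \<Rightarrow>\<^sub>L 'a) d. 0 < d \<and> (\<forall>f S. close_to_linear d T f S \<longrightarrow> S \<in> sets borel \<longrightarrow>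
        hausdorff_measure DIM('b) (f ` S) \<le> ennreal \<eta> * emeasure lborel S))"
      define \<epsilon> where "\<epsilon> = (\<lambda>T. SOME d. admissible T d)"
      have admissible: "admissible T (\<epsilon> T)" if T: "\<not> inj (blinfun_apply T)" for T
      proof (rule hausdorff_measure_close_noninj[OF T, of "ennreal \<eta>"])
        show "0 < ennreal \<eta>" using \<eta>(1) by simp
      next
        fix d assume "0 < d" "\<And>f S. close_to_linear d T f S \<Longrightarrow> S \<in> sets borel \<Longrightarrow>
          hausdorff_measure DIM('b) (f ` S) \<le> ennreal \<eta> * emeasure lborel S"
        then have "admissible T d" by (simp add: admissible_def)
        then show ?thesis unfolding \<epsilon>_def by (rule someI)
      qed
      have \<epsilon>: "0 < \<epsilon> T" if "\<not> inj (blinfun_apply T)" for T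
        using admissible[OF that] by (simp add: admissible_def)
      have \<epsilon>': "hausdorff_measure DIM('b) (f ` S) \<le> ennreal \<eta> * emeasure lborel S"
        if "\<not> inj (blinfun_apply T)" "close_to_linear (\<epsilon> T) T f S" "S \<in> sets borel" for T f S
        using admissible[OF that(1)] that(2,3) by (simp add: admissible_def)
      obtain C where C: "countable C"
        "\<And>K T. (K, T) \<in> C \<Longrightarrow> compact K \<and> T \<in> {T :: 'b \<Rightarrow>\<^sub>L 'a. \<not> inj (blinfun_apply T)} \<and> close_to_linear (\<epsilon> T) T f K"
        "{x. \<exists>T\<in>{T. \<not> inj (blinfun_apply T)}. (f has_derivative blinfun_apply T) (at x)} \<subseteq> (\<Union>p\<in>C. fst p)"
        using derivative_pieces[OF fd f, of "{T. \<not> inj (blinfun_apply T)}" \<epsilon>] \<epsilon> by auto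
      show ?thesis
      proof (cases "C = {}")
        case True
        then have "f ` (?Z \<inter> ?B) = {}" using C(3) by auto
        then show ?thesis by (simp only: H_empty) simp
      next
        case False
        define c where "c = from_nat_into C"
        have cC: "c i \<in> C" for i unfolding c_def using False by (rule from_nat_into)
        have rc: "range c = C" unfolding c_def using False C(1) by (rule range_from_nat_into)
        define K where "K = (\<lambda>i. fst (c i) \<inter> ?B)"
        define D where "D = disjointed K"
        have Ki: "compact (fst (c i))" "\<not> inj (blinfun_apply (snd (c i)))"
          "close_to_linear (\<epsilon> (snd (c i))) (snd (c i)) f (fst (c i))" for i
          using C(2)[of "fst (c i)" "snd (c i)"] cC[of i] by auto
        have Kb: "K i \<in> sets borel" for i
          unfolding K_def using Ki(1) by (intro borel_closed closed_Int compact_imp_closed) auto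
        have Db: "D i \<in> sets borel" for i
          using sets.range_disjointed_sets[of K borel] Kb unfolding D_def by auto
        have DK: "D i \<subseteq> fst (c i)" "D i \<subseteq> ?B" for i
          using disjointed_subset[of K i] by (auto simp: D_def K_def)
        have UD: "(\<Union>i. D i) = (\<Union>i. K i)" unfolding D_def by (rule UN_disjointed_eq)
        have "?Z \<inter> ?B \<subseteq> (\<Union>i. D i)"
          unfolding UD using C(3) rc by (fastforce simp: K_def)
        then have "hausdorff_measure DIM('b) (f ` (?Z \<inter> ?B)) \<le> hausdorff_measure DIM('b) (\<Union>i. f ` D i)"
          by (intro H_mono) blast
        also have "\<dots> \<le> (\<Sum>i. hausdorff_measure DIM('b) (f ` D i))" by (rule H_subadd)
        also have "\<dots> \<le> (\<Sum>i. ennreal \<eta> * emeasure lborel (D i))"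
          by (intro suminf_le \<epsilon>'[OF Ki(2) close_to_linear_subset[OF Ki(3) DK(1)] Db]) auto
        also have "\<dots> = ennreal \<eta> * (\<Sum>i. emeasure lborel (D i))" by simp
        also have "(\<Sum>i. emeasure lborel (D i)) = emeasure lborel (\<Union>i. D i)"
          using Db by (intro suminf_emeasure) (auto simp: D_def disjoint_family_disjointed)
        also have "ennreal \<eta> * \<dots> \<le> ennreal \<eta> * ennreal v"
          using DK(2) unfolding v(1)[symmetric] by (intro mult_left_mono emeasure_mono) auto
        also have "\<dots> \<le> ennreal e" using \<eta> v by (simp add: ennreal_mult[symmetric] ennreal_leI)
        finally show ?thesis by simp
      qed
    qed
    then have "hausdorff_measure DIM('b) (f ` (?Z \<inter> ?B)) \<le> 0" by (rule ennreal_le_epsilon)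
    then show ?thesis by simp
  qed
  have "?Z = (\<Union>R::nat. ?Z \<inter> cball 0 (real R))"
    using real_arch_simple by auto
  then have "f ` ?Z = (\<Union>R::nat. f ` (?Z \<inter> cball 0 (real R)))" by blast
  then have "hausdorff_measure DIM('b) (f ` ?Z) = hausdorff_measure DIM('b) (\<Union>R::nat. f ` (?Z \<inter> cball 0 (real R)))"
    by (rule arg_cong)
  also have "\<dots> \<le> (\<Sum>R::nat. hausdorff_measure DIM('b) (f ` (?Z \<inter> cball 0 (real R))))"
    by (rule H_subadd)
  also have "\<dots> = 0" by (simp only: bounded) simp
  finally show ?thesis by simp
qed

lemma lipschitz_image_pieces:
  fixes f :: "'b::euclidean_space \<Rightarrow> 'a::real_normed_vector"
  assumes fd: "finite_dim TYPE('a)" and f: "L-lipschitz_on UNIV f"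
    and \<epsilon>: "\<And>T :: 'b \<Rightarrow>\<^sub>L 'a. inj (blinfun_apply T) \<Longrightarrow> 0 < \<epsilon> T"
  obtains C :: "('b set \<times> ('b \<Rightarrow>\<^sub>L 'a)) set" where "countable C"
    "\<And>K T. (K, T) \<in> C \<Longrightarrow> compact K \<and> inj (blinfun_apply T) \<and> close_to_linear (\<epsilon> T) T f K"
    "hausdorff_measure DIM('b) (range f - (\<Union>p\<in>C. f ` fst p)) = 0"
proof -
  have cont: "continuous_on UNIV f" by (rule lipschitz_on_continuous_on[OF f])
  obtain C where C: "countable C"
    "\<And>K T. (K, T) \<in> C \<Longrightarrow> compact K \<and> T \<in> {T :: 'b \<Rightarrow>\<^sub>L 'a. inj (blinfun_apply T)} \<and> close_to_linear (\<epsilon> T) T f K"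
    "{x. \<exists>T\<in>{T. inj (blinfun_apply T)}. (f has_derivative blinfun_apply T) (at x)} \<subseteq> (\<Union>p\<in>C. fst p)"
    using derivative_pieces[OF fd cont, of "{T. inj (blinfun_apply T)}" \<epsilon>] \<epsilon> by blast
  let ?Z = "{x. \<exists>T :: 'b \<Rightarrow>\<^sub>L 'a. \<not> inj (blinfun_apply T) \<and> (f has_derivative blinfun_apply T) (at x)}"
  obtain N where N: "{x \<in> space lborel. \<not> (\<exists>T :: 'b \<Rightarrow>\<^sub>L 'a. (f has_derivative blinfun_apply T) (at x))} \<subseteq> N"
    "emeasure lborel N = 0" "N \<in> sets lborel" using AE_E[OF rademacher[OF fd f]] by blast
  have "hausdorff_measure DIM('b) N = 0" using N by (simp add: hausdorff_measure_eq_lborel)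
  then have fN: "hausdorff_measure DIM('b) (f ` N) = 0"
    using hausdorff_null_lipschitz_image[OF lipschitz_on_subset[OF f]] by blast
  have "range f - (\<Union>p\<in>C. f ` fst p) \<subseteq> f ` N \<union> f ` ?Z"
  proof
    fix y assume y: "y \<in> range f - (\<Union>p\<in>C. f ` fst p)"
    then obtain x where x: "y = f x" "x \<notin> (\<Union>p\<in>C. fst p)" by auto
    show "y \<in> f ` N \<union> f ` ?Z"
    proof (cases "\<exists>T :: 'b \<Rightarrow>\<^sub>L 'a. (f has_derivative blinfun_apply T) (at x)")
      case True
      then obtain T :: "'b \<Rightarrow>\<^sub>L 'a" where T: "(f has_derivative blinfun_apply T) (at x)" by blast
      then have "\<not> inj (blinfun_apply T)" using x C(3) by blast
      then show ?thesis using T x by blast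
    next
      case False
      then have "x \<in> N" using N(1) by auto
      then show ?thesis using x by blast
    qed
  qed
  then have "hausdorff_measure DIM('b) (range f - (\<Union>p\<in>C. f ` fst p)) \<le>
    hausdorff_measure DIM('b) (f ` N \<union> f ` ?Z)" by (rule H_mono)
  also have "\<dots> \<le> 0 + 0"
    using H_subadd2[of "DIM('b)" "f ` N" "f ` ?Z"] hausdorff_measure_critical_values[OF fd cont] fN by simp
  finally show ?thesis using that[of C] C by auto
qed

text \<open>The Lipschitz maps are extended to the whole space, their images are cut into pieces, and the
  pieces are enumerated and made disjoint. What the images of the pieces miss is the image of the
  points with degenerate derivative or without derivative, which is null.\<close>
lemma rectifiable_pieces:
  fixes A :: "'a::real_normed_vector set"
  assumes fd: "finite_dim TYPE('a)" and A: "A \<in> sets borel" "countably_rectifiable TYPE('m::finite) A"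
    and \<epsilon>: "\<And>T :: (real^'m) \<Rightarrow>\<^sub>L 'a. inj (blinfun_apply T) \<Longrightarrow> 0 < \<epsilon> T"
  obtains f :: "nat \<Rightarrow> real^'m \<Rightarrow> 'a" and K T and P :: "nat \<Rightarrow> 'a set"
  where "\<And>i. compact (K i)"
    "\<And>i. P i \<noteq> {} \<Longrightarrow> inj (blinfun_apply (T i))"
    "\<And>i. P i \<noteq> {} \<Longrightarrow> close_to_linear (\<epsilon> (T i)) (T i) (f i) (K i)"
    "\<And>i. P i \<in> sets borel" "\<And>i. P i \<subseteq> f i ` K i" "\<And>i. P i \<subseteq> A" "disjoint_family P"
    "hausdorff_measure CARD('m) (A - (\<Union>i. P i)) = 0"
proof -
  have dim: "DIM(real^'m) = CARD('m)" by simp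
  obtain S :: "nat \<Rightarrow> (real^'m) set" and g where Sg:
    "(\<forall>j. bounded (S j) \<and> (\<exists>L. L-lipschitz_on (S j) (g j))) \<and>
      hausdorff_measure CARD('m) (A - (\<Union>j. g j ` S j)) = 0"
    using A(2) unfolding countably_rectifiable_def by (elim exE)
  then have S: "\<exists>L. L-lipschitz_on (S j) (g j)"
    "hausdorff_measure CARD('m) (A - (\<Union>j. g j ` S j)) = 0" for j by auto
  have "\<forall>j. \<exists>p. (\<forall>x\<in>S j. fst p x = g j x) \<and> (snd p)-lipschitz_on UNIV (fst p)"
  proof
    fix j
    obtain L0 where "L0-lipschitz_on (S j) (g j)" using S(1) by blast
    then show "\<exists>p. (\<forall>x\<in>S j. fst p x = g j x) \<and> (snd p)-lipschitz_on UNIV (fst p)"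
    proof (rule lipschitz_extension[OF fd])
      fix h L assume "\<And>x. x \<in> S j \<Longrightarrow> h x = g j x" "L-lipschitz_on UNIV h"
      then show ?thesis by (intro exI[of _ "(h, L)"]) simp
    qed
  qed
  from choice[OF this] obtain p where
    p: "\<And>j. (\<forall>x\<in>S j. fst (p j) x = g j x) \<and> (snd (p j))-lipschitz_on UNIV (fst (p j))" by blast
  define h where "h = (\<lambda>j. fst (p j))"
  define L where "L = (\<lambda>j. snd (p j))"
  have h: "\<And>j x. x \<in> S j \<Longrightarrow> h j x = g j x" "\<And>j. (L j)-lipschitz_on UNIV (h j)"
    using p by (auto simp: h_def L_def)
  define ok where "ok = (\<lambda>j (C :: ((real^'m) set \<times> ((real^'m) \<Rightarrow>\<^sub>L 'a)) set). countable C \<and>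
    (\<forall>K T. (K, T) \<in> C \<longrightarrow> compact K \<and> inj (blinfun_apply T) \<and> close_to_linear (\<epsilon> T) T (h j) K) \<and>
    hausdorff_measure CARD('m) (range (h j) - (\<Union>p\<in>C. h j ` fst p)) = 0)"
  have "\<forall>j. \<exists>C. ok j C"
  proof
    fix j
    show "\<exists>C. ok j C"
    proof (rule lipschitz_image_pieces[OF fd h(2)[of j] \<epsilon>, unfolded dim])
      fix C assume "countable C"
        "\<And>K T. (K, T) \<in> C \<Longrightarrow> compact K \<and> inj (blinfun_apply T) \<and> close_to_linear (\<epsilon> T) T (h j) K"
        "hausdorff_measure CARD('m) (range (h j) - (\<Union>p\<in>C. h j ` fst p)) = 0"
      then show ?thesis by (intro exI[of _ C]) (simp add: ok_def)
    qed
  qed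
  from choice[OF this] obtain C where "\<And>j. ok j (C j)" by blast
  then have C: "\<And>j. countable (C j)"
    "\<And>j K T. (K, T) \<in> C j \<Longrightarrow> compact K \<and> inj (blinfun_apply T) \<and> close_to_linear (\<epsilon> T) T (h j) K"
    "\<And>j. hausdorff_measure CARD('m) (range (h j) - (\<Union>p\<in>C j. h j ` fst p)) = 0"
    by (simp_all add: ok_def)
  \<comment> \<open>The inserted empty piece keeps the enumeration total if there are no others.\<close>
  define X where "X = insert (h 0, {}, 0) ((\<lambda>(j, K, T). (h j, K, T)) ` (SIGMA j:UNIV. C j))"
  have cX: "countable X" unfolding X_def using C(1) by (intro countable_insert countable_image countable_SIGMA) auto
  have neX: "X \<noteq> {}" by (simp add: X_def)
  define c where "c = from_nat_into X"
  have cin: "c i \<in> X" for i unfolding c_def using neX by (rule from_nat_into)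
  have rc: "range c = X" unfolding c_def using neX cX by (rule range_from_nat_into)
  define f where "f = (\<lambda>i. fst (c i))"
  define K where "K = (\<lambda>i. fst (snd (c i)))"
  define T where "T = (\<lambda>i. snd (snd (c i)))"
  have piece: "compact (K i) \<and> continuous_on UNIV (f i) \<and>
    (K i \<noteq> {} \<longrightarrow> inj (blinfun_apply (T i)) \<and> close_to_linear (\<epsilon> (T i)) (T i) (f i) (K i))" for i
    using cin[of i] C(2) lipschitz_on_continuous_on[OF h(2)] unfolding X_def f_def K_def T_def by auto
  define Q where "Q = (\<lambda>i. A \<inter> f i ` K i)"
  define P where "P = disjointed Q"
  have Qb: "Q i \<in> sets borel" for i
  proof -
    have "continuous_on (K i) (f i)" using piece[of i] continuous_on_subset by blast
    then have "compact (f i ` K i)" using piece[of i] compact_continuous_image by blast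
    then show ?thesis unfolding Q_def using A(1) by (simp add: sets.Int borel_compact)
  qed
  have PQ: "P i \<subseteq> Q i" for i unfolding P_def by (rule disjointed_subset)
  have UP: "(\<Union>i. P i) = (\<Union>i. Q i)" unfolding P_def by (rule UN_disjointed_eq)
  show ?thesis
  proof (rule that[of K P T f])
    show "P i \<in> sets borel" for i
      using sets.range_disjointed_sets[of Q borel] Qb unfolding P_def by blast
    show "disjoint_family P" unfolding P_def by (rule disjoint_family_disjointed)
    show "compact (K i)" for i using piece by blast
    show "P i \<subseteq> f i ` K i" "P i \<subseteq> A" for i using PQ[of i] unfolding Q_def by blast+
    have "K i \<noteq> {}" if "P i \<noteq> {}" for i using that PQ[of i] unfolding Q_def by blast
    then show "inj (blinfun_apply (T i))" "close_to_linear (\<epsilon> (T i)) (T i) (f i) (K i)" if "P i \<noteq> {}" for i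
      using that piece[of i] by blast+
    have "A - (\<Union>i. P i) \<subseteq> (A - (\<Union>j. g j ` S j)) \<union> (\<Union>j. range (h j) - (\<Union>p\<in>C j. h j ` fst p))"
    proof
      fix y assume y: "y \<in> A - (\<Union>i. P i)"
      show "y \<in> (A - (\<Union>j. g j ` S j)) \<union> (\<Union>j. range (h j) - (\<Union>p\<in>C j. h j ` fst p))"
      proof (cases "y \<in> (\<Union>j. g j ` S j)")
        case True
        then obtain j x where jx: "x \<in> S j" "y = g j x" by blast
        have "y \<notin> h j ` K'" if KT: "(K', T') \<in> C j" for K' T'
        proof
          assume yK: "y \<in> h j ` K'"
          have "(h j, K', T') \<in> X" using KT unfolding X_def by force
          then obtain i where "c i = (h j, K', T')" using rc by (metis rangeE)
          then have "y \<in> Q i" using yK y by (simp add: Q_def f_def K_def)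
          then show False using y UP by blast
        qed
        then have "y \<notin> (\<Union>p\<in>C j. h j ` fst p)" by (metis UN_E prod.collapse)
        moreover have "y \<in> range (h j)" using jx h(1)[OF jx(1)] by (metis rangeI)
        ultimately have "y \<in> range (h j) - (\<Union>p\<in>C j. h j ` fst p)" by blast
        then show ?thesis by blast
      qed (use y in blast)
    qed
    then have "hausdorff_measure CARD('m) (A - (\<Union>i. P i)) \<le>
      hausdorff_measure CARD('m) ((A - (\<Union>j. g j ` S j)) \<union> (\<Union>j. range (h j) - (\<Union>p\<in>C j. h j ` fst p)))" by (rule H_mono)
    also have "\<dots> \<le> hausdorff_measure CARD('m) (A - (\<Union>j. g j ` S j)) +
      (\<Sum>j. hausdorff_measure CARD('m) (range (h j) - (\<Union>p\<in>C j. h j ` fst p)))"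
      by (rule order_trans[OF H_subadd2]) (intro add_left_mono H_subadd)
    also have "\<dots> = 0" unfolding S(2) C(3) by simp
    finally show "hausdorff_measure CARD('m) (A - (\<Union>i. P i)) = 0" by simp
  qed
qed

lemma close_to_linear_preimage:
  fixes f :: "'b::euclidean_space \<Rightarrow> 'a::real_normed_vector"
  assumes K: "compact K" and f: "close_to_linear e T f K" "0 \<le> e" and Q: "Q \<in> sets borel" "Q \<subseteq> f ` K"
  obtains S where "S \<subseteq> K" "S \<in> sets borel" "emeasure lborel S < \<infinity>" "f ` S = Q"
proof
  let ?S = "K \<inter> f -` Q"
  have Kb: "K \<in> sets borel" using K by (rule borel_compact)
  have "continuous_on K f"
  proof (rule lipschitz_on_continuous_on)
    show "(norm T + e)-lipschitz_on K f"
      by (rule lipschitz_onI) (use close_to_linear_dist_le_norm[OF f(1)] f(2) in auto)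
  qed
  then have "f \<in> borel_measurable (restrict_space borel K)" by (rule borel_measurable_continuous_on_restrict)
  then have "f -` Q \<inter> space (restrict_space borel K) \<in> sets (restrict_space borel K)"
    using Q(1) by (rule measurable_sets)
  then show "?S \<in> sets borel"
    using Kb by (simp add: sets_restrict_space_iff space_restrict_space Int_commute)
  have "emeasure lborel ?S \<le> emeasure lborel K" using Kb by (intro emeasure_mono) auto
  also have "\<dots> < \<infinity>" using emeasure_compact_finite[OF K] by simp
  finally show "emeasure lborel ?S < \<infinity>" .
  show "f ` ?S = Q" using Q(2) by auto
qed auto

section \<open>The gross measure is at most the Hausdorff measure\<close>

lemma range_in_Grassmannian:
  fixes T :: "'b::euclidean_space \<Rightarrow>\<^sub>L 'a::real_normed_vector"
  assumes T: "inj (blinfun_apply T)"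
  shows "range (blinfun_apply T) \<in> Grassmannian DIM('b)"
proof -
  have lin: "linear (blinfun_apply T)" by (simp add: bounded_linear.linear blinfun.bounded_linear_right)
  have r: "range (blinfun_apply T) = span (T ` Basis)"
    using linear_span_image[OF lin, of Basis] by simp
  have "independent (T ` Basis)"
    using linear_independent_injective_image[OF lin independent_Basis] T by simp
  then have "dim (range (blinfun_apply T)) = card (T ` Basis)"
    unfolding r by (simp add: dim_eq_card_independent)
  also have "\<dots> = DIM('b)" using T by (intro card_image) (auto intro: inj_on_subset)
  finally show ?thesis unfolding Grassmannian_def r using subspace_span by auto
qed

lemma close_to_linear_compose:
  assumes "close_to_linear e T f S"
  shows "close_to_linear (norm \<pi> * e) (\<pi> o\<^sub>L T) (\<lambda>x. blinfun_apply \<pi> (f x)) S"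
  unfolding close_to_linear_def
proof (intro ballI)
  fix x y assume xy: "x \<in> S" "y \<in> S"
  have "norm (\<pi> (f x) - \<pi> (f y) - (\<pi> o\<^sub>L T) (x - y)) = norm (\<pi> (f x - f y - T (x - y)))"
    by (simp add: blinfun.diff_right)
  also have "\<dots> \<le> norm \<pi> * norm (f x - f y - T (x - y))" by (rule norm_blinfun)
  also have "\<dots> \<le> norm \<pi> * (e * norm (x - y))"
    by (intro mult_left_mono close_to_linearD[OF assms] xy) auto
  finally show "norm (\<pi> (f x) - \<pi> (f y) - (\<pi> o\<^sub>L T) (x - y)) \<le> norm \<pi> * e * norm (x - y)"
    by (simp add: mult.assoc)
qed

lemma ennreal_le_of_factors:
  fixes x y :: ennreal
  assumes "\<And>\<eta>::real. 0 < \<eta> \<Longrightarrow> x \<le> ennreal ((1 + \<eta>) ^ k) * y"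
  shows "x \<le> y"
proof (cases "y = \<infinity>")
  case False
  have "(\<lambda>n. 1 / real (Suc n)) \<longlonglongrightarrow> 0"
    using LIMSEQ_inverse_real_of_nat by (simp add: inverse_eq_divide)
  then have "(\<lambda>n. (1 + 1 / real (Suc n)) ^ k) \<longlonglongrightarrow> (1 + 0) ^ k" by (intro tendsto_intros)
  then have "(\<lambda>n. y * ennreal ((1 + 1 / real (Suc n)) ^ k)) \<longlonglongrightarrow> y * ennreal ((1 + 0) ^ k)"
    using False by (intro ennreal_tendsto_cmult tendsto_ennrealI) (auto simp: less_top)
  moreover have "x \<le> y * ennreal ((1 + 1 / real (Suc n)) ^ k)" for n
    using assms[of "1 / real (Suc n)"] by (simp add: mult.commute)
  ultimately have "x \<le> y * ennreal ((1 + 0) ^ k)" by (intro LIMSEQ_le_const) blast+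
  then show ?thesis by simp
qed simp

text \<open>The tolerance e depends on T only through the lower bound c. In the lower estimate for G it must
  serve all maps \<open>\<pi> \<circ> T\<close> with the same lower bound simultaneously.\<close>
lemma close_distortion:
  assumes c: "0 < c" and \<eta>: "0 < \<eta>"
  obtains e where "0 < e" "\<And>(T :: 'b::euclidean_space \<Rightarrow>\<^sub>L 'a::real_normed_vector) f S.
    (\<And>v. c * norm v \<le> norm (blinfun_apply T v)) \<Longrightarrow> close_to_linear e T f S \<Longrightarrow> S \<in> sets borel \<Longrightarrow>
    area_factor T * emeasure lborel S \<le> ennreal (1 + \<eta>) * hausdorff_measure DIM('b) (f ` S) \<and>
    hausdorff_measure DIM('b) (f ` S) \<le> ennreal (1 + \<eta>) * (area_factor T * emeasure lborel S)"
proof -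
  have l1: "((\<lambda>e. (1 / (1 - e / c)) ^ DIM('b)) \<longlongrightarrow> (1 / (1 - 0 / c)) ^ DIM('b)) (at_right 0)"
    using c by (intro tendsto_intros) auto
  have l2: "((\<lambda>e. (1 + e / c) ^ DIM('b)) \<longlongrightarrow> (1 + 0 / c) ^ DIM('b)) (at_right 0)"
    using c by (intro tendsto_intros) auto
  have "\<forall>\<^sub>F e in at_right 0. (1 / (1 - e / c)) ^ DIM('b) < 1 + \<eta>"
    by (rule order_tendstoD(2)[OF l1]) (use \<eta> in simp)
  moreover have "\<forall>\<^sub>F e in at_right 0. (1 + e / c) ^ DIM('b) < 1 + \<eta>"
    by (rule order_tendstoD(2)[OF l2]) (use \<eta> in simp)
  moreover have "\<forall>\<^sub>F e in at_right 0. e < c"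
    using c by (auto simp: eventually_at_right_field)
  moreover have "\<forall>\<^sub>F e in at_right (0::real). 0 < e" by (rule eventually_at_right_less)
  ultimately have "\<forall>\<^sub>F e in at_right 0. (1 / (1 - e / c)) ^ DIM('b) < 1 + \<eta> \<and>
    (1 + e / c) ^ DIM('b) < 1 + \<eta> \<and> e < c \<and> 0 < e" by eventually_elim auto
  then obtain e where e: "(1 / (1 - e / c)) ^ DIM('b) < 1 + \<eta>" "(1 + e / c) ^ DIM('b) < 1 + \<eta>" "e < c" "0 < e"
    by (auto dest: eventually_happens'[OF trivial_limit_at_right_real])
  show ?thesis
  proof (rule that[OF e(4)])
    fix T :: "'b \<Rightarrow>\<^sub>L 'a" and f S
    assume T: "\<And>v. c * norm v \<le> norm (T v)" and f: "close_to_linear e T f S" and S: "S \<in> sets borel"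
    have "area_factor T * emeasure lborel S \<le> ennreal ((1 / (1 - e / c)) ^ DIM('b)) * hausdorff_measure DIM('b) (f ` S)"
      by (rule hausdorff_measure_close_lower[OF T _ _ f S]) (use e in auto)
    also have "\<dots> \<le> ennreal (1 + \<eta>) * hausdorff_measure DIM('b) (f ` S)"
      using e by (intro mult_right_mono ennreal_leI) auto
    finally have 1: "area_factor T * emeasure lborel S \<le> ennreal (1 + \<eta>) * hausdorff_measure DIM('b) (f ` S)" .
    have "hausdorff_measure DIM('b) (f ` S) \<le> ennreal ((1 + e / c) ^ DIM('b)) * (area_factor T * emeasure lborel S)"
      by (rule hausdorff_measure_close_upper[OF c T _ f S]) (use e in auto)
    also have "\<dots> \<le> ennreal (1 + \<eta>) * (area_factor T * emeasure lborel S)"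
      using e by (intro mult_right_mono ennreal_leI) auto
    finally show "area_factor T * emeasure lborel S \<le> ennreal (1 + \<eta>) * hausdorff_measure DIM('b) (f ` S) \<and>
      hausdorff_measure DIM('b) (f ` S) \<le> ennreal (1 + \<eta>) * (area_factor T * emeasure lborel S)" using 1 by simp
  qed
qed

lemma area_factor_less_scaled:
  assumes "inj (blinfun_apply (T :: 'b::euclidean_space \<Rightarrow>\<^sub>L 'a::real_normed_vector))" "0 < \<eta>"
  shows "area_factor T < ennreal (1 + \<eta>) * area_factor T"
proof -
  obtain j where j: "area_factor T = ennreal j" "0 < j"
    using hausdorff_measure_linear_image_inj(2)[OF assms(1) borel_open[OF open_empty]] area_factor_pos[OF assms(1)]
    by (cases "area_factor T") (auto simp: ennreal_less_zero_iff)
  then show ?thesis using assms(2) by (simp add: ennreal_mult[symmetric] ennreal_less_iff del: ennreal_plus)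
qed

lemma area_factor_compose:
  fixes T :: "'b::euclidean_space \<Rightarrow>\<^sub>L 'a::real_normed_vector"
  shows "area_factor (\<pi> o\<^sub>L T) = hausdorff_measure DIM('b) (blinfun_apply \<pi> ` blinfun_apply T ` cbox 0 One)"
  by (simp add: area_factor_def image_comp comp_def)

context
  fixes \<mu> :: "('a::real_normed_vector \<Rightarrow>\<^sub>L 'a) measure" and m W
  assumes dc: "density_contractor m W \<mu>"
begin

lemma dc_space: "space \<mu> = Hom_rank m"
  using dc sets_eq_imp_space_eq[of \<mu> "restrict_space borel (Hom_rank m)"]
  by (auto simp: density_contractor_def space_restrict_space)

lemma dc_measurable: "f \<in> borel_measurable borel \<Longrightarrow> f \<in> borel_measurable \<mu>"
proof -
  have s: "sets \<mu> = sets (restrict_space borel (Hom_rank m))" using dc by (simp add: density_contractor_def)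
  show "f \<in> borel_measurable borel \<Longrightarrow> f \<in> borel_measurable \<mu>"
    unfolding measurable_cong_sets[OF s refl] by (rule measurable_restrict_space1)
qed

lemma dc_sets: "U \<in> sets borel \<Longrightarrow> U \<inter> space \<mu> \<in> sets \<mu>"
proof -
  have s: "sets \<mu> = sets (restrict_space borel (Hom_rank m))" using dc by (simp add: density_contractor_def)
  show "U \<in> sets borel \<Longrightarrow> U \<inter> space \<mu> \<in> sets \<mu>"
    unfolding s dc_space by (auto simp: sets_restrict_space)
qed

lemma dc_indicator: "U \<in> sets borel \<Longrightarrow> indicator U \<in> borel_measurable \<mu>"
  by (rule dc_measurable) simp

lemma dc_le: "V \<in> Grassmannian m \<Longrightarrow> A \<in> sets borel \<Longrightarrow> A \<subseteq> V \<Longrightarrow>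
  mean_projected_measure m \<mu> A \<le> hausdorff_measure m A"
  using dc by (simp add: density_contractor_def)

lemma dc_eq: "A \<in> sets borel \<Longrightarrow> A \<subseteq> W \<Longrightarrow> mean_projected_measure m \<mu> A = hausdorff_measure m A"
  using dc by (simp add: density_contractor_def)

end

lemma measurable_blinfun_compose_left [measurable]:
  "(\<lambda>\<pi>. \<pi> o\<^sub>L T) \<in> borel_measurable borel"
  by (intro borel_measurable_continuous_onI continuous_intros)

lemma compact_linear_image_cube:
  "compact (blinfun_apply (T :: 'b::euclidean_space \<Rightarrow>\<^sub>L 'a::real_normed_vector) ` cbox 0 One)"
  by (intro compact_continuous_image continuous_intros) auto

text \<open>Monotone convergence for an arbitrary integrand g, which holds because the integral is the
  supremum over the simple functions below g.\<close>
lemma nn_integral_le_of_truncations: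
  assumes U: "\<And>n::nat. U n \<in> sets M" "incseq U" "(\<Union>n. U n) = space M"
    and le: "\<And>n. (\<integral>\<^sup>+x. g x * indicator (U n) x \<partial>M) \<le> c"
  shows "(\<integral>\<^sup>+x. g x \<partial>M) \<le> c"
  unfolding nn_integral_def
proof (rule SUP_least, clarify)
  fix s assume s: "simple_function M s" "s \<le> g"
  have [measurable]: "s \<in> borel_measurable M" using s(1) by (rule borel_measurable_simple_function)
  note U(1)[measurable]
  have "integral\<^sup>S M s = (\<integral>\<^sup>+x. s x \<partial>M)" using s(1) by (rule nn_integral_eq_simple_integral[symmetric])
  also have "\<dots> = (\<integral>\<^sup>+x. (SUP n. s x * indicator (U n) x) \<partial>M)"
  proof (rule nn_integral_cong)
    fix x assume "x \<in> space M"
    then obtain n where n: "x \<in> U n" using U(3) by blast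
    show "s x = (SUP n. s x * indicator (U n) x)"
    proof (rule antisym)
      show "s x \<le> (SUP n. s x * indicator (U n) x)" by (rule SUP_upper2[of n]) (use n in auto)
      show "(SUP n. s x * indicator (U n) x) \<le> s x" by (rule SUP_least) (auto split: split_indicator)
    qed
  qed
  also have "\<dots> = (SUP n. \<integral>\<^sup>+x. s x * indicator (U n) x \<partial>M)"
  proof (rule nn_integral_monotone_convergence_SUP)
    show "incseq (\<lambda>n x. s x * indicator (U n) x)"
      using U(2) by (auto simp: incseq_def le_fun_def split: split_indicator)
  qed measurable
  also have "\<dots> \<le> c"
  proof (rule SUP_least)
    fix n
    have "(\<integral>\<^sup>+x. s x * indicator (U n) x \<partial>M) \<le> (\<integral>\<^sup>+x. g x * indicator (U n) x \<partial>M)"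
      using s(2) by (intro nn_integral_mono mult_right_mono) (auto simp: le_fun_def)
    then show "(\<integral>\<^sup>+x. s x * indicator (U n) x \<partial>M) \<le> c" using le order_trans by blast
  qed
  finally show "integral\<^sup>S M s \<le> c" .
qed

text \<open>The mean of \<open>area_bound (1 / Suc k) (\<pi> \<circ> T)\<close> over a ball decreases to a number that is at most the
  mean of \<open>area_factor (\<pi> \<circ> T)\<close>, that is, the mean projected measure of \<open>T ` cbox 0 One\<close>. The contractor
  inequality bounds it by \<open>area_factor T\<close>, and this is strictly less than the right-hand side.\<close>
lemma mean_area_bound:
  fixes T :: "'b::euclidean_space \<Rightarrow>\<^sub>L 'a::real_normed_vector"
  assumes dc: "density_contractor DIM('b) W \<mu>" and T: "inj (blinfun_apply T)" and \<eta>: "0 < \<eta>"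
  obtains e where "0 < e" "(\<integral>\<^sup>+\<pi>. area_bound e (\<pi> o\<^sub>L T) * indicator (cball 0 r) \<pi> \<partial>\<mu>) \<le> ennreal (1 + \<eta>) * area_factor T"
proof -
  define F where "F = (\<lambda>k (\<pi> :: 'a \<Rightarrow>\<^sub>L 'a). area_bound (1 / real (Suc k)) (\<pi> o\<^sub>L T) * indicator (cball 0 r) \<pi>)"
  have [measurable]: "cball 0 r \<in> sets (borel :: ('a \<Rightarrow>\<^sub>L 'a) measure)" by (rule borel_closed) simp
  have Fm: "F k \<in> borel_measurable \<mu>" for k
    unfolding F_def by (intro dc_measurable[OF dc]) measurable
  interpret prob_space \<mu> using dc by (simp add: density_contractor_def)
  have "(\<integral>\<^sup>+\<pi>. F 0 \<pi> \<partial>\<mu>) \<le> (\<integral>\<^sup>+\<pi>. ennreal ((\<bar>r\<bar> * norm T + 1) ^ DIM('b)) * hausdorff_const TYPE('b) \<partial>\<mu>)"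
  proof (rule nn_integral_mono)
    fix \<pi> :: "'a \<Rightarrow>\<^sub>L 'a"
    show "F 0 \<pi> \<le> ennreal ((\<bar>r\<bar> * norm T + 1) ^ DIM('b)) * hausdorff_const TYPE('b)"
    proof (cases "\<pi> \<in> cball 0 r")
      case True
      have "norm (\<pi> o\<^sub>L T) \<le> norm \<pi> * norm T" by (rule norm_blinfun_compose)
      also have "\<dots> \<le> \<bar>r\<bar> * norm T" using True by (intro mult_right_mono) auto
      finally have "(norm (\<pi> o\<^sub>L T) + 1) ^ DIM('b) \<le> (\<bar>r\<bar> * norm T + 1) ^ DIM('b)" by (intro power_mono) auto
      then have "ennreal ((norm (\<pi> o\<^sub>L T) + 1) ^ DIM('b)) * hausdorff_const TYPE('b) \<le>
        ennreal ((\<bar>r\<bar> * norm T + 1) ^ DIM('b)) * hausdorff_const TYPE('b)"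
        by (intro mult_right_mono ennreal_leI) auto
      then show ?thesis using area_bound_le_norm[of 1 "\<pi> o\<^sub>L T"] True by (simp add: F_def)
    qed (simp add: F_def)
  qed
  also have "\<dots> < \<infinity>"
    using hausdorff_const_finite[where 'b='b] by (simp add: emeasure_space_1 ennreal_mult_less_top)
  finally have fin: "(\<integral>\<^sup>+\<pi>. F 0 \<pi> \<partial>\<mu>) < \<infinity>" .
  have "(INF k. \<integral>\<^sup>+\<pi>. F k \<pi> \<partial>\<mu>) = (\<integral>\<^sup>+\<pi>. (INF k. F k \<pi>) \<partial>\<mu>)"
  proof (rule nn_integral_monotone_convergence_INF_AE'[where f=F, OF _ Fm fin, symmetric])
    fix k
    have "1 / real (Suc (Suc k)) \<le> 1 / real (Suc k)" by (simp add: frac_le)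
    then show "AE \<pi> in \<mu>. F (Suc k) \<pi> \<le> F k \<pi>"
      unfolding F_def by (intro AE_I2 mult_right_mono area_bound_mono) auto
  qed
  also have "\<dots> \<le> (\<integral>\<^sup>+\<pi>. area_factor (\<pi> o\<^sub>L T) \<partial>\<mu>)"
  proof (rule nn_integral_mono)
    fix \<pi> :: "'a \<Rightarrow>\<^sub>L 'a"
    show "(INF k. F k \<pi>) \<le> area_factor (\<pi> o\<^sub>L T)"
      unfolding area_factor_eq_INF by (intro INF_mono) (auto simp: F_def split: split_indicator)
  qed
  also have "\<dots> = mean_projected_measure DIM('b) \<mu> (T ` cbox 0 One)"
    by (simp add: mean_projected_measure_def area_factor_compose)
  also have "\<dots> \<le> hausdorff_measure DIM('b) (T ` cbox 0 One)"
    by (rule dc_le[OF dc range_in_Grassmannian[OF T]]) (auto intro: borel_compact compact_linear_image_cube)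
  also have "\<dots> < ennreal (1 + \<eta>) * area_factor T"
    using area_factor_less_scaled[OF T \<eta>] by (simp add: area_factor_def)
  finally obtain k where "(\<integral>\<^sup>+\<pi>. F k \<pi> \<partial>\<mu>) < ennreal (1 + \<eta>) * area_factor T"
    unfolding INF_less_iff by blast
  then show ?thesis by (intro that[of "1 / real (Suc k)"]) (auto simp: F_def)
qed

text \<open>For \<open>norm \<pi> \<le> n\<close> the tolerance of \<open>\<pi> \<circ> f\<close> is at most \<open>n * \<epsilon> T\<close>, which is chosen below the
  number \<open>e1\<close> from \<open>mean_area_bound\<close>. One factor \<open>1 + \<eta>\<close> comes from there, the other one from replacing
  \<open>area_factor T * emeasure lborel S\<close> by the measure of the piece.\<close>
lemma mean_projected_measure_le_rectifiable:
  fixes B :: "'a::real_normed_vector set"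
  assumes fd: "finite_dim TYPE('a)" and dc: "density_contractor CARD('m::finite) W \<mu>"
    and B: "B \<in> sets borel" "countably_rectifiable TYPE('m) B"
  shows "mean_projected_measure CARD('m) \<mu> B \<le> hausdorff_measure CARD('m) B"
proof (rule ennreal_le_of_factors[where k=2])
  fix \<eta> :: real assume \<eta>: "0 < \<eta>"
  have dim: "DIM(real^'m) = CARD('m)" by simp
  have dc': "density_contractor DIM(real^'m) W \<mu>" using dc by simp
  let ?H = "hausdorff_measure CARD('m)"
  show "mean_projected_measure CARD('m) \<mu> B \<le> ennreal ((1 + \<eta>) ^ 2) * ?H B"
    unfolding mean_projected_measure_def
  proof (rule nn_integral_le_of_truncations[where U="\<lambda>n. cball 0 (real n) \<inter> space \<mu>"])
    fix n :: nat
    define admissible where "admissible = (\<lambda>(T :: (real^'m) \<Rightarrow>\<^sub>L 'a) e. 0 < e \<and>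
      (\<exists>e1. real n * e < e1 \<and> (\<integral>\<^sup>+\<pi>. area_bound e1 (\<pi> o\<^sub>L T) * indicator (cball 0 (real n)) \<pi> \<partial>\<mu>) \<le> ennreal (1 + \<eta>) * area_factor T) \<and>
      (\<forall>f S. close_to_linear e T f S \<longrightarrow> S \<in> sets borel \<longrightarrow> area_factor T * emeasure lborel S \<le> ennreal (1 + \<eta>) * ?H (f ` S)))"
    define \<epsilon> where "\<epsilon> = (\<lambda>T. SOME e. admissible T e)"
    have admissible: "admissible T (\<epsilon> T)" if T: "inj (blinfun_apply T)" for T
    proof -
      obtain e1 where e1: "0 < e1" "(\<integral>\<^sup>+\<pi>. area_bound e1 (\<pi> o\<^sub>L T) * indicator (cball 0 (real n)) \<pi> \<partial>\<mu>) \<le> ennreal (1 + \<eta>) * area_factor T"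
        by (rule mean_area_bound[OF dc' T \<eta>])
      obtain c where c: "0 < c" "\<And>v. c * norm v \<le> norm (T v)" using inj_blinfun_lower_bound[OF T] by blast
      show ?thesis
      proof (rule close_distortion[OF c(1) \<eta>, where 'b="real^'m" and 'a='a])
        fix e2 :: real
        assume e2: "0 < e2" "\<And>(T :: (real^'m) \<Rightarrow>\<^sub>L 'a) f S.
          (\<And>v. c * norm v \<le> norm (blinfun_apply T v)) \<Longrightarrow> close_to_linear e2 T f S \<Longrightarrow> S \<in> sets borel \<Longrightarrow>
          area_factor T * emeasure lborel S \<le> ennreal (1 + \<eta>) * hausdorff_measure DIM(real^'m) (f ` S) \<and>
          hausdorff_measure DIM(real^'m) (f ` S) \<le> ennreal (1 + \<eta>) * (area_factor T * emeasure lborel S)"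
        \<comment> \<open>The 1 in the denominator keeps \<open>real n * e\<close> strictly below
          \<open>e1\<close>, also for \<open>n = 0\<close>.\<close>
        define e where "e = min e2 (e1 / (real n + 1))"
        have e: "0 < e" "e \<le> e2" using e1 e2 by (auto simp: e_def)
        have "real n * e < (real n + 1) * e" using e by simp
        also have "\<dots> \<le> (real n + 1) * (e1 / (real n + 1))" by (intro mult_left_mono) (auto simp: e_def)
        also have "\<dots> = e1" by simp
        finally have ne: "real n * e < e1" .
        have "admissible T e"
          unfolding admissible_def
        proof (intro conjI e(1) exI[of _ e1] ne e1 allI impI)
          fix f S assume f: "close_to_linear e T f S" and S: "S \<in> sets (borel :: (real^'m) measure)"
          show "area_factor T * emeasure lborel S \<le> ennreal (1 + \<eta>) * ?H (f ` S)"
            using e2(2)[OF c(2) close_to_linear_mono[OF f e(2)] S] by simp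
        qed
        then show ?thesis unfolding \<epsilon>_def by (rule someI)
      qed
    qed
    have \<epsilon>pos: "0 < \<epsilon> T" if "inj (blinfun_apply T)" for T using admissible[OF that] by (simp add: admissible_def)
    show "(\<integral>\<^sup>+\<pi>. ?H (blinfun_apply \<pi> ` B) * indicator (cball 0 (real n) \<inter> space \<mu>) \<pi> \<partial>\<mu>) \<le> ennreal ((1 + \<eta>) ^ 2) * ?H B"
    proof (rule rectifiable_pieces[OF fd B \<epsilon>pos])
      fix f :: "nat \<Rightarrow> real^'m \<Rightarrow> 'a" and K and T and P :: "nat \<Rightarrow> 'a set"
      assume K: "\<And>i. compact (K i)" and T: "\<And>i. P i \<noteq> {} \<Longrightarrow> inj (blinfun_apply (T i))"
        and cl: "\<And>i. P i \<noteq> {} \<Longrightarrow> close_to_linear (\<epsilon> (T i)) (T i) (f i) (K i)"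
        and P: "\<And>i. P i \<in> sets borel" "\<And>i. P i \<subseteq> f i ` K i" "\<And>i. P i \<subseteq> B" "disjoint_family P"
        and N: "?H (B - (\<Union>i. P i)) = 0"
      \<comment> \<open>The pieces are summed under the integral only after passing to these measurable
        majorants, since the lower integral of an arbitrary function need not be subadditive.\<close>
      have "\<exists>u. u \<in> borel_measurable \<mu> \<and> (\<forall>\<pi>\<in>cball 0 (real n). ?H (blinfun_apply \<pi> ` P i) \<le> u \<pi>) \<and>
        (\<integral>\<^sup>+\<pi>. u \<pi> * indicator (cball 0 (real n)) \<pi> \<partial>\<mu>) \<le> ennreal ((1 + \<eta>) ^ 2) * ?H (P i)" for i
      proof (cases "P i = {}")
        case True
        then show ?thesis by (intro exI[of _ "\<lambda>_. 0"]) (simp add: H_empty)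
      next
        case False
        note Ti = T[OF False] and cli = cl[OF False]
        obtain S where S: "S \<subseteq> K i" "S \<in> sets borel" "emeasure lborel S < \<infinity>" "f i ` S = P i"
          using close_to_linear_preimage[OF K cli less_imp_le[OF \<epsilon>pos[OF Ti]] P(1,2)] by blast
        have clS: "close_to_linear (\<epsilon> (T i)) (T i) (f i) S" by (rule close_to_linear_subset[OF cli S(1)])
        obtain e1 where e1: "real n * \<epsilon> (T i) < e1"
          "(\<integral>\<^sup>+\<pi>. area_bound e1 (\<pi> o\<^sub>L T i) * indicator (cball 0 (real n)) \<pi> \<partial>\<mu>) \<le> ennreal (1 + \<eta>) * area_factor (T i)"
          and low: "area_factor (T i) * emeasure lborel S \<le> ennreal (1 + \<eta>) * ?H (f i ` S)"
          using admissible[OF Ti] clS S(2) unfolding admissible_def by blast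
        define u where "u = (\<lambda>\<pi> :: 'a \<Rightarrow>\<^sub>L 'a. area_bound e1 (\<pi> o\<^sub>L T i) * emeasure lborel S)"
        have ub: "(\<lambda>\<pi> :: 'a \<Rightarrow>\<^sub>L 'a. area_bound e1 (\<pi> o\<^sub>L T i)) \<in> borel_measurable borel" by measurable
        have um: "u \<in> borel_measurable \<mu>" unfolding u_def by (intro dc_measurable[OF dc']) measurable
        moreover have "?H (blinfun_apply \<pi> ` P i) \<le> u \<pi>" if "\<pi> \<in> cball 0 (real n)" for \<pi>
        proof -
          have "norm \<pi> * \<epsilon> (T i) \<le> real n * \<epsilon> (T i)"
            using that \<epsilon>pos[OF Ti] by (intro mult_right_mono) auto
          then have "norm \<pi> * \<epsilon> (T i) < e1" using e1(1) by simp
          then have "hausdorff_measure DIM(real^'m) ((\<lambda>x. blinfun_apply \<pi> (f i x)) ` S) \<le> area_bound e1 (\<pi> o\<^sub>L T i) * emeasure lborel S"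
            using \<epsilon>pos[OF Ti] by (intro area_bound_upper[OF close_to_linear_compose[OF clS] _ _ S(2,3)]) auto
          moreover have "(\<lambda>x. blinfun_apply \<pi> (f i x)) ` S = blinfun_apply \<pi> ` P i"
            unfolding S(4)[symmetric] by (simp add: image_image)
          ultimately show ?thesis by (simp add: u_def)
        qed
        moreover have "(\<integral>\<^sup>+\<pi>. u \<pi> * indicator (cball 0 (real n)) \<pi> \<partial>\<mu>) \<le> ennreal ((1 + \<eta>) ^ 2) * ?H (P i)"
        proof -
          have "(\<integral>\<^sup>+\<pi>. u \<pi> * indicator (cball 0 (real n)) \<pi> \<partial>\<mu>) =
            (\<integral>\<^sup>+\<pi>. (area_bound e1 (\<pi> o\<^sub>L T i) * indicator (cball 0 (real n)) \<pi>) * emeasure lborel S \<partial>\<mu>)"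
            by (simp add: u_def mult_ac)
          also have "\<dots> = (\<integral>\<^sup>+\<pi>. area_bound e1 (\<pi> o\<^sub>L T i) * indicator (cball 0 (real n)) \<pi> \<partial>\<mu>) * emeasure lborel S"
            by (intro nn_integral_multc borel_measurable_times_ennreal dc_measurable[OF dc'] ub borel_measurable_indicator borel_closed closed_cball)
          also have "\<dots> \<le> ennreal (1 + \<eta>) * area_factor (T i) * emeasure lborel S"
            by (intro mult_right_mono e1) simp
          also have "\<dots> \<le> ennreal (1 + \<eta>) * (ennreal (1 + \<eta>) * ?H (P i))"
            using low by (simp add: S(4) mult.assoc mult_left_mono)
          also have "\<dots> = ennreal ((1 + \<eta>) ^ 2) * ?H (P i)"
            using \<eta> by (simp add: mult.assoc[symmetric] ennreal_mult[symmetric] power2_eq_square del: ennreal_plus)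
          finally show ?thesis .
        qed
        ultimately show ?thesis by blast
      qed
      then have "\<forall>i. \<exists>u. u \<in> borel_measurable \<mu> \<and> (\<forall>\<pi>\<in>cball 0 (real n). ?H (blinfun_apply \<pi> ` P i) \<le> u \<pi>) \<and>
        (\<integral>\<^sup>+\<pi>. u \<pi> * indicator (cball 0 (real n)) \<pi> \<partial>\<mu>) \<le> ennreal ((1 + \<eta>) ^ 2) * ?H (P i)" by blast
      from choice[OF this] obtain u where u: "\<And>i. u i \<in> borel_measurable \<mu>"
        "\<And>i \<pi>. \<pi> \<in> cball 0 (real n) \<Longrightarrow> ?H (blinfun_apply \<pi> ` P i) \<le> u i \<pi>"
        "\<And>i. (\<integral>\<^sup>+\<pi>. u i \<pi> * indicator (cball 0 (real n)) \<pi> \<partial>\<mu>) \<le> ennreal ((1 + \<eta>) ^ 2) * ?H (P i)" by blast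
      have "(\<integral>\<^sup>+\<pi>. ?H (blinfun_apply \<pi> ` B) * indicator (cball 0 (real n) \<inter> space \<mu>) \<pi> \<partial>\<mu>) \<le>
        (\<integral>\<^sup>+\<pi>. (\<Sum>i. u i \<pi> * indicator (cball 0 (real n)) \<pi>) \<partial>\<mu>)"
      proof (rule nn_integral_mono)
        fix \<pi> :: "'a \<Rightarrow>\<^sub>L 'a"
        show "?H (blinfun_apply \<pi> ` B) * indicator (cball 0 (real n) \<inter> space \<mu>) \<pi> \<le> (\<Sum>i. u i \<pi> * indicator (cball 0 (real n)) \<pi>)"
        proof (cases "\<pi> \<in> cball 0 (real n)")
          case True
          have lip: "(norm \<pi>)-lipschitz_on X (blinfun_apply \<pi>)" for X
            by (rule lipschitz_onI) (use norm_blinfun[of \<pi>] in \<open>auto simp: dist_norm blinfun.diff_right[symmetric]\<close>)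
          have "?H (blinfun_apply \<pi> ` B) \<le> ?H (blinfun_apply \<pi> ` (B - (\<Union>i. P i)) \<union> (\<Union>i. blinfun_apply \<pi> ` P i))"
            by (rule H_mono) auto
          also have "\<dots> \<le> ?H (blinfun_apply \<pi> ` (B - (\<Union>i. P i))) + (\<Sum>i. ?H (blinfun_apply \<pi> ` P i))"
            by (rule order_trans[OF H_subadd2]) (intro add_left_mono H_subadd)
          also have "?H (blinfun_apply \<pi> ` (B - (\<Union>i. P i))) = 0" by (rule hausdorff_null_lipschitz_image[OF lip N])
          also have "0 + (\<Sum>i. ?H (blinfun_apply \<pi> ` P i)) \<le> (\<Sum>i. u i \<pi>)"
            using suminf_le[of "\<lambda>i. ?H (blinfun_apply \<pi> ` P i)" "\<lambda>i. u i \<pi>"] u(2)[OF True] by simp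
          finally show ?thesis using True by (simp split: split_indicator)
        qed simp
      qed
      also have "\<dots> = (\<Sum>i. \<integral>\<^sup>+\<pi>. u i \<pi> * indicator (cball 0 (real n)) \<pi> \<partial>\<mu>)"
        by (intro nn_integral_suminf borel_measurable_times_ennreal u(1) dc_indicator[OF dc']) simp
      also have "\<dots> \<le> (\<Sum>i. ennreal ((1 + \<eta>) ^ 2) * ?H (P i))" by (intro suminf_le u(3)) auto
      also have "\<dots> = ennreal ((1 + \<eta>) ^ 2) * ?H (\<Union>i. P i)"
        using mom_disjoint_suminf[OF mom_H P(1,4), of "CARD('m)"] by simp
      also have "\<dots> \<le> ennreal ((1 + \<eta>) ^ 2) * ?H B" using P(3) by (intro mult_left_mono H_mono) auto
      finally show ?thesis .
    qed
  next
    show "cball 0 (real n) \<inter> space \<mu> \<in> sets \<mu>" for n by (rule dc_sets[OF dc]) simp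
    show "incseq (\<lambda>n. cball 0 (real n) \<inter> space \<mu>)" by (auto simp: incseq_def)
    show "(\<Union>n. cball 0 (real n) \<inter> space \<mu>) = space \<mu>" using real_arch_simple by auto
  qed
qed

section \<open>The Hausdorff measure is at most the gross measure\<close>

text \<open>The sets \<open>G n\<close> exhaust the \<open>\<pi>\<close> for which \<open>\<pi> \<circ> T\<close> is injective, and \<open>area_factor (\<pi> \<circ> T)\<close> vanishes
  for the others. As \<open>\<mu>\<close> is a contractor on the range of T itself, the mean of
  \<open>area_factor (\<pi> \<circ> T)\<close> is exactly \<open>area_factor T\<close>, and some \<open>G n\<close> carries all of it up to a factor
  \<open>1 + \<eta>\<close>. The other two factors come from passing between f and T, and between \<open>\<pi> \<circ> f\<close> and
  \<open>\<pi> \<circ> T\<close>.\<close>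
lemma hausdorff_measure_le_mean_projected:
  fixes T :: "'b::euclidean_space \<Rightarrow>\<^sub>L 'a::real_normed_vector"
  assumes T: "inj (blinfun_apply T)" and dc: "density_contractor DIM('b) (range (blinfun_apply T)) \<mu>"
    and \<eta>: "0 < \<eta>"
  obtains e where "0 < e" "\<And>f S. close_to_linear e T f S \<Longrightarrow> S \<in> sets borel \<Longrightarrow>
    hausdorff_measure DIM('b) (f ` S) \<le> ennreal ((1 + \<eta>) ^ 3) * mean_projected_measure DIM('b) \<mu> (f ` S)"
proof -
  let ?H = "hausdorff_measure DIM('b)"
  define J where "J = (\<lambda>\<pi> :: 'a \<Rightarrow>\<^sub>L 'a. area_factor (\<pi> o\<^sub>L T))"
  have Jb [measurable]: "J \<in> borel_measurable borel" unfolding J_def by measurable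
  define G where "G = (\<lambda>n::nat. {\<pi> :: 'a \<Rightarrow>\<^sub>L 'a. norm \<pi> \<le> real n} \<inter>
    (\<Inter>v. {\<pi>. norm v \<le> real n * norm (blinfun_apply \<pi> (blinfun_apply T v))}))"
  have "closed (G n)" for n
    unfolding G_def by (intro closed_Int closed_INT ballI closed_Collect_le continuous_intros)
  then have Gb [measurable]: "G n \<in> sets borel" for n by (rule borel_closed)
  have Gmono: "G n \<subseteq> G k" if "n \<le> k" for n k
  proof
    fix \<pi> assume \<pi>: "\<pi> \<in> G n"
    have "norm v \<le> real k * norm (blinfun_apply \<pi> (blinfun_apply T v))" for v
    proof -
      have "norm v \<le> real n * norm (blinfun_apply \<pi> (blinfun_apply T v))" using \<pi> by (simp add: G_def)
      also have "\<dots> \<le> real k * norm (blinfun_apply \<pi> (blinfun_apply T v))"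
        using that by (intro mult_right_mono) auto
      finally show ?thesis .
    qed
    moreover have "norm \<pi> \<le> real k" using \<pi> that by (simp add: G_def)
    ultimately show "\<pi> \<in> G k" by (simp add: G_def)
  qed
  have JG: "(SUP n. J \<pi> * indicator (G n) \<pi>) = J \<pi>" for \<pi>
  proof (rule antisym)
    show "(SUP n. J \<pi> * indicator (G n) \<pi>) \<le> J \<pi>" by (rule SUP_least) (auto split: split_indicator)
    show "J \<pi> \<le> (SUP n. J \<pi> * indicator (G n) \<pi>)"
    proof (cases "inj (blinfun_apply (\<pi> o\<^sub>L T))")
      case True
      obtain c where c: "0 < c" "\<And>v. c * norm v \<le> norm ((\<pi> o\<^sub>L T) v)"
        using inj_blinfun_lower_bound[OF True] by blast
      obtain n :: nat where n: "max (norm \<pi>) (1 / c) \<le> real n" using real_arch_simple by blast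
      have "norm v \<le> real n * norm (\<pi> (T v))" for v
      proof -
        have "norm v \<le> 1 / c * norm (\<pi> (T v))" using c(1) c(2)[of v] by (simp add: field_simps)
        also have "\<dots> \<le> real n * norm (\<pi> (T v))" using n by (intro mult_right_mono) auto
        finally show ?thesis .
      qed
      then have "\<pi> \<in> G n" using n by (simp add: G_def)
      then show ?thesis by (intro SUP_upper2[of n]) auto
    qed (simp add: J_def area_factor_noninj)
  qed
  have "(SUP n. \<integral>\<^sup>+\<pi>. J \<pi> * indicator (G n) \<pi> \<partial>\<mu>) = (\<integral>\<^sup>+\<pi>. (SUP n. J \<pi> * indicator (G n) \<pi>) \<partial>\<mu>)"
  proof (rule nn_integral_monotone_convergence_SUP[symmetric])
    show "incseq (\<lambda>n \<pi>. J \<pi> * indicator (G n) \<pi>)"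
      using Gmono by (force simp: incseq_def le_fun_def split: split_indicator)
    show "(\<lambda>\<pi>. J \<pi> * indicator (G n) \<pi>) \<in> borel_measurable \<mu>" for n
      by (rule dc_measurable[OF dc]) measurable
  qed
  also have "\<dots> = mean_projected_measure DIM('b) \<mu> (T ` cbox 0 One)"
    unfolding JG by (simp add: J_def mean_projected_measure_def area_factor_compose)
  also have "\<dots> = area_factor T"
    unfolding area_factor_def by (rule dc_eq[OF dc]) (auto intro: borel_compact compact_linear_image_cube)
  finally have sup: "(SUP n. \<integral>\<^sup>+\<pi>. J \<pi> * indicator (G n) \<pi> \<partial>\<mu>) = area_factor T" .
  have "area_factor T < ennreal (1 + \<eta>) * area_factor T" by (rule area_factor_less_scaled[OF T \<eta>])
  also have "\<dots> = (SUP n. ennreal (1 + \<eta>) * (\<integral>\<^sup>+\<pi>. J \<pi> * indicator (G n) \<pi> \<partial>\<mu>))"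
    unfolding sup[symmetric] by (rule SUP_mult_left_ennreal)
  finally obtain n where n: "area_factor T < ennreal (1 + \<eta>) * (\<integral>\<^sup>+\<pi>. J \<pi> * indicator (G n) \<pi> \<partial>\<mu>)"
    unfolding less_SUP_iff by blast
  obtain c where c: "0 < c" "\<And>v. c * norm v \<le> norm (T v)" using inj_blinfun_lower_bound[OF T] by blast
  have n1: "0 < 1 / (real n + 1)" by simp
  show ?thesis
  proof (rule close_distortion[OF c(1) \<eta>, where 'b='b and 'a='a])
    fix e1 :: real
    assume e1: "0 < e1" "\<And>(T :: 'b \<Rightarrow>\<^sub>L 'a) f S.
      (\<And>v. c * norm v \<le> norm (blinfun_apply T v)) \<Longrightarrow> close_to_linear e1 T f S \<Longrightarrow> S \<in> sets borel \<Longrightarrow>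
      area_factor T * emeasure lborel S \<le> ennreal (1 + \<eta>) * ?H (f ` S) \<and>
      ?H (f ` S) \<le> ennreal (1 + \<eta>) * (area_factor T * emeasure lborel S)"
    show ?thesis
    proof (rule close_distortion[OF n1 \<eta>, where 'b='b and 'a='a])
      fix e2 :: real
      assume e2: "0 < e2" "\<And>(T :: 'b \<Rightarrow>\<^sub>L 'a) f S.
        (\<And>v. 1 / (real n + 1) * norm v \<le> norm (blinfun_apply T v)) \<Longrightarrow> close_to_linear e2 T f S \<Longrightarrow> S \<in> sets borel \<Longrightarrow>
        area_factor T * emeasure lborel S \<le> ennreal (1 + \<eta>) * ?H (f ` S) \<and>
        ?H (f ` S) \<le> ennreal (1 + \<eta>) * (area_factor T * emeasure lborel S)"
      \<comment> \<open>\<open>e1\<close> serves the comparison of f with T, and \<open>e2\<close> that of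
        \<open>\<pi> \<circ> f\<close> with \<open>\<pi> \<circ> T\<close> for
        \<open>\<pi> \<in> G n\<close>, which enlarges the tolerance by the factor
        \<open>norm \<pi> \<le> real n\<close>.\<close>
      define e where "e = min e1 (e2 / (real n + 1))"
      have e: "0 < e" "e \<le> e1" using e1 e2 by (auto simp: e_def)
      show ?thesis
      proof (rule that[OF e(1)])
        fix f and S :: "'b set"
        assume f: "close_to_linear e T f S" and S: "S \<in> sets borel"
        define q where "q = ennreal (1 / (1 + \<eta>))"
        have q: "q * (ennreal (1 + \<eta>) * x) = x" "ennreal (1 + \<eta>) * (q * x) = x" for x
          using \<eta> by (simp_all add: q_def mult.assoc[symmetric] ennreal_mult''[symmetric] del: ennreal_plus)
        have low: "q * (J \<pi> * emeasure lborel S) \<le> ?H (blinfun_apply \<pi> ` f ` S)" if \<pi>: "\<pi> \<in> G n" for \<pi>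
        proof -
          have "norm \<pi> * e \<le> (real n + 1) * (e2 / (real n + 1))"
            using \<pi> e by (intro mult_mono) (auto simp: G_def e_def)
          then have "norm \<pi> * e \<le> e2" by simp
          then have cl: "close_to_linear e2 (\<pi> o\<^sub>L T) (\<lambda>x. blinfun_apply \<pi> (f x)) S"
            using close_to_linear_mono[OF close_to_linear_compose[OF f]] by blast
          have "1 / (real n + 1) * norm v \<le> norm ((\<pi> o\<^sub>L T) v)" for v
          proof -
            have "norm v \<le> real n * norm (\<pi> (T v))" using \<pi> by (simp add: G_def)
            also have "\<dots> \<le> (real n + 1) * norm (\<pi> (T v))" by (intro mult_right_mono) auto
            finally show ?thesis by (simp add: field_simps)
          qed
          then have "J \<pi> * emeasure lborel S \<le> ennreal (1 + \<eta>) * ?H ((\<lambda>x. blinfun_apply \<pi> (f x)) ` S)"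
            unfolding J_def using e2(2)[OF _ cl S] by blast
          then have "q * (J \<pi> * emeasure lborel S) \<le> q * (ennreal (1 + \<eta>) * ?H ((\<lambda>x. blinfun_apply \<pi> (f x)) ` S))"
            by (intro mult_left_mono) auto
          then show ?thesis unfolding q by (simp add: image_image)
        qed
        have "q * ((\<integral>\<^sup>+\<pi>. J \<pi> * indicator (G n) \<pi> \<partial>\<mu>) * emeasure lborel S) =
          (\<integral>\<^sup>+\<pi>. q * ((J \<pi> * indicator (G n) \<pi>) * emeasure lborel S) \<partial>\<mu>)"
        proof -
          have m1: "(\<lambda>\<pi>. J \<pi> * indicator (G n) \<pi>) \<in> borel_measurable \<mu>"
            by (rule dc_measurable[OF dc]) measurable
          then have m2: "(\<lambda>\<pi>. (J \<pi> * indicator (G n) \<pi>) * emeasure lborel S) \<in> borel_measurable \<mu>" by measurable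
          show ?thesis unfolding nn_integral_cmult[OF m2] nn_integral_multc[OF m1] ..
        qed
        also have "\<dots> \<le> mean_projected_measure DIM('b) \<mu> (f ` S)"
          unfolding mean_projected_measure_def
          by (intro nn_integral_mono) (use low in \<open>auto split: split_indicator\<close>)
        finally have mean: "q * ((\<integral>\<^sup>+\<pi>. J \<pi> * indicator (G n) \<pi> \<partial>\<mu>) * emeasure lborel S) \<le> mean_projected_measure DIM('b) \<mu> (f ` S)" .
        let ?a = "ennreal (1 + \<eta>)" and ?I = "\<integral>\<^sup>+\<pi>. J \<pi> * indicator (G n) \<pi> \<partial>\<mu>"
        have "?H (f ` S) \<le> ?a * (area_factor T * emeasure lborel S)"
          using e1(2)[OF c(2) close_to_linear_mono[OF f e(2)] S] by blast
        also have "\<dots> \<le> ?a * ((?a * ?I) * emeasure lborel S)"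
          using n by (intro mult_left_mono mult_right_mono) auto
        also have "\<dots> = ?a * (?a * (?a * (q * (?I * emeasure lborel S))))"
          by (simp only: q mult.assoc)
        also have "\<dots> \<le> ?a * (?a * (?a * mean_projected_measure DIM('b) \<mu> (f ` S)))"
          by (intro mult_left_mono mean) auto
        also have "\<dots> = ennreal ((1 + \<eta>) ^ 3) * mean_projected_measure DIM('b) \<mu> (f ` S)"
          using \<eta> by (simp add: mult.assoc[symmetric] ennreal_mult[symmetric] power3_eq_cube del: ennreal_plus)
        finally show "?H (f ` S) \<le> ennreal ((1 + \<eta>) ^ 3) * mean_projected_measure DIM('b) \<mu> (f ` S)" .
      qed
    qed
  qed
qed

lemma countably_rectifiable_subset:
  assumes A: "countably_rectifiable TYPE('m::finite) A" and "B \<subseteq> A"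
  shows "countably_rectifiable TYPE('m) B"
proof -
  obtain S :: "nat \<Rightarrow> (real^'m) set" and f where
    "(\<forall>j. bounded (S j) \<and> (\<exists>L. L-lipschitz_on (S j) (f j))) \<and>
      hausdorff_measure CARD('m) (A - (\<Union>j. f j ` S j)) = 0"
    using A unfolding countably_rectifiable_def by (elim exE)
  moreover have "hausdorff_measure CARD('m) (B - (\<Union>j. f j ` S j)) \<le> hausdorff_measure CARD('m) (A - (\<Union>j. f j ` S j))"
    using \<open>B \<subseteq> A\<close> by (intro H_mono) auto
  ultimately show ?thesis unfolding countably_rectifiable_def by (intro exI[of _ S] exI[of _ f]) auto
qed

lemma gross_delta_eq_cc: "gross_delta m \<mu> = cc_delta (sets borel) (gross_zeta m \<mu>)"
  by (simp add: fun_eq_iff gross_delta_def cc_delta_def)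

lemma gross_measure_eq_cc: "gross_measure m \<mu> = cc_measure (sets borel) (gross_zeta m \<mu>)"
  by (simp add: fun_eq_iff gross_measure_def cc_measure_def gross_delta_eq_cc)

lemma mean_projected_measure_mono: "A \<subseteq> B \<Longrightarrow> mean_projected_measure m \<mu> A \<le> mean_projected_measure m \<mu> B"
  unfolding mean_projected_measure_def by (intro nn_integral_mono H_mono) auto

lemma gross_zeta_mono: "A \<subseteq> B \<Longrightarrow> gross_zeta m \<mu> A \<le> gross_zeta m \<mu> B"
  unfolding gross_zeta_def by (intro SUP_mono' mean_projected_measure_mono)

lemma gross_zeta_empty: "gross_zeta m \<mu> {} = 0"
proof -
  have "gross_zeta m \<mu> {} \<le> 0"
    unfolding gross_zeta_def by (rule SUP_least) (simp add: mean_projected_measure_def H_empty)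
  then show ?thesis by simp
qed

lemma metric_outer_measure_gross: "metric_outer_measure (gross_measure m \<mu>)"
  unfolding gross_measure_eq_cc by (rule metric_outer_measure_cc) (auto simp: gross_zeta_empty)

section \<open>Equality of the two measures\<close>

text \<open>A partition of A into Borel sets of small diameter is an admissible cover, and H is additive on
  it.\<close>
lemma gross_measure_le_hausdorff:
  fixes A :: "'a::real_normed_vector set"
  assumes fd: "finite_dim TYPE('a)" and \<mu>: "choice_of_density_contractors CARD('m::finite) \<mu>"
    and A: "A \<in> sets borel" "countably_rectifiable TYPE('m) A"
  shows "gross_measure CARD('m) \<mu> A \<le> hausdorff_measure CARD('m) A"
proof -
  let ?H = "hausdorff_measure CARD('m)"
  have zeta: "gross_zeta CARD('m) \<mu> B \<le> ?H B" if B: "B \<in> sets borel" "B \<subseteq> A" for B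
    unfolding gross_zeta_def
  proof (rule SUP_least)
    fix W :: "'a set" assume "W \<in> Grassmannian CARD('m)"
    then have "density_contractor CARD('m) W (\<mu> W)" using \<mu> by (simp add: choice_of_density_contractors_def)
    then show "mean_projected_measure CARD('m) (\<mu> W) B \<le> ?H B"
      by (rule mean_projected_measure_le_rectifiable[OF fd _ B(1) countably_rectifiable_subset[OF A(2) B(2)]])
  qed
  obtain D :: "'a set" where D: "countable D" "\<And>x e. 0 < e \<Longrightarrow> \<exists>d\<in>D. norm (x - d) < e"
    using finite_dim_separable[OF fd] by blast
  have D0: "D \<noteq> {}" using D(2)[of 1] by force
  show ?thesis
    unfolding gross_measure_def
  proof (rule SUP_least)
    fix \<delta> :: ennreal assume "\<delta> \<in> {0<..}"
    then obtain r :: real where r: "0 < r" "ennreal r \<le> \<delta>"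
      by (cases \<delta>) (auto simp: ennreal_less_zero_iff intro: that[of 1])
    define Q where "Q = (\<lambda>i. A \<inter> ball (from_nat_into D i) (r / 4))"
    define B where "B = disjointed Q"
    have Qb: "Q i \<in> sets borel" for i unfolding Q_def using A(1) by (simp add: sets.Int)
    have Bb: "B i \<in> sets borel" for i
      using sets.range_disjointed_sets[of Q borel] Qb unfolding B_def by blast
    have BQ: "B i \<subseteq> Q i" for i unfolding B_def by (rule disjointed_subset)
    have UB: "(\<Union>i. B i) = A"
    proof -
      have "(\<Union>i. B i) = (\<Union>i. Q i)" unfolding B_def by (rule UN_disjointed_eq)
      also have "\<dots> = A"
      proof
        show "A \<subseteq> (\<Union>i. Q i)"
        proof
          fix x assume x: "x \<in> A"
          obtain d where d: "d \<in> D" "norm (x - d) < r / 4" using D(2)[of "r / 4" x] r by auto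
          then obtain i where "d = from_nat_into D i" using from_nat_into_surj[OF D(1)] by metis
          then have "x \<in> Q i" using x d by (simp add: Q_def dist_norm norm_minus_commute)
          then show "x \<in> (\<Union>i. Q i)" by blast
        qed
      qed (auto simp: Q_def)
      finally show ?thesis .
    qed
    have diam: "ediam (B i) < \<delta>" for i
    proof -
      have "ediam (B i) \<le> ennreal (r / 2)"
      proof (intro ediam_le ennreal_leI)
        fix x y assume "x \<in> B i" "y \<in> B i"
        then have "dist (from_nat_into D i) x < r / 4" "dist (from_nat_into D i) y < r / 4"
          using BQ[of i] by (auto simp: Q_def)
        then show "dist x y \<le> r / 2" using dist_triangle3[of x y "from_nat_into D i"] by simp
      qed
      also have "\<dots> < ennreal r" using r by (simp add: ennreal_less_iff)
      finally show ?thesis using r by simp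
    qed
    have "gross_delta CARD('m) \<mu> \<delta> A \<le> (\<Sum>i. gross_zeta CARD('m) \<mu> (B i))"
      unfolding gross_delta_eq_cc by (rule cc_delta_le) (use Bb UB diam in auto)
    also have "\<dots> \<le> (\<Sum>i. ?H (B i))" using UB by (intro suminf_le zeta Bb) auto
    also have "\<dots> = ?H A"
      using mom_disjoint_suminf[OF mom_H, of B] Bb UB by (simp add: B_def disjoint_family_disjointed)
    finally show "gross_delta CARD('m) \<mu> \<delta> A \<le> ?H A" .
  qed
qed

text \<open>Given a Borel cover \<open>B j\<close> of a piece, \<open>H (P i \<inter> B j)\<close> is at most \<open>(1 + \<eta>) ^ 3\<close> times the weight of
  \<open>B j\<close>, because the plane of the approximating linear map competes in the supremum that defines the
  weight.\<close>
lemma hausdorff_le_gross_measure: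
  fixes A :: "'a::real_normed_vector set"
  assumes fd: "finite_dim TYPE('a)" and \<mu>: "choice_of_density_contractors CARD('m::finite) \<mu>"
    and A: "A \<in> sets borel" "countably_rectifiable TYPE('m) A"
  shows "hausdorff_measure CARD('m) A \<le> gross_measure CARD('m) \<mu> A"
proof (rule ennreal_le_of_factors[where k=3])
  fix \<eta> :: real assume \<eta>: "0 < \<eta>"
  let ?H = "hausdorff_measure CARD('m)" and ?G = "gross_measure CARD('m) \<mu>"
  let ?a = "ennreal ((1 + \<eta>) ^ 3)"
  define admissible where "admissible = (\<lambda>(T :: (real^'m) \<Rightarrow>\<^sub>L 'a) e. 0 < e \<and>
    (\<forall>f S. close_to_linear e T f S \<longrightarrow> S \<in> sets borel \<longrightarrow> ?H (f ` S) \<le> ?a * gross_zeta CARD('m) \<mu> (f ` S)))"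
  define \<epsilon> where "\<epsilon> = (\<lambda>T. SOME e. admissible T e)"
  have admissible: "admissible T (\<epsilon> T)" if T: "inj (blinfun_apply T)" for T
  proof -
    let ?W = "range (blinfun_apply T)"
    have W: "?W \<in> Grassmannian CARD('m)" using range_in_Grassmannian[OF T] by simp
    then have dc: "density_contractor DIM(real^'m) ?W (\<mu> ?W)"
      using \<mu> by (simp add: choice_of_density_contractors_def)
    show ?thesis
    proof (rule hausdorff_measure_le_mean_projected[OF T dc \<eta>])
      fix e assume e: "0 < e" "\<And>f S. close_to_linear e T f S \<Longrightarrow> S \<in> sets borel \<Longrightarrow>
        hausdorff_measure DIM(real^'m) (f ` S) \<le> ?a * mean_projected_measure DIM(real^'m) (\<mu> ?W) (f ` S)"
      have "admissible T e"
        unfolding admissible_def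
      proof (intro conjI e(1) allI impI)
        fix f S assume f: "close_to_linear e T f S" "S \<in> sets (borel :: (real^'m) measure)"
        have "?H (f ` S) \<le> ?a * mean_projected_measure CARD('m) (\<mu> ?W) (f ` S)" using e(2)[OF f] by simp
        also have "\<dots> \<le> ?a * gross_zeta CARD('m) \<mu> (f ` S)"
          unfolding gross_zeta_def using W by (intro mult_left_mono SUP_upper) auto
        finally show "?H (f ` S) \<le> ?a * gross_zeta CARD('m) \<mu> (f ` S)" .
      qed
      then show ?thesis unfolding \<epsilon>_def by (rule someI)
    qed
  qed
  have \<epsilon>pos: "0 < \<epsilon> T" if "inj (blinfun_apply T)" for T using admissible[OF that] by (simp add: admissible_def)
  show "?H A \<le> ?a * ?G A"
  proof (rule rectifiable_pieces[OF fd A \<epsilon>pos])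
    fix f :: "nat \<Rightarrow> real^'m \<Rightarrow> 'a" and K and T and P :: "nat \<Rightarrow> 'a set"
    assume K: "\<And>i. compact (K i)" and T: "\<And>i. P i \<noteq> {} \<Longrightarrow> inj (blinfun_apply (T i))"
      and cl: "\<And>i. P i \<noteq> {} \<Longrightarrow> close_to_linear (\<epsilon> (T i)) (T i) (f i) (K i)"
      and P: "\<And>i. P i \<in> sets borel" "\<And>i. P i \<subseteq> f i ` K i" "\<And>i. P i \<subseteq> A" "disjoint_family P"
      and N: "?H (A - (\<Union>i. P i)) = 0"
    have sub: "?H Q \<le> ?a * gross_zeta CARD('m) \<mu> Q" if Q: "Q \<in> sets borel" "Q \<subseteq> P i" for Q i
    proof (cases "P i = {}")
      case True
      then show ?thesis using Q by (simp add: H_empty)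
    next
      case False
      obtain S where S: "S \<subseteq> K i" "S \<in> sets borel" "emeasure lborel S < \<infinity>" "f i ` S = Q"
        using close_to_linear_preimage[OF K cl[OF False] less_imp_le[OF \<epsilon>pos[OF T[OF False]]] Q(1) order_trans[OF Q(2) P(2)]]
        by blast
      have "close_to_linear (\<epsilon> (T i)) (T i) (f i) S" by (rule close_to_linear_subset[OF cl[OF False] S(1)])
      then have "?H (f i ` S) \<le> ?a * gross_zeta CARD('m) \<mu> (f i ` S)"
        using admissible[OF T[OF False]] S(2) unfolding admissible_def by blast
      then show ?thesis by (simp only: S(4))
    qed
    define b where "b = ennreal (1 / (1 + \<eta>) ^ 3)"
    have b: "b * (?a * x) = x" "?a * (b * x) = x" for x
      using \<eta> by (simp_all add: b_def mult.assoc[symmetric] ennreal_mult''[symmetric])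
    have piece: "?H (P i) \<le> ?a * ?G (P i)" for i
    proof -
      have "b * ?H (P i) \<le> gross_delta CARD('m) \<mu> \<infinity> (P i)"
        unfolding gross_delta_def
      proof (rule INF_greatest, clarify)
        fix B :: "nat \<Rightarrow> 'a set" assume B: "\<forall>j. B j \<in> sets borel" "P i \<subseteq> (\<Union>j. B j)"
        have "?H (P i) \<le> ?H (\<Union>j. P i \<inter> B j)" using B(2) by (intro H_mono) auto
        also have "\<dots> \<le> (\<Sum>j. ?H (P i \<inter> B j))" by (rule H_subadd)
        also have "\<dots> \<le> (\<Sum>j. ?a * gross_zeta CARD('m) \<mu> (B j))"
        proof (intro suminf_le)
          fix j
          have "?H (P i \<inter> B j) \<le> ?a * gross_zeta CARD('m) \<mu> (P i \<inter> B j)"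
            using B(1) P(1) by (intro sub[of _ i]) auto
          also have "\<dots> \<le> ?a * gross_zeta CARD('m) \<mu> (B j)"
            by (intro mult_left_mono gross_zeta_mono) auto
          finally show "?H (P i \<inter> B j) \<le> ?a * gross_zeta CARD('m) \<mu> (B j)" .
        qed auto
        also have "\<dots> = ?a * (\<Sum>j. gross_zeta CARD('m) \<mu> (B j))" by simp
        finally have "b * ?H (P i) \<le> b * (?a * (\<Sum>j. gross_zeta CARD('m) \<mu> (B j)))"
          by (intro mult_left_mono) auto
        then show "b * ?H (P i) \<le> (\<Sum>j. gross_zeta CARD('m) \<mu> (B j))" unfolding b .
      qed
      also have "\<dots> \<le> ?G (P i)"
        unfolding gross_delta_eq_cc gross_measure_eq_cc by (rule cc_delta_le_measure) simp
      finally have "?a * (b * ?H (P i)) \<le> ?a * ?G (P i)" by (intro mult_left_mono) auto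
      then show ?thesis unfolding b .
    qed
    have "?H A \<le> ?H ((\<Union>i. P i) \<union> (A - (\<Union>i. P i)))" by (rule H_mono) auto
    also have "\<dots> \<le> ?H (\<Union>i. P i) + ?H (A - (\<Union>i. P i))" by (rule H_subadd2)
    also have "\<dots> \<le> (\<Sum>i. ?H (P i))" unfolding N using H_subadd by simp
    also have "\<dots> \<le> (\<Sum>i. ?a * ?G (P i))" by (intro suminf_le piece) auto
    also have "\<dots> = ?a * ?G (\<Union>i. P i)"
      using mom_disjoint_suminf[OF metric_outer_measure_gross P(1,4), of "CARD('m)" \<mu>] by simp
    also have "\<dots> \<le> ?a * ?G A"
      using P(3) by (intro mult_left_mono mom_mono[OF metric_outer_measure_gross]) auto
    finally show ?thesis .
  qed
qed

theorem theorem6p7: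
  fixes m :: nat
    and A :: "'a::real_normed_vector set"
    and \<mu> :: "'a set \<Rightarrow> ('a \<Rightarrow>\<^sub>L 'a) measure"
  assumes "finite_dim TYPE('a)"
    and "m = CARD('m::finite)"
    and "1 \<le> m" and "m \<le> dim (UNIV :: 'a set) - 1"
    and "admits_density_contractors TYPE('a) m"
    and "choice_of_density_contractors m \<mu>"
    and "A \<in> sets borel"
    and "countably_rectifiable TYPE('m) A"
  shows "gross_measure m \<mu> A = hausdorff_measure m A"
proof (rule antisym)
  show "gross_measure m \<mu> A \<le> hausdorff_measure m A"
    unfolding assms(2) by (rule gross_measure_le_hausdorff) (use assms in auto)
  show "hausdorff_measure m A \<le> gross_measure m \<mu> A"
    unfolding assms(2) by (rule hausdorff_le_gross_measure) (use assms in auto)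
qed

end
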